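(* Let $\rho\in\mathbb{R}$, $\tau>0$, $\kappa\ge 0$, and let $K$ be the $2\tau$-periodic step pulse equal to $0$ on $[2n\tau,(2n+1)\tau)$ and to $\kappa$ on $[(2n+1)\tau,(2n+2)\tau)$, $n\in\mathbb{Z}$. Set $$\delta^-=\min\{W''(x):x\in[\rho-1,\rho+1]\},\qquad \delta^+=\max\{W''(x):x\in[\rho-1,\rho+1]\}.$$ Assume that $\beta>0$, $0<\alpha<1/2$ and $a,b\in\mathbb{R}$ with $1/2+\alpha\le b-a<1$ are such that $$\kappa\cdot V'(x)\ge\delta^++\beta\qquad\text{for all }x\in[a,b].$$ Then $$v(\rho,\tau)\ge\frac1\tau\left(\frac{\alpha}{2}-d(\rho,\tau)^{1/2}+d(\rho,\tau)-\frac14\left[\left(1/2+\alpha-\beta\tau-2d(\rho,\tau)^{1/2}\right)\vee 0\right]^2\right),$$ where $$d(\rho,\tau)=\left[\inf_{p/q}\left(\frac1{4q}+\frac q4\left|\frac pq-\rho\right|+\frac{q}{\sqrt{12}}\cdot\frac{\delta^+}{\left(2(\delta^-)^3\tau+\delta^+\delta^-\right)^{1/2}}\right)\right]\wedge\frac14,$$ the infimum being over all rationals $p/q$ with $p,q$ relatively prime integers, $q\ge1$.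
   Context: Standing assumptions: $W,V:\mathbb{R}\to\mathbb{R}$ are $C^2$; $W''$ is positive and bounded away from zero; $V(x+1)=V(x)$ for all $x$. The dynamics is, for $k\in\mathbb{Z}$, $$\frac{d}{dt}u_k(t)=W'(u_{k+1}-u_k)-W'(u_k-u_{k-1})+K(t)V'(u_k).$$ A configuration $u\in\mathbb{R}^{\mathbb{Z}}$ has bounded width with mean spacing $\rho$ and constant $n$ (a positive integer) if $|u_{j+k}-u_j-k\rho|\le n$ for all $j,k\in\mathbb{Z}$, $k\ge1$. The transport speed $v(\rho)=v(\rho,\tau)$ is the unique number such that for every solution $u(t)$ whose initial configuration $u(t_0)$ has bounded width with mean spacing $\rho$ and constant $n$, and all $k,m\in\mathbb{Z}$, $m\ge1$, one has $\left|\frac{u_k(t_0+2m\tau)-u_k(t_0)}{2m\tau}-v(\rho)\right|\le\frac{n+2}{2m\tau}$ (in particular it is the limit of these quotients as $m\to\infty$). Symbols $\vee,\wedge$ denote maximum and minimum of two numbers. *)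

theory Defs
  imports "HOL-Analysis.Analysis"
begin

definition C2 :: "(real \<Rightarrow> real) \<Rightarrow> bool" where
  "C2 f \<longleftrightarrow> (\<forall>x. f differentiable at x) \<and> (\<forall>x. deriv f differentiable at x) \<and>
     continuous_on UNIV (deriv (deriv f))"

definition bounded_width :: "real \<Rightarrow> nat \<Rightarrow> (int \<Rightarrow> real) \<Rightarrow> bool" where
  "bounded_width \<rho> n u \<longleftrightarrow>
     (\<forall>j k :: int. k \<ge> 1 \<longrightarrow> \<bar>u (j + k) - u j - of_int k * \<rho>\<bar> \<le> real n)"

text \<open>
  Forward solutions on \<open>[t0, \<infinity>)\<close>. The pulse \<open>K\<close> may jump, so the coordinates are required to be
  continuous throughout and to satisfy the equation wherever \<open>K\<close> is continuous.
  The last conjunct says that the solution stays in the phase space of configurations with bounded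
  spacing, locally uniformly in time. Such a condition cannot be dropped: already for
  \<open>W x = x\<^sup>2 / 2\<close>, \<open>V = 0\<close> (the discrete heat equation) Tychonoff-type solutions, which start at 0 and
  grow arbitrarily fast in \<open>k\<close> for later times, would destroy uniqueness and hence the transport speed.
\<close>

definition FK_solution ::
  "(real \<Rightarrow> real) \<Rightarrow> (real \<Rightarrow> real) \<Rightarrow> (real \<Rightarrow> real) \<Rightarrow> real \<Rightarrow> (real \<Rightarrow> int \<Rightarrow> real) \<Rightarrow> bool" where
  "FK_solution W V K t0 u \<longleftrightarrow>
     (\<forall>k. continuous_on {t0..} (\<lambda>t. u t k)) \<and>
     (\<forall>k. \<forall>t>t0. isCont K t \<longrightarrow>
        ((\<lambda>s. u s k) has_real_derivative
           (deriv W (u t (k + 1) - u t k) - deriv W (u t k - u t (k - 1)) + K t * deriv V (u t k)))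
        (at t)) \<and>
     (\<forall>T. \<exists>B. \<forall>t\<in>{t0..T}. \<forall>k. \<bar>u t (k + 1) - u t k\<bar> \<le> B)"

definition is_transport_speed ::
  "(real \<Rightarrow> real) \<Rightarrow> (real \<Rightarrow> real) \<Rightarrow> (real \<Rightarrow> real) \<Rightarrow> real \<Rightarrow> real \<Rightarrow> real \<Rightarrow> bool" where
  "is_transport_speed W V K \<tau> \<rho> v \<longleftrightarrow>
     (\<forall>t0 u n. n \<ge> 1 \<and> FK_solution W V K t0 u \<and> bounded_width \<rho> n (u t0) \<longrightarrow>
        (\<forall>k m :: int. m \<ge> 1 \<longrightarrow>
           \<bar>(u (t0 + 2 * of_int m * \<tau>) k - u t0 k) / (2 * of_int m * \<tau>) - v\<bar>
             \<le> (real n + 2) / (2 * of_int m * \<tau>)))"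

definition transport_speed ::
  "(real \<Rightarrow> real) \<Rightarrow> (real \<Rightarrow> real) \<Rightarrow> (real \<Rightarrow> real) \<Rightarrow> real \<Rightarrow> real \<Rightarrow> real" where
  "transport_speed W V K \<tau> \<rho> = (THE v. is_transport_speed W V K \<tau> \<rho> v)"

text \<open>For \<open>C2 W\<close> the infimum and supremum below are attained, i.e. are a minimum and a maximum.\<close>

definition delta_minus :: "(real \<Rightarrow> real) \<Rightarrow> real \<Rightarrow> real" where
  "delta_minus W \<rho> = (INF x\<in>{\<rho> - 1..\<rho> + 1}. deriv (deriv W) x)"

definition delta_plus :: "(real \<Rightarrow> real) \<Rightarrow> real \<Rightarrow> real" where
  "delta_plus W \<rho> = (SUP x\<in>{\<rho> - 1..\<rho> + 1}. deriv (deriv W) x)"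

definition d_FK :: "(real \<Rightarrow> real) \<Rightarrow> real \<Rightarrow> real \<Rightarrow> real" where
  "d_FK W \<rho> \<tau> =
     min (INF (p, q)\<in>{(p :: int, q :: int). coprime p q \<and> q \<ge> 1}.
            1 / (4 * of_int q) + of_int q / 4 * \<bar>of_int p / of_int q - \<rho>\<bar>
            + of_int q / sqrt 12 *
              (delta_plus W \<rho> /
               sqrt (2 * delta_minus W \<rho> ^ 3 * \<tau> + delta_plus W \<rho> * delta_minus W \<rho>)))
         (1 / 4)"

end

theory Submission
  imports Defs
begin

text \<open>
  \<^bold>\<open>The speed exists.\<close> The chain is cooperative: a particle is never pushed back when its neighbours
  move forward, so solutions that start ordered stay ordered (\<open>comparison\<close>). The dynamics commutes
  with shifts of the index and, because \<open>V\<close> has period 1, with integer translations. Comparing a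
  solution with its own translates shows that a chain started with equal spacing \<open>\<rho>\<close> keeps
  all distances \<open>u\<^sub>j - u\<^sub>k\<close> within 1 of \<open>(j - k) \<rho>\<close> (\<open>linear_width\<close>), and that its
  displacement over \<open>m\<close> periods is additive in \<open>m\<close> up to 2. A quasi-additive sequence is within the
  same constant of a linear one (\<open>quasi_additive_near_linear\<close>), whose slope is the advance per period.
  A configuration of width \<open>n\<close> lies between two equally spaced ones at heights at most \<open>n\<close> apart,
  which gives the tolerance \<open>n + 2\<close> of the definition (\<open>bounded_width_rotation\<close>).
  Uniqueness of the speed needs at least one solution; it comes from a fixed point of the
  integral equation (\<open>solution_exists\<close>, \<open>linear_exists\<close>).

  \<^bold>\<open>The lower bound.\<close> It suffices to follow the chain that starts equally spaced, and to average over
  windows of \<open>N\<close> consecutive particles; boundary terms are of order \<open>1 / N\<close>.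

  While the pulse is off, elastic forces cancel in the average, so the chain does not advance
  (\<open>off_phase_displacement\<close>). It relaxes, however: the elastic energy \<open>F\<close> satisfies
  \<open>F' \<le> - m\<^sup>2 F\<^sup>2\<close>, because a small width turns a large energy into large forces. At the end of
  the phase the mean square of \<open>u\<^sub>k\<^sub>+\<^sub>1 - u\<^sub>k - \<rho>\<close> is at most
  \<open>(\<delta>\<^sup>+)\<^sup>2 / (2 (\<delta>\<^sup>-)\<^sup>3 \<tau> + \<delta>\<^sup>+ \<delta>\<^sup>-)\<close>
  (\<open>off_phase_variance\<close>). A block of \<open>q\<close> consecutive particles is then close to an arithmetic progression
  with step \<open>p / q\<close>, whose points are equally spaced modulo 1. The three terms of \<open>d(\<rho>, \<tau>)\<close> are the
  transport costs from \<open>q\<close> equally spaced points to the uniform measure, from slope \<open>\<rho>\<close> to slope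
  \<open>p / q\<close>, and from the actual block to an exact one (\<open>window_average_le\<close>). On the circle, a transport
  distance \<open>d\<close> to the uniform measure forces every arc to have its share of particles up to
  \<open>D = 2 \<surd>d\<close>: a trapezoidal test function over an overfull arc would reveal a cost above \<open>D\<^sup>2 / 4\<close>
  (\<open>card_below_ge\<close>).

  While the pulse is on, the elastic force is at least \<open>- \<delta>\<^sup>+\<close>, so inside the
  arc from \<open>a\<close> to \<open>b\<close> the velocity is at least \<open>\<beta>\<close>, and \<open>b\<close> cannot be crossed backwards. A particle at
  distance \<open>y \<in> (0, 1]\<close> above \<open>a\<close> modulo 1 thus advances at least \<open>(b - a) - max y (b - a - \<beta> \<tau>)\<close>
  (\<open>on_phase_displacement\<close>). Averaging this function over all \<open>y\<close>, given only the lower bounds \<open>s - D\<close> for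
  the fraction of particles with \<open>y \<le> s\<close>, yields the stated expression (\<open>sum_max_le\<close>, \<open>period_gain\<close>).
\<close>

section \<open>Monotonicity from derivatives off a finite set\<close>

text \<open>
  The coordinates of a solution are continuous but need not be differentiable at the jumps of the
  pulse, of which there are finitely many in bounded time.
\<close>

lemma increasing_off_finite:
  fixes f :: "real \<Rightarrow> real"
  assumes "finite S" "a \<le> b" "continuous_on {a..b} f"
    and "\<And>x. a < x \<Longrightarrow> x < b \<Longrightarrow> x \<notin> S \<Longrightarrow> \<exists>D\<ge>0. (f has_real_derivative D) (at x)"
  shows "f a \<le> f b"
  using assms
proof (induction S arbitrary: a b rule: finite_induct)
  case empty
  then show ?case
    by (intro DERIV_nonneg_imp_increasing_open[of a b f]) auto
next
  case (insert s S)
  show ?case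
  proof (cases "a < s \<and> s < b")
    case True
    have "f a \<le> f s"
      using True insert.prems by (intro insert.IH) (auto intro: continuous_on_subset)
    also have "f s \<le> f b"
      using True insert.prems by (intro insert.IH) (auto intro: continuous_on_subset)
    finally show ?thesis .
  next
    case False
    then show ?thesis
      using insert.prems by (intro insert.IH) auto
  qed
qed

lemma bounded_change_off_finite:
  fixes f :: "real \<Rightarrow> real"
  assumes "finite S" "a \<le> b" "continuous_on {a..b} f"
    and "\<And>x. a < x \<Longrightarrow> x < b \<Longrightarrow> x \<notin> S \<Longrightarrow> \<exists>D. \<bar>D\<bar> \<le> C \<and> (f has_real_derivative D) (at x)"
  shows "\<bar>f b - f a\<bar> \<le> C * (b - a)"
proof -
  have "(\<lambda>x. C * x - f x) a \<le> (\<lambda>x. C * x - f x) b"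
  proof (rule increasing_off_finite[OF assms(1,2)])
    show "continuous_on {a..b} (\<lambda>x. C * x - f x)" by (intro continuous_intros assms)
    show "\<exists>D\<ge>0. ((\<lambda>x. C * x - f x) has_real_derivative D) (at x)"
      if x: "a < x" "x < b" "x \<notin> S" for x
    proof -
      obtain D where D: "\<bar>D\<bar> \<le> C" "(f has_real_derivative D) (at x)" using assms(4)[OF x] by blast
      have "((\<lambda>x. C * x - f x) has_real_derivative (C - D)) (at x)"
        using D by (auto intro!: derivative_eq_intros)
      then show ?thesis using D by (intro exI[of _ "C - D"]) auto
    qed
  qed
  moreover have "(\<lambda>x. C * x + f x) a \<le> (\<lambda>x. C * x + f x) b"
  proof (rule increasing_off_finite[OF assms(1,2)])
    show "continuous_on {a..b} (\<lambda>x. C * x + f x)" by (intro continuous_intros assms)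
    show "\<exists>D\<ge>0. ((\<lambda>x. C * x + f x) has_real_derivative D) (at x)"
      if x: "a < x" "x < b" "x \<notin> S" for x
    proof -
      obtain D where D: "\<bar>D\<bar> \<le> C" "(f has_real_derivative D) (at x)" using assms(4)[OF x] by blast
      have "((\<lambda>x. C * x + f x) has_real_derivative (C + D)) (at x)"
        using D by (auto intro!: derivative_eq_intros)
      then show ?thesis using D by (intro exI[of _ "C + D"]) auto
    qed
  qed
  ultimately show ?thesis by (auto simp: algebra_simps abs_le_iff)
qed

lemma periodic_int:
  fixes f :: "real \<Rightarrow> 'a"
  assumes "\<And>x. f (x + 1) = f x"
  shows "f (x + of_int n) = f x"
proof -
  have nat: "f (x + of_nat m) = f x" for x m
  proof (induction m)
    case (Suc m)
    then show ?case using assms[of "x + of_nat m"] by (simp add: add_ac)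
  qed simp
  show ?thesis
  proof (cases "n \<ge> 0")
    case True
    then show ?thesis using nat[of x "nat n"] by simp
  next
    case False
    then show ?thesis using nat[of "x + of_int n" "nat (-n)"] by simp
  qed
qed

section \<open>The chain and the comparison principle\<close>

text \<open>
  The interaction \<open>g\<close> takes the place of \<open>W'\<close>. Only monotonicity and a local Lipschitz bound are
  asked of it, so that the theory also applies to a truncated \<open>W'\<close>, which is not
  differentiable any more.
\<close>

locale chain =
  fixes g h K :: "real \<Rightarrow> real" and L H \<kappa> :: real
  assumes g_mono: "x \<le> y \<Longrightarrow> g x \<le> g y"
    and g_lipschitz: "\<exists>A\<ge>0. \<forall>x y. \<bar>x\<bar> \<le> B \<longrightarrow> \<bar>y\<bar> \<le> B \<longrightarrow> \<bar>g x - g y\<bar> \<le> A * \<bar>x - y\<bar>"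
    and h_lipschitz: "\<bar>h x - h y\<bar> \<le> L * \<bar>x - y\<bar>"
    and h_bound: "\<bar>h x\<bar> \<le> H"
    and h_periodic: "h (x + 1) = h x"
    and K_bound: "\<bar>K t\<bar> \<le> \<kappa>"
    and K_jumps: "finite {t\<in>{s..s'}. \<not> isCont K t}"
begin

definition force :: "real \<Rightarrow> (int \<Rightarrow> real) \<Rightarrow> int \<Rightarrow> real" where
  "force t x k = g (x (k + 1) - x k) - g (x k - x (k - 1)) + K t * h (x k)"

definition solution :: "real \<Rightarrow> (real \<Rightarrow> int \<Rightarrow> real) \<Rightarrow> bool" where
  "solution t0 u \<longleftrightarrow>
     (\<forall>k. continuous_on {t0..} (\<lambda>t. u t k)) \<and>
     (\<forall>k. \<forall>t>t0. isCont K t \<longrightarrow> ((\<lambda>s. u s k) has_real_derivative force t (u t) k) (at t)) \<and>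
     (\<forall>T. \<exists>B. \<forall>t\<in>{t0..T}. \<forall>k. \<bar>u t (k + 1) - u t k\<bar> \<le> B)"

lemma L_nonneg: "0 \<le> L"
  using h_lipschitz[of 1 0] by simp

lemma K_nonneg: "0 \<le> \<kappa>"
  using K_bound[of 0] by linarith

lemma H_nonneg: "0 \<le> H"
  using h_bound[of 0] by linarith

lemma h_periodic_int: "h (x + of_int n) = h x"
  by (rule periodic_int[of h, OF h_periodic])

lemma solution_continuous: "solution t0 u \<Longrightarrow> t0 \<le> s \<Longrightarrow> continuous_on {s..t} (\<lambda>t. u t k)"
  unfolding solution_def by (auto intro: continuous_on_subset)

lemma solution_deriv:
  "solution t0 u \<Longrightarrow> t0 < t \<Longrightarrow> isCont K t \<Longrightarrow>
     ((\<lambda>s. u s k) has_real_derivative force t (u t) k) (at t)"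
  unfolding solution_def by auto

lemma solution_spacing:
  assumes "solution t0 u"
  obtains B where "0 \<le> B" "\<And>t k. t0 \<le> t \<Longrightarrow> t \<le> T \<Longrightarrow> \<bar>u t (k + 1) - u t k\<bar> \<le> B"
proof -
  obtain B where B: "\<forall>t\<in>{t0..T}. \<forall>k. \<bar>u t (k + 1) - u t k\<bar> \<le> B"
    using assms unfolding solution_def by blast
  show thesis
  proof (rule that[of "\<bar>B\<bar>"])
    show "\<bar>u t (k + 1) - u t k\<bar> \<le> \<bar>B\<bar>" if "t0 \<le> t" "t \<le> T" for t k
    proof -
      have "\<bar>u t (k + 1) - u t k\<bar> \<le> B" using B that by simp
      then show ?thesis by linarith
    qed
  qed simp
qed

lemma solution_restart:
  assumes "solution t0 u" "t0 \<le> s"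
  shows "solution s u"
  unfolding solution_def
proof (intro conjI allI impI)
  show "continuous_on {s..} (\<lambda>t. u t k)" for k
    using assms unfolding solution_def by (auto intro: continuous_on_subset)
  show "((\<lambda>s. u s k) has_real_derivative force t (u t) k) (at t)"
    if "s < t" "isCont K t" for k t
    using solution_deriv[OF assms(1)] assms(2) that by simp
  show "\<exists>B. \<forall>t\<in>{s..T}. \<forall>k. \<bar>u t (k + 1) - u t k\<bar> \<le> B" for T
    using solution_spacing[OF assms(1)] assms(2) by (metis atLeastAtMost_iff order_trans)
qed

lemma solution_translate:
  assumes "solution t0 u"
  shows "solution t0 (\<lambda>t k. u t (k + j) + of_int l)"
proof -
  have f: "force t (\<lambda>k. u t (k + j) + of_int l) k = force t (u t) (k + j)" for t k
    unfolding force_def h_periodic_int by (simp add: algebra_simps)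
  have "continuous_on {t0..} (\<lambda>t. u t (k + j) + of_int l)" for k
    using assms unfolding solution_def by (auto intro!: continuous_intros)
  moreover have "((\<lambda>s. u s (k + j) + of_int l) has_real_derivative force t (u t) (k + j)) (at t)"
    if "t0 < t" "isCont K t" for t k
    using solution_deriv[OF assms that] by (auto intro!: derivative_eq_intros)
  moreover have "\<exists>B. \<forall>t\<in>{t0..T}. \<forall>k. \<bar>u t (k + 1 + j) - u t (k + j)\<bar> \<le> B" for T
  proof -
    obtain B where "\<And>t k. t0 \<le> t \<Longrightarrow> t \<le> T \<Longrightarrow> \<bar>u t (k + 1) - u t k\<bar> \<le> B"
      using solution_spacing[OF assms] by metis
    then have "\<bar>u t (k + 1 + j) - u t (k + j)\<bar> \<le> B" if "t \<in> {t0..T}" for t k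
      using that by (metis (no_types) add.commute add.left_commute atLeastAtMost_iff)
    then show ?thesis by blast
  qed
  ultimately show ?thesis unfolding solution_def by (simp add: f)
qed

lemma force_bound:
  assumes A: "\<And>x y. \<bar>x\<bar> \<le> B \<Longrightarrow> \<bar>y\<bar> \<le> B \<Longrightarrow> \<bar>g x - g y\<bar> \<le> A * \<bar>x - y\<bar>" "0 \<le> A"
    and x: "\<And>k. \<bar>x (k + 1) - x k\<bar> \<le> B"
  shows "\<bar>force t x k\<bar> \<le> 2 * A * B + \<kappa> * H"
proof -
  have "\<bar>g (x (k + 1) - x k) - g (x k - x (k - 1))\<bar> \<le> A * \<bar>(x (k + 1) - x k) - (x k - x (k - 1))\<bar>"
    using x[of k] x[of "k - 1"] by (intro A) auto
  also have "\<dots> \<le> A * (2 * B)"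
    using x[of k] x[of "k - 1"] A(2) by (intro mult_left_mono) auto
  finally have 1: "\<bar>g (x (k + 1) - x k) - g (x k - x (k - 1))\<bar> \<le> 2 * A * B" by simp
  have 2: "\<bar>K t * h (x k)\<bar> \<le> \<kappa> * H"
    unfolding abs_mult by (intro mult_mono K_bound h_bound K_nonneg) auto
  show ?thesis unfolding force_def using 1 2 by linarith
qed

text \<open>
  The part of the difference of two forces that can be negative is at most a multiple of \<open>y\<^sub>k - x\<^sub>k\<close>
  itself plus a multiple of \<open>M\<close>: the elastic terms only pull particle \<open>k\<close> towards
  its neighbours. After adding \<open>(2 A + \<kappa> L) (y\<^sub>k - x\<^sub>k)\<close>, which an exponential factor provides, what remains
  is bounded by \<open>M\<close> alone.
\<close>

lemma force_diff_lower:
  assumes A: "\<And>x y. \<bar>x\<bar> \<le> B \<Longrightarrow> \<bar>y\<bar> \<le> B \<Longrightarrow> \<bar>g x - g y\<bar> \<le> A * \<bar>x - y\<bar>" "0 \<le> A"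
    and x: "\<And>k. \<bar>x (k + 1) - x k\<bar> \<le> B" and y: "\<And>k. \<bar>y (k + 1) - y k\<bar> \<le> B"
    and M: "0 \<le> M" "\<And>k. - M \<le> y k - x k"
  shows "- ((2 * A + 2 * \<kappa> * L) * M) \<le> (2 * A + \<kappa> * L) * (y k - x k) + (force t y k - force t x k)"
proof -
  have gl: "g p - g q \<le> A * r" if "\<bar>p\<bar> \<le> B" "\<bar>q\<bar> \<le> B" "p - q \<le> r" "0 \<le> r" for p q r
  proof (cases "p \<le> q")
    case True
    then show ?thesis using g_mono[OF True] A(2) that by (smt (verit) mult_nonneg_nonneg)
  next
    case False
    have "g p - g q \<le> A * \<bar>p - q\<bar>" using A(1)[OF that(1,2)] by linarith
    also have "\<dots> \<le> A * r" using False that A(2) by (intro mult_left_mono) auto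
    finally show ?thesis .
  qed
  let ?d = "y k - x k"
  have d0: "0 \<le> M + ?d" using M(2)[of k] by linarith
  have "g (x (k + 1) - x k) - g (y (k + 1) - y k) \<le> A * (M + ?d)"
    using M(2)[of "k + 1"] d0 x[of k] y[of k] by (intro gl) auto
  moreover have "g (y k - y (k - 1)) - g (x k - x (k - 1)) \<le> A * (M + ?d)"
    using M(2)[of "k - 1"] d0 x[of "k - 1"] y[of "k - 1"] by (intro gl) auto
  moreover have "K t * h (x k) - K t * h (y k) \<le> \<kappa> * L * (2 * M + ?d)"
  proof -
    have "K t * h (x k) - K t * h (y k) \<le> \<bar>K t * (h (x k) - h (y k))\<bar>" by (simp add: algebra_simps)
    also have "\<dots> \<le> \<kappa> * (L * \<bar>x k - y k\<bar>)"
      unfolding abs_mult by (intro mult_mono K_bound h_lipschitz K_nonneg) auto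
    also have "\<dots> \<le> \<kappa> * (L * (2 * M + ?d))"
      using M(1) d0 K_nonneg L_nonneg by (intro mult_left_mono) auto
    finally show ?thesis by (simp add: mult_ac)
  qed
  ultimately show ?thesis unfolding force_def by (simp add: algebra_simps)
qed

lemma finite_jumps: "finite {t. a < t \<and> t < b \<and> \<not> isCont K t}"
  by (rule finite_subset[OF _ K_jumps[of a b]]) auto

text \<open>
  With infinitely many particles there need not be a first moment of contact. Instead a lower
  bound for the (exponentially weighted) difference is improved repeatedly: if it is at least
  \<open>- E\<^sub>n\<close>, then \<open>force_diff_lower\<close> bounds its derivative by \<open>- N E\<^sub>n\<close>, so it is at least
  \<open>- E\<^sub>n\<^sub>+\<^sub>1\<close>, and \<open>E\<^sub>n\<close> tends to 0 like \<open>(N t)\<^sup>n / n!\<close>. The first bound uses that the spacings,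
  and hence the forces, are bounded uniformly in the index on bounded time intervals.
\<close>

lemma comparison:
  assumes u: "solution t0 u" and w: "solution t0 w"
    and init: "\<And>k. u t0 k \<le> w t0 k" and "t0 \<le> T"
  shows "u T k \<le> w T k"
proof -
  obtain B1 where B1: "0 \<le> B1" "\<And>t k. t0 \<le> t \<Longrightarrow> t \<le> T \<Longrightarrow> \<bar>u t (k + 1) - u t k\<bar> \<le> B1"
    using solution_spacing[OF u] by blast
  obtain B2 where B2: "0 \<le> B2" "\<And>t k. t0 \<le> t \<Longrightarrow> t \<le> T \<Longrightarrow> \<bar>w t (k + 1) - w t k\<bar> \<le> B2"
    using solution_spacing[OF w] by blast
  define B where "B = max B1 B2"
  have Bu: "\<bar>u t (k + 1) - u t k\<bar> \<le> B" if "t0 \<le> t" "t \<le> T" for t k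
    using B1(2)[OF that, of k] by (simp add: B_def)
  have Bw: "\<bar>w t (k + 1) - w t k\<bar> \<le> B" if "t0 \<le> t" "t \<le> T" for t k
    using B2(2)[OF that, of k] by (simp add: B_def)
  have "0 \<le> B" using B1 by (simp add: B_def)
  obtain A where A: "0 \<le> A" "\<And>x y. \<bar>x\<bar> \<le> B \<Longrightarrow> \<bar>y\<bar> \<le> B \<Longrightarrow> \<bar>g x - g y\<bar> \<le> A * \<bar>x - y\<bar>"
    using g_lipschitz by blast
  define R where "R = 2 * A * B + \<kappa> * H"
  have moved: "\<bar>v t k - v t0 k\<bar> \<le> R * (t - t0)"
    if v: "solution t0 v" "\<And>t k. t0 \<le> t \<Longrightarrow> t \<le> T \<Longrightarrow> \<bar>v t (k + 1) - v t k\<bar> \<le> B"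
      and t: "t0 \<le> t" "t \<le> T" for v t k
  proof (rule bounded_change_off_finite[OF finite_jumps[of t0 t] t(1)])
    show "continuous_on {t0..t} (\<lambda>t. v t k)" using v(1) by (rule solution_continuous) simp
    show "\<exists>D. \<bar>D\<bar> \<le> R \<and> ((\<lambda>t. v t k) has_real_derivative D) (at s)"
      if "t0 < s" "s < t" "s \<notin> {s. t0 < s \<and> s < t \<and> \<not> isCont K s}" for s
    proof (intro exI conjI)
      show "\<bar>force s (v s) k\<bar> \<le> R" unfolding R_def
        using v(2)[of s] that t A by (intro force_bound) auto
      show "((\<lambda>t. v t k) has_real_derivative force s (v s) k) (at s)"
        using that by (intro solution_deriv[OF v(1)]) auto
    qed
  qed
  define C0 where "C0 = 2 * R * (T - t0)"
  have R0: "0 \<le> R" unfolding R_def using A(1) \<open>0 \<le> B\<close> K_nonneg H_nonneg by simp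
  have C00: "0 \<le> C0" unfolding C0_def using R0 \<open>t0 \<le> T\<close> by simp
  have lower: "- C0 \<le> w t k - u t k" if "t0 \<le> t" "t \<le> T" for t k
  proof -
    have "R * (t - t0) \<le> R * (T - t0)" using R0 that by (intro mult_left_mono) auto
    moreover have "\<bar>u t k - u t0 k\<bar> \<le> R * (t - t0)"
      by (rule moved[OF u Bu]) (use that in auto)
    moreover have "\<bar>w t k - w t0 k\<bar> \<le> R * (t - t0)"
      by (rule moved[OF w Bw]) (use that in auto)
    ultimately show ?thesis using init[of k] unfolding C0_def by argo
  qed
  define l where "l = 2 * A + \<kappa> * L"
  define N where "N = 2 * A + 2 * \<kappa> * L"
  have l0: "0 \<le> l" and N0: "0 \<le> N"
    unfolding l_def N_def using A(1) K_nonneg L_nonneg by auto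
  define C where "C = exp (l * (T - t0)) * C0"
  have C0: "0 \<le> C" unfolding C_def using C00 by simp
  define z where "z t k = exp (l * (t - t0)) * (w t k - u t k)" for t k
  define E where "E n t = (C * N ^ n / fact n) * (t - t0) ^ n" for n t
  have E0: "0 \<le> E n t" if "t0 \<le> t" for n t
    unfolding E_def using that C0 N0 by simp
  have E_deriv: "((\<lambda>t. E (Suc n) t) has_real_derivative N * E n t) (at t)" for n t
  proof -
    have "((\<lambda>t. E (Suc n) t) has_real_derivative
        (C * N ^ Suc n / fact (Suc n)) * (real (Suc n) * (t - t0) ^ n)) (at t)"
      unfolding E_def
      by (rule DERIV_cmult, rule DERIV_cong[OF DERIV_power[where n = "Suc n"]])
         (auto intro!: derivative_eq_intros simp del: power_Suc)
    also have "(C * N ^ Suc n / fact (Suc n)) * (real (Suc n) * (t - t0) ^ n) = N * E n t"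
      by (simp add: E_def field_simps del: of_nat_Suc)
    finally show ?thesis .
  qed
  have zE: "- E n t \<le> z t k" if "t0 \<le> t" "t \<le> T" for n t k
    using that
  proof (induction n arbitrary: t k)
    case 0
    have "exp (l * (t - t0)) * C0 \<le> C"
      unfolding C_def using 0 l0 C00 by (intro mult_right_mono) (auto intro!: mult_left_mono)
    moreover have "exp (l * (t - t0)) * - C0 \<le> z t k"
      unfolding z_def using lower[OF 0] by (intro mult_left_mono) auto
    ultimately have "- C \<le> z t k" by simp
    then show ?case by (simp add: E_def)
  next
    case (Suc n)
    have "(\<lambda>s. z s k + E (Suc n) s) t0 \<le> (\<lambda>s. z s k + E (Suc n) s) t"
    proof (rule increasing_off_finite[OF finite_jumps[of t0 t] Suc.prems(1)])
      show "continuous_on {t0..t} (\<lambda>s. z s k + E (Suc n) s)"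
        unfolding z_def E_def using solution_continuous[OF u] solution_continuous[OF w]
        by (intro continuous_intros) auto
      fix s assume s: "t0 < s" "s < t" "s \<notin> {s. t0 < s \<and> s < t \<and> \<not> isCont K s}"
      then have Ks: "isCont K s" by auto
      let ?e = "exp (l * (s - t0))"
      let ?D = "?e * (l * (w s k - u s k) + (force s (w s) k - force s (u s) k)) + N * E n s"
      have "((\<lambda>s. z s k + E (Suc n) s) has_real_derivative ?D) (at s)"
        unfolding z_def
        by (rule derivative_eq_intros solution_deriv[OF u s(1) Ks] solution_deriv[OF w s(1) Ks]
              E_deriv refl | simp add: algebra_simps)+
      moreover have "0 \<le> ?D"
      proof -
        define M where "M = E n s / ?e"
        have "- M \<le> w s k - u s k" for k
          using Suc.IH[of s k] s Suc.prems by (simp add: z_def M_def field_simps)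
        moreover have "0 \<le> M" using E0[of s n] s by (simp add: M_def)
        ultimately have "- (N * M) \<le> l * (w s k - u s k) + (force s (w s) k - force s (u s) k)"
          unfolding N_def l_def using s Suc.prems A Bu[of s] Bw[of s] by (intro force_diff_lower) auto
        then have "?e * - (N * M) \<le> ?e * (l * (w s k - u s k) + (force s (w s) k - force s (u s) k))"
          by (intro mult_left_mono) auto
        then show ?thesis by (simp add: M_def)
      qed
      ultimately show "\<exists>D\<ge>0. ((\<lambda>s. z s k + E (Suc n) s) has_real_derivative D) (at s)" by blast
    qed
    moreover have "0 \<le> z t0 k + E (Suc n) t0" using init[of k] by (simp add: z_def E_def)
    ultimately show ?case by simp
  qed
  have "(\<lambda>n. C * (inverse (fact n) * (N * (T - t0)) ^ n)) \<longlonglongrightarrow> C * 0"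
    by (intro tendsto_mult tendsto_const summable_LIMSEQ_zero summable_exp)
  then have "(\<lambda>n. - E n T) \<longlonglongrightarrow> - 0"
    by (intro tendsto_minus) (simp add: E_def power_mult_distrib divide_inverse mult_ac)
  then have "- 0 \<le> z T k"
    by (rule LIMSEQ_le_const2) (use zE \<open>t0 \<le> T\<close> in auto)
  then show ?thesis by (simp add: z_def zero_le_mult_iff)
qed

end

section \<open>Existence of solutions\<close>

lemma continuous_on_times_discrete:
  fixes f :: "'a::topological_space \<times> 'b::discrete_topology \<Rightarrow> 'c::topological_space"
  assumes "\<And>k. continuous_on UNIV (\<lambda>t. f (t, k))"
  shows "continuous_on UNIV f"
proof -
  have "continuous_on (\<Union>k\<in>UNIV. UNIV \<times> {k}) f"
  proof (rule continuous_on_open_UN)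
    show "open ((UNIV :: 'a set) \<times> {k :: 'b})" for k
      by (intro open_Times open_discrete) auto
    show "continuous_on (UNIV \<times> {k}) f" for k
    proof -
      have "continuous_on (UNIV \<times> {k}) (\<lambda>p. f (fst p, k))"
        by (rule continuous_on_compose2[OF assms]) (auto intro!: continuous_intros)
      then show ?thesis by (rule continuous_on_eq) auto
    qed
  qed
  moreover have "(\<Union>k\<in>UNIV. (UNIV :: 'a set) \<times> {k :: 'b}) = UNIV" by auto
  ultimately show ?thesis by simp
qed

text \<open>
  In the norm with weight \<open>exp (- w t)\<close>, integration in time has norm at most \<open>1 / w\<close>, on the whole
  half-line.
\<close>

lemma exp_weighted_integral_bound:
  fixes f :: "real \<Rightarrow> real"
  assumes "f integrable_on {t0..t}" "t0 \<le> t" "0 < w" "0 \<le> R"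
    and bound: "\<And>s. t0 \<le> s \<Longrightarrow> s \<le> t \<Longrightarrow> \<bar>f s\<bar> \<le> R * exp (w * (s - t0))"
  shows "exp (- (w * (t - t0))) * \<bar>integral {t0..t} f\<bar> \<le> R / w"
proof -
  have I: "((\<lambda>s. R * exp (w * (s - t0))) has_integral
             (R / w * exp (w * (t - t0)) - R / w * exp (w * (t0 - t0)))) {t0..t}"
    using \<open>0 < w\<close>
    by (intro fundamental_theorem_of_calculus \<open>t0 \<le> t\<close>)
       (auto intro!: derivative_eq_intros simp: has_real_derivative_iff_has_vector_derivative[symmetric])
  have "\<bar>integral {t0..t} f\<bar> \<le> integral {t0..t} (\<lambda>s. R * exp (w * (s - t0)))"
    using integral_norm_bound_integral[OF assms(1) has_integral_integrable[OF I]] bound by simp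
  also have "\<dots> = R / w * exp (w * (t - t0)) - R / w"
    using integral_unique[OF I] by simp
  also have "\<dots> \<le> R / w * exp (w * (t - t0))" using assms by simp
  finally have "exp (- (w * (t - t0))) * \<bar>integral {t0..t} f\<bar>
      \<le> exp (- (w * (t - t0))) * (R / w * exp (w * (t - t0)))"
    by (intro mult_left_mono) auto
  moreover have "exp (- (w * (t - t0))) * exp (w * (t - t0)) = 1"
    by (simp flip: exp_add)
  ultimately show ?thesis by (simp add: mult.left_commute)
qed

lemma continuous_on_max_indefinite_integral:
  fixes f :: "real \<Rightarrow> real"
  assumes "\<And>b. f integrable_on {a..b}"
  shows "continuous_on UNIV (\<lambda>t. integral {a..max a t} f)"
proof -
  have "continuous_on (\<Union>b\<in>UNIV. {..<b}) (\<lambda>t. integral {a..max a t} f)"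
  proof (rule continuous_on_open_UN)
    show "continuous_on {..<b} (\<lambda>t. integral {a..max a t} f)" for b
      by (rule continuous_on_compose2[OF indefinite_integral_continuous_1[OF assms[of "max a b"]]])
         (auto intro!: continuous_intros)
  qed auto
  moreover have "(\<Union>b\<in>UNIV. {..<b}) = (UNIV :: real set)" using gt_ex by auto
  ultimately show ?thesis by simp
qed

text \<open>
  Completeness of the sup metric uses no metric on the domain, and below the domain is the product of
  time with the discrete index set.
\<close>

lemma complete_UNIV_bcontfun:
  "complete (UNIV :: ('a::topological_space \<Rightarrow>\<^sub>C 'b::complete_space) set)"
  unfolding complete_def
proof (intro allI impI)
  fix f :: "nat \<Rightarrow> 'a \<Rightarrow>\<^sub>C 'b"
  assume "(\<forall>n. f n \<in> UNIV) \<and> Cauchy f"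
  then have C: "Cauchy f" by simp
  have "\<forall>e>0. \<exists>N. \<forall>m n x. N \<le> m \<and> N \<le> n \<and> True \<longrightarrow> dist (f m x) (f n x) < e"
  proof (intro allI impI)
    fix e :: real assume "e > 0"
    then obtain N where N: "\<And>m n. m \<ge> N \<Longrightarrow> n \<ge> N \<Longrightarrow> dist (f m) (f n) < e"
      using metric_CauchyD[OF C] by blast
    show "\<exists>N. \<forall>m n x. N \<le> m \<and> N \<le> n \<and> True \<longrightarrow> dist (f m x) (f n x) < e"
      by (rule exI[of _ N]) (auto intro: dist_fun_lt_imp_dist_val_lt N)
  qed
  then obtain g where "\<forall>e>0. \<exists>N. \<forall>n x. N \<le> n \<and> True \<longrightarrow> dist (f n x) (g x) < e"
    using uniformly_convergent_eq_cauchy[of "\<lambda>_. True" "\<lambda>n. apply_bcontfun (f n)"] by blast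
  then have "uniform_limit UNIV f g sequentially"
    unfolding uniform_limit_sequentially_iff by simp
  then obtain l where "f \<longlonglongrightarrow> l"
    by (rule uniform_limit_bcontfunE[OF _ sequentially_bot])
  then show "\<exists>l\<in>UNIV. f \<longlonglongrightarrow> l" by (intro bexI[of _ l]) auto
qed

locale lipschitz_chain = chain +
  fixes A :: real
  assumes g_global_lipschitz: "\<bar>g x - g y\<bar> \<le> A * \<bar>x - y\<bar>"
    and K_measurable: "K \<in> borel_measurable borel"
begin

lemma A_nonneg: "0 \<le> A"
  using g_global_lipschitz[of 1 0] by simp

lemma continuous_g: "continuous_on S g"
proof -
  have "A-lipschitz_on S g"
    using g_global_lipschitz A_nonneg by (auto intro!: lipschitz_onI simp: dist_real_def)
  then show ?thesis by (rule lipschitz_on_continuous_on)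
qed

lemma continuous_h: "continuous_on S h"
proof -
  have "L-lipschitz_on S h"
    using h_lipschitz L_nonneg by (auto intro!: lipschitz_onI simp: dist_real_def)
  then show ?thesis by (rule lipschitz_on_continuous_on)
qed

lemma force_integrable:
  assumes y: "\<And>k. continuous_on {a..b} (\<lambda>s. y s k)"
  shows "(\<lambda>s. force s (y s) k) integrable_on {a..b}"
proof -
  have "(\<lambda>s. g (y s (k + 1) - y s k) - g (y s k - y s (k - 1))) integrable_on {a..b}"
    by (intro integrable_continuous_real continuous_intros y
          continuous_on_compose2[OF continuous_g[of UNIV]]) auto
  moreover have "(\<lambda>s. K s * h (y s k)) absolutely_integrable_on {a..b}"
  proof (rule absolutely_integrable_bounded_measurable_product_real)
    show "K \<in> borel_measurable (lebesgue_on {a..b})"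
      using K_measurable
      by (intro measurable_restrict_space1 measurable_completion) simp
    show "bounded (K ` {a..b})" using K_bound by (auto simp: bounded_iff)
    show "(\<lambda>s. h (y s k)) absolutely_integrable_on {a..b}"
      by (intro absolutely_integrable_continuous_real continuous_intros y
            continuous_on_compose2[OF continuous_h[of UNIV]]) auto
  qed simp
  ultimately show ?thesis
    unfolding force_def by (intro integrable_add) (auto intro: set_lebesgue_integral_eq_integral(1))
qed

lemma force_lipschitz:
  assumes "\<And>j. \<bar>x j - y j\<bar> \<le> M"
  shows "\<bar>force t x k - force t y k\<bar> \<le> (4 * A + \<kappa> * L) * M"
proof -
  have g2: "\<bar>g (x (i + 1) - x i) - g (y (i + 1) - y i)\<bar> \<le> A * (2 * M)" for i
  proof -
    have "\<bar>g (x (i + 1) - x i) - g (y (i + 1) - y i)\<bar>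
        \<le> A * \<bar>(x (i + 1) - x i) - (y (i + 1) - y i)\<bar>"
      by (rule g_global_lipschitz)
    also have "\<dots> \<le> A * (2 * M)"
      using assms[of "i + 1"] assms[of i] A_nonneg by (intro mult_left_mono) auto
    finally show ?thesis .
  qed
  have "\<bar>K t * h (x k) - K t * h (y k)\<bar> = \<bar>K t\<bar> * \<bar>h (x k) - h (y k)\<bar>"
    by (simp add: abs_mult[symmetric] algebra_simps)
  also have "\<dots> \<le> \<kappa> * (L * M)"
  proof (intro mult_mono K_bound K_nonneg)
    show "\<bar>h (x k) - h (y k)\<bar> \<le> L * M"
      using h_lipschitz[of "x k" "y k"] mult_left_mono[OF assms[of k] L_nonneg] by linarith
  qed auto
  finally have "\<bar>K t * h (x k) - K t * h (y k)\<bar> \<le> \<kappa> * L * M" by simp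
  then show ?thesis using g2[of k] g2[of "k - 1"] unfolding force_def by (simp add: algebra_simps)
qed

text \<open>
  Picard iteration as a contraction: the unknown \<open>v\<close> is the displacement from the initial
  configuration, divided by \<open>exp (w (t - t0))\<close> with \<open>w\<close> twice the Lipschitz constant of the force. It
  is bounded for all time, so one fixed point gives a global solution. Equal initial spacing makes the elastic
  forces on \<open>x0\<close> cancel, so the force along \<open>x0\<close> is bounded.
\<close>

lemma solution_exists:
  assumes x0: "\<And>k. x0 (k + 1) - x0 k = \<rho>"
  shows "\<exists>u. solution t0 u \<and> u t0 = x0"
proof -
  define N where "N = 4 * A + \<kappa> * L + 1"
  have N0: "0 < N" unfolding N_def using A_nonneg K_nonneg L_nonneg by (simp add: add_nonneg_pos)
  define w where "w = 2 * N"
  have w0: "0 < w" using N0 by (simp add: w_def)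
  have NM: "(4 * A + \<kappa> * L) * M \<le> N * M" if "0 \<le> M" for M
    using that unfolding N_def by (intro mult_right_mono) auto
  define Y where "Y v s k = x0 k + exp (w * (s - t0)) * apply_bcontfun v (s, k)"
    for v :: "(real \<times> int) \<Rightarrow>\<^sub>C real" and s k
  have Y_cont: "continuous_on S (\<lambda>s. Y v s k)" for v k S
    unfolding Y_def
    by (intro continuous_intros continuous_on_compose2[OF continuous_on_apply_bcontfun[of UNIV v]]) auto
  have Y_int: "(\<lambda>s. force s (Y v s) k) integrable_on {a..b}" for v k a b
    by (intro force_integrable Y_cont)
  have F0: "\<bar>force s x0 k\<bar> \<le> \<kappa> * H" for s k
  proof -
    have "x0 (k + 1) - x0 k = \<rho>" "x0 k - x0 (k - 1) = \<rho>" using x0[of k] x0[of "k - 1"] by auto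
    then have "force s x0 k = K s * h (x0 k)" unfolding force_def by simp
    then show ?thesis
      by (simp add: abs_mult, intro mult_mono K_bound h_bound K_nonneg) auto
  qed
  \<comment> \<open>Replacing \<open>t\<close> by \<open>max t0 t\<close> freezes the time before \<open>t0\<close>, so that \<open>F v\<close> is defined on all of \<open>\<real> \<times> \<int>\<close>.\<close>
  obtain F where F: "F v (t, k) =
      exp (- (w * (max t0 t - t0))) * integral {t0..max t0 t} (\<lambda>s. force s (Y v s) k)" for v t k
  proof
    show "(\<lambda>v (t, k). exp (- (w * (max t0 t - t0))) *
        integral {t0..max t0 t} (\<lambda>s. force s (Y v s) k)) v (t, k) =
      exp (- (w * (max t0 t - t0))) * integral {t0..max t0 t} (\<lambda>s. force s (Y v s) k)" for v t k
      by simp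
  qed
  have "F v \<in> bcontfun" for v
  proof -
    have "continuous_on UNIV (F v)"
      by (rule continuous_on_times_discrete)
         (auto simp: F intro!: continuous_intros continuous_on_max_indefinite_integral Y_int)
    moreover have "\<bar>F v (t, k)\<bar> \<le> (\<kappa> * H + N * norm v) / w" for t k
    proof -
      have "\<bar>force s (Y v s) k\<bar> \<le> (\<kappa> * H + N * norm v) * exp (w * (s - t0))" if "t0 \<le> s" for s
      proof -
        have "\<bar>force s (Y v s) k - force s x0 k\<bar>
            \<le> (4 * A + \<kappa> * L) * (exp (w * (s - t0)) * norm v)"
        proof (rule force_lipschitz)
          show "\<bar>Y v s j - x0 j\<bar> \<le> exp (w * (s - t0)) * norm v" for j
            using norm_bounded[of v "(s, j)"] by (simp add: Y_def abs_mult)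
        qed
        also have "\<dots> \<le> N * (exp (w * (s - t0)) * norm v)" by (rule NM) simp
        finally have "\<bar>force s (Y v s) k\<bar> \<le> \<kappa> * H * 1 + N * (exp (w * (s - t0)) * norm v)"
          using F0[of s k] by linarith
        also have "\<dots> \<le> \<kappa> * H * exp (w * (s - t0)) + N * (exp (w * (s - t0)) * norm v)"
          using w0 that K_nonneg H_nonneg by (intro add_right_mono mult_left_mono) auto
        finally show ?thesis by (simp add: algebra_simps)
      qed
      then have "exp (- (w * (max t0 t - t0))) * \<bar>integral {t0..max t0 t} (\<lambda>s. force s (Y v s) k)\<bar>
          \<le> (\<kappa> * H + N * norm v) / w"
        using w0 N0 K_nonneg H_nonneg by (intro exp_weighted_integral_bound Y_int) auto
      then show ?thesis by (simp add: F abs_mult)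
    qed
    ultimately show ?thesis unfolding bcontfun_def by (auto simp: bounded_iff)
  qed
  then have F_app: "apply_bcontfun (Bcontfun (F v)) = F v" for v by (rule Bcontfun_inverse)
  have "dist (Bcontfun (F v)) (Bcontfun (F v')) \<le> 1 / 2 * dist v v'" for v v'
  proof (rule dist_bound)
    fix p :: "real \<times> int"
    obtain t k where p: "p = (t, k)" by (cases p)
    let ?I = "{t0..max t0 t}"
    have "\<bar>force s (Y v s) k - force s (Y v' s) k\<bar> \<le> (N * dist v v') * exp (w * (s - t0))" for s
    proof -
      have "\<bar>force s (Y v s) k - force s (Y v' s) k\<bar>
          \<le> (4 * A + \<kappa> * L) * (exp (w * (s - t0)) * dist v v')"
      proof (rule force_lipschitz)
        show "\<bar>Y v s j - Y v' s j\<bar> \<le> exp (w * (s - t0)) * dist v v'" for j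
          using dist_bounded[of v "(s, j)" v']
          by (simp add: Y_def dist_real_def abs_mult flip: right_diff_distrib)
      qed
      also have "\<dots> \<le> N * (exp (w * (s - t0)) * dist v v')" by (rule NM) simp
      finally show ?thesis by (simp add: mult_ac)
    qed
    then have "exp (- (w * (max t0 t - t0))) *
        \<bar>integral ?I (\<lambda>s. force s (Y v s) k - force s (Y v' s) k)\<bar> \<le> N * dist v v' / w"
      using w0 N0 by (intro exp_weighted_integral_bound integrable_diff Y_int) auto
    moreover have "integral ?I (\<lambda>s. force s (Y v s) k - force s (Y v' s) k) =
        integral ?I (\<lambda>s. force s (Y v s) k) - integral ?I (\<lambda>s. force s (Y v' s) k)"
      by (intro integral_diff Y_int)
    ultimately show "dist (apply_bcontfun (Bcontfun (F v)) p) (apply_bcontfun (Bcontfun (F v')) p)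
        \<le> 1 / 2 * dist v v'"
      using N0 unfolding F_app p F dist_real_def
      by (simp add: abs_mult w_def flip: right_diff_distrib)
  qed
  then obtain v where v: "Bcontfun (F v) = v"
    using Banach_fix[OF complete_UNIV_bcontfun, of "1 / 2" "\<lambda>v. Bcontfun (F v)"] by auto
  define u where "u = Y v"
  have u_eq: "u t k = x0 k + integral {t0..t} (\<lambda>s. force s (u s) k)" if "t0 \<le> t" for t k
  proof -
    have "apply_bcontfun v (t, k) = F v (t, k)" using F_app[of v] v by simp
    then have "u t k = x0 k + exp (w * (t - t0)) * F v (t, k)" by (simp add: u_def Y_def)
    then show ?thesis using that by (simp add: F u_def max_absorb2 exp_minus)
  qed
  have deriv: "((\<lambda>t. u t k) has_real_derivative force t (u t) k) (at t)"
    if t: "t0 < t" "isCont K t" for t k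
  proof -
    let ?f = "\<lambda>s. force s (u s) k"
    have u_cont: "isCont (\<lambda>s. u s j) t" for j
      using Y_cont[of UNIV v j] by (simp add: continuous_on_eq_continuous_at u_def)
    have "isCont g x" "isCont h x" for x
      using continuous_g[of UNIV] continuous_h[of UNIV] by (auto simp: continuous_on_eq_continuous_at)
    then have "isCont (\<lambda>s. g (u s (k + 1) - u s k)) t" "isCont (\<lambda>s. g (u s k - u s (k - 1))) t"
      "isCont (\<lambda>s. h (u s k)) t"
      by (auto intro!: isCont_o2[of t _ g] isCont_o2[of t _ h] continuous_diff u_cont)
    then have "isCont ?f t"
      unfolding force_def using t by (intro continuous_intros) auto
    then have "((\<lambda>r. integral {t0..r} ?f) has_vector_derivative ?f t) (at t within {t0..t + 1} - {})"
      using t by (intro integral_has_vector_derivative_continuous_at)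
        (auto simp: u_def intro!: Y_int continuous_at_imp_continuous_at_within)
    then have "((\<lambda>r. integral {t0..r} ?f) has_real_derivative ?f t) (at t)"
      using t by (simp add: has_real_derivative_iff_has_vector_derivative at_within_Icc_at)
    then have "((\<lambda>r. x0 k + integral {t0..r} ?f) has_real_derivative ?f t) (at t)"
      by (auto intro!: derivative_eq_intros)
    then show ?thesis
      by (rule has_field_derivative_transform_within_open[of _ _ _ "{t0<..}"])
         (use t u_eq in auto)
  qed
  have spacing: "\<exists>B. \<forall>t\<in>{t0..T}. \<forall>k. \<bar>u t (k + 1) - u t k\<bar> \<le> B" for T
  proof (intro exI ballI allI)
    fix t k assume t: "t \<in> {t0..T}"
    have e: "\<bar>exp (w * (t - t0)) * apply_bcontfun v (t, j)\<bar> \<le> exp (w * (T - t0)) * norm v" for j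
      unfolding abs_mult using norm_bounded[of v "(t, j)"] t w0 by (intro mult_mono) auto
    show "\<bar>u t (k + 1) - u t k\<bar> \<le> \<bar>\<rho>\<bar> + 2 * (exp (w * (T - t0)) * norm v)"
      using e[of "k + 1"] e[of k] x0[of k] unfolding u_def Y_def by linarith
  qed
  have "solution t0 u"
    unfolding solution_def using deriv spacing by (auto simp: u_def Y_cont)
  moreover have "u t0 = x0" using u_eq[of t0] by auto
  ultimately show ?thesis by blast
qed

end

section \<open>Rotation numbers\<close>

text \<open>
  By quasi-additivity \<open>b (l m)\<close> is close both to \<open>l b m\<close> and to \<open>m b l\<close>, so every \<open>(b m - C) / m\<close> lies
  below every \<open>(b l + C) / l\<close>; the supremum of the former separates the two families.
\<close>

lemma quasi_additive_near_linear:
  fixes b :: "nat \<Rightarrow> real"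
  assumes qa: "\<And>m l. \<bar>b (m + l) - b m - b l\<bar> \<le> C"
  shows "\<exists>\<omega>. \<forall>m. \<bar>b m - real m * \<omega>\<bar> \<le> C"
proof -
  have C0: "0 \<le> C" using qa[of 0 0] by linarith
  have mult: "\<bar>b (Suc l * m) - real (Suc l) * b m\<bar> \<le> real l * C" for l m
  proof (induction l)
    case (Suc l)
    then show ?case using qa[of m "Suc l * m"] by (simp add: algebra_simps)
  qed simp
  have mult': "\<bar>b (l * m) - real l * b m\<bar> \<le> real l * C - C" if "l \<ge> 1" for l m
    using mult[of "l - 1" m] that by (cases l) (auto simp: algebra_simps)
  have sep: "(b m - C) / real m \<le> (b l + C) / real l" if "m \<ge> 1" "l \<ge> 1" for m l
  proof -
    have "real l * b m - real m * b l \<le> real l * C + real m * C"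
      using mult'[OF that(2), of m] mult'[OF that(1), of l] C0
      unfolding mult.commute[of l m] by linarith
    then show ?thesis using that by (simp add: field_simps)
  qed
  let ?S = "(\<lambda>m. (b m - C) / real m) ` {1..}"
  define \<omega> where "\<omega> = Sup ?S"
  have bdd: "bdd_above ?S" using sep[of _ 1] by (intro bdd_aboveI2[of _ _ "(b 1 + C) / real 1"]) auto
  have "\<bar>b m - real m * \<omega>\<bar> \<le> C" for m
  proof (cases "m \<ge> 1")
    case True
    have "(b m - C) / real m \<le> \<omega>" unfolding \<omega>_def by (rule cSUP_upper[OF _ bdd]) (use True in auto)
    moreover have "\<omega> \<le> (b m + C) / real m"
      unfolding \<omega>_def by (rule cSUP_least) (use sep True in auto)
    ultimately show ?thesis using True by (simp add: field_simps abs_le_iff)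
  next
    case False
    then have "m = 0" by simp
    then show ?thesis using qa[of 0 0] by simp
  qed
  then show ?thesis by blast
qed

context chain
begin

lemma comparison_int:
  assumes "solution t0 u" "solution t0 w" "\<And>k. u t0 k \<le> w t0 k + of_int r" "t0 \<le> t"
  shows "u t k \<le> w t k + of_int r"
  using comparison[OF assms(1) solution_translate[OF assms(2), of 0 r], of t k] assms(3,4) by simp

definition linear_from :: "real \<Rightarrow> real \<Rightarrow> real \<Rightarrow> (real \<Rightarrow> int \<Rightarrow> real) \<Rightarrow> bool" where
  "linear_from \<rho> t0 c u \<longleftrightarrow> solution t0 u \<and> (\<forall>k. u t0 k = c + of_int k * \<rho>)"

lemma linear_fromD:
  assumes "linear_from \<rho> t0 c u"
  shows "solution t0 u" "u t0 k = c + of_int k * \<rho>"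
  using assms unfolding linear_from_def by auto

text \<open>
  Initially the chain shifted by \<open>j\<close> differs from the chain itself by the constant \<open>j \<rho>\<close>. The dynamics
  preserves the order between the shifted chain and the integer translates by the floor and the
  ceiling of this constant.
\<close>

lemma linear_spread:
  assumes "linear_from \<rho> t0 c u" "t0 \<le> t"
  shows "of_int \<lfloor>of_int j * \<rho>\<rfloor> \<le> u t (k + j) - u t k"
    and "u t (k + j) - u t k \<le> of_int \<lceil>of_int j * \<rho>\<rceil>"
proof -
  note u = linear_fromD[OF assms(1)]
  have "u t (k + 0) + of_int \<lfloor>of_int j * \<rho>\<rfloor> \<le> u t (k + j) + of_int 0"
    by (rule comparison[OF solution_translate solution_translate, OF u(1) u(1) _ assms(2)])
       (simp add: u(2) algebra_simps)
  then show "of_int \<lfloor>of_int j * \<rho>\<rfloor> \<le> u t (k + j) - u t k" by simp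
  have "u t (k + j) + of_int 0 \<le> u t (k + 0) + of_int \<lceil>of_int j * \<rho>\<rceil>"
    by (rule comparison[OF solution_translate solution_translate, OF u(1) u(1) _ assms(2)])
       (simp add: u(2) algebra_simps)
  then show "u t (k + j) - u t k \<le> of_int \<lceil>of_int j * \<rho>\<rceil>" by simp
qed

lemma linear_width:
  assumes "linear_from \<rho> t0 c u" "t0 \<le> t"
  shows "\<bar>u t j - u t k - of_int (j - k) * \<rho>\<bar> \<le> 1"
proof -
  have "of_int \<lfloor>of_int (j - k) * \<rho>\<rfloor> \<le> u t j - u t k" "u t j - u t k \<le> of_int \<lceil>of_int (j - k) * \<rho>\<rceil>"
    using linear_spread[OF assms, where j = "j - k" and k = k] by simp_all
  then show ?thesis
    using floor_correct[of "of_int (j - k) * \<rho>"] ceiling_correct[of "of_int (j - k) * \<rho>"] by linarith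
qed

text \<open>
  The force is globally Lipschitz once \<open>g\<close> is kept constant outside \<open>[\<rho> - 1, \<rho> + 1]\<close>. By
  \<open>linear_width\<close>, applied to the truncated chain, the spacings never leave this interval, so the solution of the truncated
  equation solves the original one.
\<close>

lemma linear_exists:
  assumes K_measurable: "K \<in> borel_measurable borel"
  shows "\<exists>u. linear_from \<rho> t0 c u"
proof -
  define tr where "tr x = max (\<rho> - 1) (min (\<rho> + 1) x)" for x :: real
  define gT where "gT x = g (tr x)" for x
  obtain A where A: "A \<ge> 0"
    "\<And>x y. \<bar>x\<bar> \<le> \<bar>\<rho>\<bar> + 1 \<Longrightarrow> \<bar>y\<bar> \<le> \<bar>\<rho>\<bar> + 1 \<Longrightarrow> \<bar>g x - g y\<bar> \<le> A * \<bar>x - y\<bar>"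
    using g_lipschitz by blast
  have tr_lip: "\<bar>tr x - tr y\<bar> \<le> \<bar>x - y\<bar>" for x y unfolding tr_def by linarith
  have tr_bound: "\<bar>tr x\<bar> \<le> \<bar>\<rho>\<bar> + 1" for x unfolding tr_def by linarith
  have gT_lip: "\<bar>gT x - gT y\<bar> \<le> A * \<bar>x - y\<bar>" for x y
    unfolding gT_def using A(2)[OF tr_bound tr_bound, of x y] mult_left_mono[OF tr_lip A(1), of x y]
    by linarith
  interpret T: lipschitz_chain gT h K L H \<kappa> A
  proof
    show "gT x \<le> gT y" if "x \<le> y" for x y
      unfolding gT_def by (rule g_mono) (use that in \<open>auto simp: tr_def\<close>)
    show "\<exists>A\<ge>0. \<forall>x y. \<bar>x\<bar> \<le> B \<longrightarrow> \<bar>y\<bar> \<le> B \<longrightarrow> \<bar>gT x - gT y\<bar> \<le> A * \<bar>x - y\<bar>" for B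
      using gT_lip A(1) by blast
  qed (use h_lipschitz h_bound h_periodic K_bound K_jumps gT_lip K_measurable in auto)
  obtain u where u: "T.solution t0 u" "u t0 = (\<lambda>k. c + of_int k * \<rho>)"
    using T.solution_exists[of "\<lambda>k. c + of_int k * \<rho>" \<rho> t0] by (auto simp: algebra_simps)
  then have lin: "T.linear_from \<rho> t0 c u" unfolding T.linear_from_def by simp
  have eq: "T.force t (u t) k = force t (u t) k" if "t0 \<le> t" for t k
  proof -
    have "tr (u t (i + 1) - u t i) = u t (i + 1) - u t i" for i
      using T.linear_width[OF lin that, of "i + 1" i] unfolding tr_def by simp
    from this[of k] this[of "k - 1"] show ?thesis unfolding T.force_def force_def gT_def by simp
  qed
  have "solution t0 u"
    using u(1) unfolding solution_def T.solution_def by (simp add: eq)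
  then show ?thesis using u(2) unfolding linear_from_def by auto
qed

end

locale periodic_chain = chain +
  fixes P :: real
  assumes P_pos: "0 < P"
    and K_period: "K (t + P) = K t"
    and K_measurable: "K \<in> borel_measurable borel"
begin

lemma K_period_mult: "K (t + real m * P) = K t"
proof (induction m)
  case (Suc m)
  then show ?case using K_period[of "t + real m * P"] by (simp add: algebra_simps)
qed simp

lemma isCont_K_period: "isCont K (t + real m * P) \<longleftrightarrow> isCont K t"
proof
  assume "isCont K (t + real m * P)"
  then have "isCont (\<lambda>x. K (x + real m * P)) t"
    by (rule isCont_o2[rotated]) (intro continuous_intros)
  then show "isCont K t" by (simp add: K_period_mult)
next
  assume "isCont K t"
  then have "isCont K (t + real m * P - real m * P)" by simp
  then have "isCont (\<lambda>x. K (x - real m * P)) (t + real m * P)"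
    by (rule isCont_o2[rotated]) (intro continuous_intros)
  moreover have "(\<lambda>x. K (x - real m * P)) = K"
    using K_period_mult[of "x - real m * P" m for x] by auto
  ultimately show "isCont K (t + real m * P)" by simp
qed

lemma solution_time_shift:
  assumes "solution (t0 + real m * P) u"
  shows "solution t0 (\<lambda>t. u (t + real m * P))"
  unfolding solution_def
proof (intro conjI allI impI)
  show "continuous_on {t0..} (\<lambda>t. u (t + real m * P) k)" for k
    by (rule continuous_on_compose2[of "{t0 + real m * P..}" "\<lambda>t. u t k"])
       (use assms in \<open>auto simp: solution_def intro!: continuous_intros\<close>)
  show "((\<lambda>s. u (s + real m * P) k) has_real_derivative force t (u (t + real m * P)) k) (at t)"
    if "t0 < t" "isCont K t" for t k
  proof -
    have "((\<lambda>s. u s k) has_real_derivative force (t + real m * P) (u (t + real m * P)) k)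
        (at (t + real m * P))"
      using that isCont_K_period by (intro solution_deriv[OF assms]) auto
    then show ?thesis by (simp add: DERIV_shift force_def K_period_mult)
  qed
  show "\<exists>B. \<forall>t\<in>{t0..T}. \<forall>k. \<bar>u (t + real m * P) (k + 1) - u (t + real m * P) k\<bar> \<le> B" for T
  proof -
    obtain B where "\<And>t k. t0 + real m * P \<le> t \<Longrightarrow> t \<le> T + real m * P \<Longrightarrow> \<bar>u t (k + 1) - u t k\<bar> \<le> B"
      using solution_spacing[OF assms] by metis
    then show ?thesis by (intro exI[of _ B]) auto
  qed
qed

lemma solution_next_period:
  assumes "solution t0 u"
  shows "solution t0 (\<lambda>t. u (t + real m * P))"
  by (rule solution_time_shift, rule solution_restart[OF assms]) (use P_pos in simp)

text \<open>
  Over \<open>m\<close> periods all particles advance by the same amount \<open>b\<close> up to 1. Rounding \<open>b + 1\<close> up (and \<open>b - 1\<close>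
  down) to an integer translates the initial chain beyond the advanced one, and this order is still there
  at time \<open>s\<close>; the rounding costs less than 1 more.
\<close>

lemma linear_advance:
  assumes u: "linear_from \<rho> t0 c u" and "0 \<le> s"
  shows "\<bar>u (t0 + s + real m * P) k - u (t0 + s) k - (u (t0 + real m * P) k' - u t0 k')\<bar> \<le> 2"
proof -
  define b where "b = u (t0 + real m * P) k' - u t0 k'"
  note sol = linear_fromD(1)[OF u]
  have t: "t0 \<le> t0 + real m * P" using P_pos by simp
  have near: "\<bar>u (t0 + real m * P) i - u t0 i - b\<bar> \<le> 1" for i
    using linear_width[OF u t, of i k'] linear_fromD(2)[OF u, of i] linear_fromD(2)[OF u, of k']
    by (simp add: b_def algebra_simps)
  have "u (t0 + s + real m * P) k \<le> u (t0 + s) k + of_int \<lceil>b + 1\<rceil>"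
  proof (rule comparison_int[OF solution_next_period[OF sol] sol])
    show "u (t0 + real m * P) i \<le> u t0 i + of_int \<lceil>b + 1\<rceil>" for i
      using near[of i] le_of_int_ceiling[of "b + 1"] by linarith
  qed (use \<open>0 \<le> s\<close> in simp)
  moreover have "u (t0 + s) k \<le> u (t0 + s + real m * P) k + of_int \<lceil>1 - b\<rceil>"
  proof (rule comparison_int[OF sol solution_next_period[OF sol]])
    show "u t0 i \<le> u (t0 + real m * P) i + of_int \<lceil>1 - b\<rceil>" for i
      using near[of i] le_of_int_ceiling[of "1 - b"] by linarith
  qed (use \<open>0 \<le> s\<close> in simp)
  ultimately show ?thesis
    using of_int_ceiling_le_add_one[of "b + 1"] of_int_ceiling_le_add_one[of "1 - b"]
    unfolding b_def by linarith
qed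

lemma linear_rotation_exists:
  assumes u: "linear_from \<rho> t0 c u"
  shows "\<exists>\<omega>. \<forall>m k. \<bar>u (t0 + real m * P) k - u t0 k - real m * \<omega>\<bar> \<le> 2"
proof -
  define b where "b k m = u (t0 + real m * P) k - u t0 k" for k m
  have "\<bar>b k (m + l) - b k m - b k l\<bar> \<le> 2" for k m l
  proof -
    have eq: "t0 + real l * P + real m * P = t0 + real (m + l) * P" by (simp add: distrib_right)
    have "0 \<le> real l * P" using P_pos by simp
    from linear_advance[OF u this, of m k k] show ?thesis unfolding b_def eq by linarith
  qed
  then have "\<exists>\<omega>. \<forall>m. \<bar>b k m - real m * \<omega>\<bar> \<le> 2" for k
    by (intro quasi_additive_near_linear) auto
  then obtain \<omega> where \<omega>: "\<And>k m. \<bar>b k m - real m * \<omega> k\<bar> \<le> 2" by metis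
  have "\<omega> k = \<omega> 0" for k
  proof (rule ccontr)
    assume ne: "\<omega> k \<noteq> \<omega> 0"
    have le: "real m * \<bar>\<omega> k - \<omega> 0\<bar> \<le> 6" for m
    proof -
      have "\<bar>b k m - b 0 m\<bar> \<le> 2"
        using linear_advance[OF u, of 0 m k 0] by (simp add: b_def)
      then have "\<bar>real m * \<omega> k - real m * \<omega> 0\<bar> \<le> 6"
        using \<omega>[of k m] \<omega>[of 0 m] by linarith
      then show ?thesis by (simp add: abs_mult flip: right_diff_distrib)
    qed
    obtain m where "6 < real m * \<bar>\<omega> k - \<omega> 0\<bar>"
      using reals_Archimedean3[of "\<bar>\<omega> k - \<omega> 0\<bar>"] ne by auto
    then show False using le[of m] by linarith
  qed
  then show ?thesis using \<omega> unfolding b_def by metis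
qed

text \<open>
  At the later starting time both chains have width at most 1, so they are within a constant of each
  other for all future times; the slopes must agree.
\<close>

lemma linear_rotation_unique_aux:
  assumes u: "linear_from \<rho> t0 c u" and w: "linear_from \<rho> t0' c' w" and "t0 \<le> t0'"
    and \<omega>: "\<And>m k. \<bar>u (t0 + real m * P) k - u t0 k - real m * \<omega>\<bar> \<le> 2"
    and \<omega>': "\<And>m k. \<bar>w (t0' + real m * P) k - w t0' k - real m * \<omega>'\<bar> \<le> 2"
  shows "\<omega> = \<omega>'"
proof (rule ccontr)
  assume ne: "\<omega> \<noteq> \<omega>'"
  note sol = solution_restart[OF linear_fromD(1)[OF u] \<open>t0 \<le> t0'\<close>] linear_fromD(1)[OF w]
  define e where "e = u t0' 0 - w t0' 0"
  have near: "\<bar>u t0' k - w t0' k - e\<bar> \<le> 1" for k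
    using linear_width[OF u \<open>t0 \<le> t0'\<close>, of k 0] linear_fromD(2)[OF w, of k] linear_fromD(2)[OF w, of 0]
    by (simp add: e_def algebra_simps)
  have close: "\<bar>u t 0 - w t 0\<bar> \<le> \<bar>e\<bar> + 2" if "t0' \<le> t" for t
  proof -
    have "u t 0 \<le> w t 0 + of_int \<lceil>e + 1\<rceil>"
    proof (rule comparison_int[OF sol _ that])
      show "u t0' k \<le> w t0' k + of_int \<lceil>e + 1\<rceil>" for k
        using near[of k] le_of_int_ceiling[of "e + 1"] by linarith
    qed
    moreover have "w t 0 \<le> u t 0 + of_int \<lceil>1 - e\<rceil>"
    proof (rule comparison_int[OF sol(2,1) _ that])
      show "w t0' k \<le> u t0' k + of_int \<lceil>1 - e\<rceil>" for k
        using near[of k] le_of_int_ceiling[of "1 - e"] by linarith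
    qed
    ultimately show ?thesis
      using of_int_ceiling_le_add_one[of "e + 1"] of_int_ceiling_le_add_one[of "1 - e"] by linarith
  qed
  have le: "real m * \<bar>\<omega> - \<omega>'\<bar> \<le> 2 * \<bar>e\<bar> + 10" for m
  proof -
    have "t0' \<le> t0' + real m * P" using P_pos by simp
    note close[OF this] close[of t0']
    moreover have "\<bar>u (t0' + real m * P) 0 - u t0' 0 - (u (t0 + real m * P) 0 - u t0 0)\<bar> \<le> 2"
      using linear_advance[OF u, of "t0' - t0" m 0 0] \<open>t0 \<le> t0'\<close> by simp
    ultimately have "\<bar>real m * \<omega> - real m * \<omega>'\<bar> \<le> 2 * \<bar>e\<bar> + 10"
      using \<omega>[of m 0] \<omega>'[of m 0] by linarith
    then show ?thesis by (simp add: abs_mult flip: right_diff_distrib)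
  qed
  obtain m where "2 * \<bar>e\<bar> + 10 < real m * \<bar>\<omega> - \<omega>'\<bar>"
    using reals_Archimedean3[of "\<bar>\<omega> - \<omega>'\<bar>"] ne by auto
  then show False using le[of m] by linarith
qed

lemma linear_rotation:
  "\<exists>\<omega>. \<forall>t0 c u. linear_from \<rho> t0 c u \<longrightarrow>
     (\<forall>m k. \<bar>u (t0 + real m * P) k - u t0 k - real m * \<omega>\<bar> \<le> 2)"
proof -
  obtain u0 where u0: "linear_from \<rho> 0 0 u0" using linear_exists[OF K_measurable] by blast
  obtain \<omega> where \<omega>: "\<And>m k. \<bar>u0 (0 + real m * P) k - u0 0 k - real m * \<omega>\<bar> \<le> 2"
    using linear_rotation_exists[OF u0] by blast
  have "\<bar>u (t0 + real m * P) k - u t0 k - real m * \<omega>\<bar> \<le> 2"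
    if u: "linear_from \<rho> t0 c u" for t0 c u m k
  proof -
    obtain \<omega>' where \<omega>': "\<And>m k. \<bar>u (t0 + real m * P) k - u t0 k - real m * \<omega>'\<bar> \<le> 2"
      using linear_rotation_exists[OF u] by blast
    have "\<omega> = \<omega>'"
    proof (cases "0 \<le> t0")
      case True
      show ?thesis by (rule linear_rotation_unique_aux[OF u0 u True \<omega> \<omega>'])
    next
      case False
      then have "t0 \<le> 0" by simp
      show ?thesis using linear_rotation_unique_aux[OF u u0 \<open>t0 \<le> 0\<close> \<omega>' \<omega>] by simp
    qed
    then show ?thesis using \<omega>' by simp
  qed
  then show ?thesis by blast
qed

text \<open>
  The two equally spaced chains touching the given configuration from above and below start at heights at
  most \<open>n\<close> apart, and each follows the slope \<open>\<omega>\<close> up to 2.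
\<close>

lemma bounded_width_rotation:
  "\<exists>\<omega>. \<forall>t0 u n m k. solution t0 u \<longrightarrow> bounded_width \<rho> n (u t0) \<longrightarrow>
     \<bar>u (t0 + real m * P) k - u t0 k - real m * \<omega>\<bar> \<le> real n + 2"
proof -
  obtain \<omega> where \<omega>: "\<And>t0 c u m k. linear_from \<rho> t0 c u \<Longrightarrow>
      \<bar>u (t0 + real m * P) k - u t0 k - real m * \<omega>\<bar> \<le> 2"
    using linear_rotation[of \<rho>] by blast
  have "\<bar>u (t0 + real m * P) k - u t0 k - real m * \<omega>\<bar> \<le> real n + 2"
    if sol: "solution t0 u" and width: "bounded_width \<rho> n (u t0)" for t0 u n m k
  proof -
    define e where "e k = u t0 k - of_int k * \<rho>" for k
    have osc: "\<bar>e i - e j\<bar> \<le> real n" for i j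
    proof -
      have "i < j \<or> i = j \<or> j < i" by linarith
      moreover have ij: "\<bar>e j - e i\<bar> \<le> real n" if "i < j" for i j
        using width[unfolded bounded_width_def, rule_format, of "j - i" i] that
        by (simp add: e_def algebra_simps)
      ultimately show ?thesis using ij[of i j] ij[of j i] by (auto simp: abs_minus_commute)
    qed
    have above: "bdd_above (range e)" and below: "bdd_below (range e)"
      using osc[of _ 0] by (auto intro!: bdd_aboveI2[of _ _ "e 0 + real n"]
          bdd_belowI2[of _ "e 0 - real n"] simp: abs_le_iff algebra_simps)
    have t: "t0 \<le> t0 + real m * P" using P_pos by simp
    obtain w where w: "linear_from \<rho> t0 (Sup (range e)) w"
      using linear_exists[OF K_measurable] by blast
    have "u (t0 + real m * P) k \<le> w (t0 + real m * P) k"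
    proof (rule comparison[OF sol linear_fromD(1)[OF w] _ t])
      show "u t0 i \<le> w t0 i" for i
        using cSUP_upper[OF _ above, of i] by (simp add: linear_fromD(2)[OF w] e_def)
    qed
    moreover have "Sup (range e) \<le> e k + real n"
      by (rule cSUP_least) (use osc[of _ k] in \<open>auto simp: abs_le_iff algebra_simps\<close>)
    moreover obtain w' where w': "linear_from \<rho> t0 (Inf (range e)) w'"
      using linear_exists[OF K_measurable] by blast
    have "w' (t0 + real m * P) k \<le> u (t0 + real m * P) k"
    proof (rule comparison[OF linear_fromD(1)[OF w'] sol _ t])
      show "w' t0 i \<le> u t0 i" for i
        using cINF_lower[OF below, of i] by (simp add: linear_fromD(2)[OF w'] e_def)
    qed
    moreover have "e k - real n \<le> Inf (range e)"
      by (rule cINF_greatest) (use osc[of _ k] in \<open>auto simp: abs_le_iff algebra_simps\<close>)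
    ultimately show ?thesis
      using \<omega>[OF w, of m k] \<omega>[OF w', of m k]
      unfolding linear_fromD(2)[OF w] linear_fromD(2)[OF w'] e_def by linarith
  qed
  then show ?thesis by blast
qed

end

section \<open>Equidistribution of relaxed blocks\<close>

lemma deriv_le_imp_diff_le:
  fixes F G :: "real \<Rightarrow> real"
  assumes "a \<le> b"
    and F: "\<And>x. a \<le> x \<Longrightarrow> x \<le> b \<Longrightarrow> (F has_real_derivative f x) (at x)"
    and G: "\<And>x. a \<le> x \<Longrightarrow> x \<le> b \<Longrightarrow> (G has_real_derivative g x) (at x)"
    and le: "\<And>x. a \<le> x \<Longrightarrow> x \<le> b \<Longrightarrow> f x \<le> g x"
  shows "F b - F a \<le> G b - G a"
proof -
  have "G a - F a \<le> G b - F b"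
  proof (rule DERIV_nonneg_imp_nondecreasing[OF \<open>a \<le> b\<close>, of "\<lambda>x. G x - F x"])
    fix x assume x: "a \<le> x" "x \<le> b"
    show "\<exists>y. ((\<lambda>x. G x - F x) has_real_derivative y) (at x) \<and> 0 \<le> y"
      using DERIV_diff[OF G[OF x] F[OF x]] le[OF x] by (intro exI[of _ "g x - f x"]) auto
  qed
  then show ?thesis by simp
qed

text \<open>
  Kantorovich duality for \<open>q\<close> equally spaced points on the circle: a point differs from a uniform
  point of its cell of length \<open>1 / q\<close> by \<open>1 / (4 q)\<close> on average. The integral of \<open>\<phi>\<close> over a
  period is written as \<open>I\<close>, the increment of an antiderivative. Coprimality makes
  multiplication by \<open>p\<close> a permutation of the residues modulo \<open>q\<close>.
\<close>

lemma equidistributed_sum_le: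
  fixes \<phi> \<Phi> :: "real \<Rightarrow> real" and p :: int and q :: nat
  assumes lip: "\<And>x y. \<bar>\<phi> x - \<phi> y\<bar> \<le> \<bar>x - y\<bar>"
    and per: "\<And>x. \<phi> (x + 1) = \<phi> x"
    and \<Phi>: "\<And>x. (\<Phi> has_real_derivative \<phi> x) (at x)"
    and I: "\<And>x. \<Phi> (x + 1) - \<Phi> x = I"
    and pq: "coprime p (int q)" "q \<ge> 1"
  shows "(\<Sum>j<q. \<phi> (c + real j * (of_int p / real q))) \<le> real q * I + 1 / 4"
proof -
  define r where "r j = nat ((int j * p) mod int q)" for j
  have q0: "0 < int q" using pq by simp
  have "inj_on r {..<q}"
  proof (rule inj_onI)
    fix i j assume ij: "i \<in> {..<q}" "j \<in> {..<q}" "r i = r j"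
    then have "(int i * p) mod int q = (int j * p) mod int q"
      using q0 by (simp add: r_def nat_eq_iff)
    then have "int q dvd (int i - int j) * p"
      by (simp add: mod_eq_dvd_iff left_diff_distrib)
    then have "int q dvd int i - int j"
      using pq(1) by (simp add: coprime_dvd_mult_left_iff coprime_commute)
    then show "i = j"
      using ij zdvd_imp_le[of "int q" "int i - int j"] zdvd_imp_le[of "int q" "int j - int i"]
      by (cases i j rule: linorder_cases) (auto simp: dvd_diff_commute)
  qed
  moreover have "r ` {..<q} \<subseteq> {..<q}"
  proof -
    have "(int j * p) mod int q < int q" for j using q0 by simp
    then show ?thesis using q0 by (auto simp: r_def nat_less_iff)
  qed
  ultimately have bij: "bij_betw r {..<q} {..<q}"
    by (simp add: bij_betw_def endo_inj_surj)
  have "\<phi> (c + real j * (of_int p / real q)) = \<phi> (c + real (r j) / real q)" for j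
  proof -
    have "int j * p = int (r j) + int q * ((int j * p) div int q)"
      unfolding r_def using q0 by simp
    then have "real j * of_int p = real (r j) + real q * of_int ((int j * p) div int q)"
      by (metis (no_types, lifting) of_int_add of_int_mult of_int_of_nat_eq)
    then have "real j * (of_int p / real q) = real (r j) / real q + of_int ((int j * p) div int q)"
      using q0 by (simp add: field_simps)
    then show ?thesis using periodic_int[of \<phi>, OF per] by (simp flip: add.assoc)
  qed
  then have "(\<Sum>j<q. \<phi> (c + real j * (of_int p / real q))) = (\<Sum>j<q. \<phi> (c + real (r j) / real q))"
    by simp
  also have "\<dots> = (\<Sum>i<q. \<phi> (c + real i / real q))"
    by (rule sum.reindex_bij_betw[OF bij])
  also have "\<dots> \<le> (\<Sum>i<q. real q * (\<Phi> (c + real i / real q + 1 / (2 * real q))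
      - \<Phi> (c + real i / real q - 1 / (2 * real q))) + 1 / (4 * real q))"
  proof (rule sum_mono)
    fix i
    define x where "x = c + real i / real q"
    define d where "d = 1 / (2 * real q)"
    have d0: "0 \<le> d" by (simp add: d_def)
    have "(d * \<phi> x - d\<^sup>2 / 2) - 0 \<le> \<Phi> (x + d) - \<Phi> x"
    proof -
      have "((\<lambda>y. (y - x) * \<phi> x - (y - x)\<^sup>2 / 2) (x + d)) - ((\<lambda>y. (y - x) * \<phi> x - (y - x)\<^sup>2 / 2) x)
          \<le> \<Phi> (x + d) - \<Phi> x"
      proof (rule deriv_le_imp_diff_le[OF _ _ \<Phi>, where f = "\<lambda>y. \<phi> x - (y - x)"])
        show "((\<lambda>y. (y - x) * \<phi> x - (y - x)\<^sup>2 / 2) has_real_derivative \<phi> x - (y - x)) (at y)" for y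
          by (auto intro!: derivative_eq_intros simp: field_simps)
        show "\<phi> x - (y - x) \<le> \<phi> y" if "x \<le> y" for y using lip[of x y] that by simp
      qed (use d0 in auto)
      then show ?thesis by simp
    qed
    moreover have "(d * \<phi> x - d\<^sup>2 / 2) - 0 \<le> \<Phi> x - \<Phi> (x - d)"
    proof -
      have "((\<lambda>y. (y - x) * \<phi> x + (y - x)\<^sup>2 / 2) x) - ((\<lambda>y. (y - x) * \<phi> x + (y - x)\<^sup>2 / 2) (x - d))
          \<le> \<Phi> x - \<Phi> (x - d)"
      proof (rule deriv_le_imp_diff_le[OF _ _ \<Phi>, where f = "\<lambda>y. \<phi> x + (y - x)"])
        show "((\<lambda>y. (y - x) * \<phi> x + (y - x)\<^sup>2 / 2) has_real_derivative \<phi> x + (y - x)) (at y)" for y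
          by (auto intro!: derivative_eq_intros simp: field_simps)
        show "\<phi> x + (y - x) \<le> \<phi> y" if "y \<le> x" for y using lip[of x y] that by simp
      qed (use d0 in auto)
      then show ?thesis by simp
    qed
    ultimately have "2 * d * \<phi> x \<le> \<Phi> (x + d) - \<Phi> (x - d) + d\<^sup>2" by simp
    then have "real q * (2 * d * \<phi> x) \<le> real q * (\<Phi> (x + d) - \<Phi> (x - d) + d\<^sup>2)"
      by (intro mult_left_mono) auto
    then show "\<phi> (c + real i / real q) \<le> real q * (\<Phi> (c + real i / real q + 1 / (2 * real q))
      - \<Phi> (c + real i / real q - 1 / (2 * real q))) + 1 / (4 * real q)"
      unfolding x_def[symmetric] d_def[symmetric]
    proof -
      assume le: "real q * (2 * d * \<phi> x) \<le> real q * (\<Phi> (x + d) - \<Phi> (x - d) + d\<^sup>2)"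
      have "real q * (2 * d * \<phi> x) = \<phi> x" "real q * d\<^sup>2 = 1 / (4 * real q)"
        using q0 by (auto simp: d_def power2_eq_square)
      then show "\<phi> x \<le> real q * (\<Phi> (x + d) - \<Phi> (x - d)) + 1 / (4 * real q)"
        using le unfolding distrib_left by linarith
    qed
  qed
  also have "\<dots> = real q * (\<Sum>i<q. \<Phi> (c + real i / real q + 1 / (2 * real q))
      - \<Phi> (c + real i / real q - 1 / (2 * real q))) + 1 / 4"
    using q0 by (simp add: sum.distrib sum_distrib_left)
  also have "(\<Sum>i<q. \<Phi> (c + real i / real q + 1 / (2 * real q))
      - \<Phi> (c + real i / real q - 1 / (2 * real q))) = I"
  proof -
    define f where "f i = \<Phi> (c - 1 / (2 * real q) + real i / real q)" for i
    have "(\<Sum>i<q. \<Phi> (c + real i / real q + 1 / (2 * real q))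
        - \<Phi> (c + real i / real q - 1 / (2 * real q))) = (\<Sum>i<q. f (Suc i) - f i)"
    proof (rule sum.cong[OF refl])
      fix i
      have e1: "c + real i / real q + 1 / (2 * real q) = c - 1 / (2 * real q) + real (Suc i) / real q"
        using q0 by (simp add: field_simps)
      have e2: "c + real i / real q - 1 / (2 * real q) = c - 1 / (2 * real q) + real i / real q"
        by simp
      show "\<Phi> (c + real i / real q + 1 / (2 * real q)) - \<Phi> (c + real i / real q - 1 / (2 * real q))
          = f (Suc i) - f i"
        unfolding f_def e1 e2 ..
    qed
    also have "\<dots> = f q - f 0" by (rule sum_lessThan_telescope)
    also have "\<dots> = I" using I[of "c - 1 / (2 * real q)"] q0 by (simp add: f_def)
    finally show ?thesis .
  qed
  finally show ?thesis .
qed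

text \<open>
  The mean distance of \<open>0, \<dots>, q - 1\<close> from their centre is at most \<open>q / 4\<close>. Passing from \<open>q - 2\<close> to \<open>q\<close> adds two end points.
\<close>

lemma sum_abs_centred_le: "(\<Sum>j<q. \<bar>2 * real j - (real q - 1)\<bar>) \<le> (real q)\<^sup>2 / 2"
proof (induction q rule: nat_less_induct)
  case (1 q)
  show ?case
  proof (cases "q < 2")
    case True
    then have "q = 0 \<or> q = 1" by auto
    then show ?thesis by auto
  next
    case False
    then obtain n where n: "q = Suc (Suc n)" by (metis add_2_eq_Suc le_Suc_ex not_less)
    define f where "f j = \<bar>2 * real j - (real q - 1)\<bar>" for j
    have "sum f {..<q} = f 0 + (\<Sum>j<n. f (Suc j)) + f (Suc n)"
      unfolding n sum.lessThan_Suc[of f "Suc n"] sum.lessThan_Suc_shift[of f n] ..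
    also have "(\<Sum>j<n. f (Suc j)) = (\<Sum>j<n. \<bar>2 * real j - (real n - 1)\<bar>)"
      unfolding n f_def by (intro sum.cong) auto
    also have "\<dots> \<le> (real n)\<^sup>2 / 2" using 1 n by auto
    finally show ?thesis unfolding f_def n by (simp add: power2_eq_square field_simps)
  qed
qed

lemma sum_pairs_sq_diff:
  fixes x :: "nat \<Rightarrow> real"
  shows "(\<Sum>i<q. \<Sum>j<q. (x i - x j)\<^sup>2) = 2 * real q * (\<Sum>i<q. (x i)\<^sup>2) - 2 * (\<Sum>i<q. x i)\<^sup>2"
proof -
  have "(\<Sum>i<q. \<Sum>j<q. (x i - x j)\<^sup>2)
      = (\<Sum>i<q. real q * (x i)\<^sup>2 + (\<Sum>j<q. (x j)\<^sup>2) - 2 * x i * (\<Sum>j<q. x j))"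
    by (simp add: power2_diff sum.distrib sum_subtractf sum_distrib_left mult.assoc)
  also have "\<dots> = 2 * real q * (\<Sum>i<q. (x i)\<^sup>2) - 2 * (\<Sum>i<q. x i)\<^sup>2"
    by (simp add: sum.distrib sum_subtractf power2_eq_square
        flip: sum_distrib_left sum_distrib_right)
  finally show ?thesis .
qed

lemma sum_sq_deviation:
  fixes x :: "nat \<Rightarrow> real"
  assumes "q \<ge> 1" and m: "m = (\<Sum>i<q. x i) / real q"
  shows "(\<Sum>i<q. (x i - m)\<^sup>2) = (\<Sum>i<q. \<Sum>j<q. (x i - x j)\<^sup>2) / (2 * real q)"
proof -
  have "(\<Sum>i<q. x i - m) = 0" using assms by (simp add: sum_subtractf)
  then have "(\<Sum>i<q. \<Sum>j<q. ((x i - m) - (x j - m))\<^sup>2) = 2 * real q * (\<Sum>i<q. (x i - m)\<^sup>2)"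
    using sum_pairs_sq_diff[where q = q and x = "\<lambda>i. x i - m"] by simp
  then show ?thesis using assms by simp
qed

lemma sum_pairs_sq_index: "(\<Sum>i<q. \<Sum>j<q. (real i - real j)\<^sup>2) \<le> (real q) ^ 4 / 6"
proof -
  have 1: "(\<Sum>i<q. real i) = real q * (real q - 1) / 2"
    by (induction q) (auto simp: field_simps)
  have 2: "(\<Sum>i<q. (real i)\<^sup>2) = real q * (real q - 1) * (2 * real q - 1) / 6"
    by (induction q) (auto simp: field_simps power2_eq_square)
  have "(\<Sum>i<q. \<Sum>j<q. (real i - real j)\<^sup>2) = ((real q) ^ 4 - (real q)\<^sup>2) / 6"
    unfolding sum_pairs_sq_diff 1 2 by (simp add: field_simps power2_eq_square power4_eq_xxxx)
  then show ?thesis by simp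
qed

text \<open>
  Cauchy-Schwarz along the \<open>j - i\<close> steps between the two particles. Shifting the window brings in at most
  \<open>j\<close> new steps, each of square at most 1.
\<close>

lemma window_sq_diff_le:
  fixes P :: "nat \<Rightarrow> real"
  assumes step: "\<And>k. \<bar>P (Suc k) - P k\<bar> \<le> 1" and i: "i \<le> j"
  shows "(\<Sum>k<N. (P (k + j) - P (k + i))\<^sup>2)
    \<le> (real j - real i)\<^sup>2 * ((\<Sum>k<N. (P (Suc k) - P k)\<^sup>2) + real j)"
proof -
  define D where "D k = P (Suc k) - P k" for k
  have D1: "(D k)\<^sup>2 \<le> 1" for k using step[of k] by (simp add: D_def abs_square_le_1)
  have shift: "(\<Sum>k<N. (D (k + l))\<^sup>2) \<le> (\<Sum>k<N. (D k)\<^sup>2) + real l" for l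
  proof -
    have "(\<Sum>k<N. (D (k + l))\<^sup>2) = (\<Sum>k\<in>{l..<N + l}. (D k)\<^sup>2)"
      using sum.shift_bounds_nat_ivl[of "\<lambda>k. (D k)\<^sup>2" 0 l N] by (simp add: lessThan_atLeast0)
    also have "\<dots> \<le> (\<Sum>k<N + l. (D k)\<^sup>2)" by (rule sum_mono2) auto
    also have "\<dots> = (\<Sum>k<N. (D k)\<^sup>2) + (\<Sum>k\<in>{N..<N + l}. (D k)\<^sup>2)"
      by (simp add: lessThan_atLeast0 sum.atLeastLessThan_concat)
    also have "(\<Sum>k\<in>{N..<N + l}. (D k)\<^sup>2) \<le> real l"
      using sum_bounded_above[of "{N..<N + l}" "\<lambda>k. (D k)\<^sup>2" 1] D1 by simp
    finally show ?thesis by simp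
  qed
  have "(P (k + j) - P (k + i))\<^sup>2 \<le> (real j - real i) * (\<Sum>l\<in>{i..<j}. (D (k + l))\<^sup>2)" for k
  proof -
    have "P (k + j) - P (k + i) = (\<Sum>l\<in>{i..<j}. 1 * D (k + l))"
      using sum_Suc_diff'[OF i, of "\<lambda>l. P (k + l)"] by (simp add: D_def)
    also have "\<dots>\<^sup>2 \<le> (\<Sum>l\<in>{i..<j}. 1\<^sup>2) * (\<Sum>l\<in>{i..<j}. (D (k + l))\<^sup>2)"
      by (rule Cauchy_Schwarz_ineq_sum)
    finally show ?thesis using i by (simp add: of_nat_diff)
  qed
  then have "(\<Sum>k<N. (P (k + j) - P (k + i))\<^sup>2)
      \<le> (\<Sum>k<N. (real j - real i) * (\<Sum>l\<in>{i..<j}. (D (k + l))\<^sup>2))"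
    by (rule sum_mono)
  also have "\<dots> = (real j - real i) * (\<Sum>l\<in>{i..<j}. \<Sum>k<N. (D (k + l))\<^sup>2)"
    by (simp add: sum.swap[of _ "{i..<j}"] flip: sum_distrib_left)
  also have "\<dots> \<le> (real j - real i) * (\<Sum>l\<in>{i..<j}. (\<Sum>k<N. (D k)\<^sup>2) + real j)"
  proof (intro mult_left_mono sum_mono)
    show "(\<Sum>k<N. (D (k + l))\<^sup>2) \<le> (\<Sum>k<N. (D k)\<^sup>2) + real j" if "l \<in> {i..<j}" for l
      using shift[of l] that by auto
  qed (use i in simp)
  also have "\<dots> = (real j - real i)\<^sup>2 * ((\<Sum>k<N. (D k)\<^sup>2) + real j)"
    using i by (simp add: of_nat_diff power2_eq_square)
  finally show ?thesis unfolding D_def .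
qed

lemma sum_abs_sq_le_card:
  fixes f :: "'a \<Rightarrow> real"
  shows "(\<Sum>x\<in>A. \<bar>f x\<bar>)\<^sup>2 \<le> real (card A) * (\<Sum>x\<in>A. (f x)\<^sup>2)"
  using Cauchy_Schwarz_ineq_sum[of "\<lambda>_. 1" "\<lambda>x. \<bar>f x\<bar>" A] by simp

text \<open>
  The factor \<open>1 / \<surd>12\<close> is the standard deviation of the uniform distribution: a block of \<open>q\<close> values with
  mean square step \<open>\<sigma>\<^sup>2\<close> has mean square deviation at most \<open>\<sigma>\<^sup>2 q\<^sup>2 / 12\<close>, nearly attained by long linear
  blocks.
\<close>

lemma deviation_sum_le:
  fixes P :: "nat \<Rightarrow> real"
  assumes step: "\<And>k. \<bar>P (Suc k) - P k\<bar> \<le> 1" and q: "q \<ge> 1"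
    and \<mu>: "\<And>k. \<mu> k = (\<Sum>j<q. P (k + j)) / real q"
  shows "(\<Sum>k<N. \<Sum>j<q. \<bar>P (k + j) - \<mu> k\<bar>)
    \<le> (real q)\<^sup>2 / sqrt 12 * sqrt (real N * ((\<Sum>k<N. (P (Suc k) - P k)\<^sup>2) + real q))"
proof -
  define S where "S = (\<Sum>k<N. (P (Suc k) - P k)\<^sup>2)"
  have S0: "0 \<le> S" by (simp add: S_def sum_nonneg)
  have pair: "(\<Sum>k<N. (P (k + i) - P (k + j))\<^sup>2) \<le> (real i - real j)\<^sup>2 * (S + real q)"
    if "i < q" "j < q" for i j
  proof -
    have *: "(\<Sum>k<N. (P (k + i) - P (k + j))\<^sup>2) \<le> (real i - real j)\<^sup>2 * (S + real q)"
      if "j \<le> i" "i < q" for i j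
    proof -
      have "(\<Sum>k<N. (P (k + i) - P (k + j))\<^sup>2) \<le> (real i - real j)\<^sup>2 * (S + real i)"
        unfolding S_def by (rule window_sq_diff_le[where P = P, OF step that(1)])
      also have "\<dots> \<le> (real i - real j)\<^sup>2 * (S + real q)"
        using that by (intro mult_left_mono) auto
      finally show ?thesis .
    qed
    show ?thesis
    proof (cases "j \<le> i")
      case False
      then show ?thesis using *[of i j] that by (simp add: power2_commute)
    qed (use * that in blast)
  qed
  have "(\<Sum>k<N. \<Sum>j<q. \<bar>P (k + j) - \<mu> k\<bar>)\<^sup>2
      = (\<Sum>z\<in>{..<N}\<times>{..<q}. \<bar>P (fst z + snd z) - \<mu> (fst z)\<bar>)\<^sup>2"
    by (simp add: sum.cartesian_product case_prod_unfold)
  also have "\<dots> \<le> real (card ({..<N}\<times>{..<q})) * (\<Sum>z\<in>{..<N}\<times>{..<q}. (P (fst z + snd z) - \<mu> (fst z))\<^sup>2)"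
    by (rule sum_abs_sq_le_card)
  also have "\<dots> = real N * real q * (\<Sum>k<N. \<Sum>j<q. (P (k + j) - \<mu> k)\<^sup>2)"
    by (simp add: sum.cartesian_product case_prod_unfold)
  also have "(\<Sum>k<N. \<Sum>j<q. (P (k + j) - \<mu> k)\<^sup>2)
      = (\<Sum>k<N. (\<Sum>i<q. \<Sum>j<q. (P (k + i) - P (k + j))\<^sup>2)) / (2 * real q)"
    by (simp only: sum_sq_deviation[OF q \<mu>] flip: sum_divide_distrib)
  also have "(\<Sum>k<N. (\<Sum>i<q. \<Sum>j<q. (P (k + i) - P (k + j))\<^sup>2))
      = (\<Sum>i<q. \<Sum>j<q. \<Sum>k<N. (P (k + i) - P (k + j))\<^sup>2)"
    by (subst sum.swap, intro sum.cong refl sum.swap)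
  also have "real N * real q * (\<dots> / (2 * real q)) \<le>
      real N * real q * ((\<Sum>i<q. \<Sum>j<q. (real i - real j)\<^sup>2 * (S + real q)) / (2 * real q))"
    using pair by (intro mult_left_mono divide_right_mono sum_mono) auto
  also have "\<dots> = real N * (S + real q) / 2 * (\<Sum>i<q. \<Sum>j<q. (real i - real j)\<^sup>2)"
    using q by (simp flip: sum_distrib_right)
  also have "\<dots> \<le> real N * (S + real q) / 2 * ((real q) ^ 4 / 6)"
    using S0 by (intro mult_left_mono sum_pairs_sq_index) auto
  also have "\<dots> = ((real q)\<^sup>2 / sqrt 12 * sqrt (real N * (S + real q)))\<^sup>2"
    using S0 by (simp add: power_mult_distrib power_divide)
  finally show ?thesis
    unfolding S_def[symmetric] using S0 by (elim power2_le_imp_le) auto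
qed

text \<open>
  The block starting at \<open>k\<close> is matched with the arithmetic progression of step \<open>p / q\<close> that has the same
  mean. The distance between partners has a part from the slope error \<open>\<rho> - p / q\<close>, controlled by
  \<open>sum_abs_centred_le\<close>, and a part from the fluctuations, controlled by \<open>deviation_sum_le\<close>. Averaging over all
  starting points \<open>k\<close> counts each particle \<open>q\<close> times, apart from those near the ends of the window.
\<close>

lemma window_average_le:
  fixes \<phi> \<Phi> :: "real \<Rightarrow> real" and p :: int and q :: nat and X :: "nat \<Rightarrow> real"
  assumes lip: "\<And>x y. \<bar>\<phi> x - \<phi> y\<bar> \<le> \<bar>x - y\<bar>"
    and per: "\<And>x. \<phi> (x + 1) = \<phi> x"
    and range: "\<And>x. 0 \<le> \<phi> x" "\<And>x. \<phi> x \<le> 1 / 2"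
    and \<Phi>: "\<And>x. (\<Phi> has_real_derivative \<phi> x) (at x)"
    and I: "\<And>x. \<Phi> (x + 1) - \<Phi> x = I"
    and pq: "coprime p (int q)" "q \<ge> 1"
    and step: "\<And>k. \<bar>X (Suc k) - X k - \<rho>\<bar> \<le> 1" and N: "N \<ge> 1"
    and S: "(\<Sum>k<N. (X (Suc k) - X k - \<rho>)\<^sup>2) \<le> real N * S"
  shows "(\<Sum>k<N. \<phi> (X k)) \<le> real N * (I + (1 / (4 * real q) + real q / 4 * \<bar>of_int p / real q - \<rho>\<bar>
    + real q / sqrt 12 * sqrt (S + real q / real N)) + real q / (2 * real N))"
proof -
  define P where "P k = X k - real k * \<rho>" for k
  define \<mu> where "\<mu> k = (\<Sum>j<q. P (k + j)) / real q" for k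
  define e where "e = \<rho> - of_int p / real q"
  define c where "c k = real k * \<rho> + \<mu> k + (real q - 1) / 2 * e" for k
  have PS: "P (Suc k) - P k = X (Suc k) - X k - \<rho>" for k by (simp add: P_def algebra_simps)
  have q0: "0 < real q" using pq by simp
  have block: "(\<Sum>j<q. \<phi> (X (k + j)))
      \<le> real q * I + 1 / 4 + (\<Sum>j<q. \<bar>P (k + j) - \<mu> k\<bar>) + \<bar>e\<bar> * ((real q)\<^sup>2 / 4)" for k
  proof -
    have "(\<Sum>j<q. \<phi> (X (k + j))) \<le> (\<Sum>j<q. \<phi> (c k + real j * (of_int p / real q))
        + (\<bar>P (k + j) - \<mu> k\<bar> + \<bar>e\<bar> / 2 * \<bar>2 * real j - (real q - 1)\<bar>))"
    proof (rule sum_mono)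
      fix j
      have "X (k + j) - (c k + real j * (of_int p / real q))
          = (P (k + j) - \<mu> k) + e / 2 * (2 * real j - (real q - 1))"
        by (simp add: P_def c_def e_def field_simps)
      then have "\<bar>X (k + j) - (c k + real j * (of_int p / real q))\<bar>
          \<le> \<bar>P (k + j) - \<mu> k\<bar> + \<bar>e / 2 * (2 * real j - (real q - 1))\<bar>"
        using abs_triangle_ineq by metis
      also have "\<bar>e / 2 * (2 * real j - (real q - 1))\<bar> = \<bar>e\<bar> / 2 * \<bar>2 * real j - (real q - 1)\<bar>"
        by (simp add: abs_mult)
      finally show "\<phi> (X (k + j)) \<le> \<phi> (c k + real j * (of_int p / real q))
        + (\<bar>P (k + j) - \<mu> k\<bar> + \<bar>e\<bar> / 2 * \<bar>2 * real j - (real q - 1)\<bar>)"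
        using lip[of "X (k + j)" "c k + real j * (of_int p / real q)"] by linarith
    qed
    also have "\<dots> = (\<Sum>j<q. \<phi> (c k + real j * (of_int p / real q))) + (\<Sum>j<q. \<bar>P (k + j) - \<mu> k\<bar>)
        + \<bar>e\<bar> / 2 * (\<Sum>j<q. \<bar>2 * real j - (real q - 1)\<bar>)"
      by (simp add: sum.distrib sum_distrib_left)
    also have "\<dots> \<le> (real q * I + 1 / 4) + (\<Sum>j<q. \<bar>P (k + j) - \<mu> k\<bar>) + \<bar>e\<bar> / 2 * ((real q)\<^sup>2 / 2)"
      by (intro add_mono equidistributed_sum_le[OF lip per \<Phi> I pq] order_refl
          mult_left_mono sum_abs_centred_le) auto
    finally show ?thesis by simp
  qed
  have shift: "(\<Sum>k<N. \<phi> (X k)) \<le> (\<Sum>k<N. \<phi> (X (k + j))) + real q / 2" if "j < q" for j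
  proof -
    have "(\<Sum>k<N. \<phi> (X k)) \<le> (\<Sum>k<N + j. \<phi> (X k))"
      by (rule sum_mono2) (use range in auto)
    also have "\<dots> = (\<Sum>k<j. \<phi> (X k)) + (\<Sum>k\<in>{j..<N + j}. \<phi> (X k))"
      by (simp add: lessThan_atLeast0 sum.atLeastLessThan_concat)
    also have "(\<Sum>k\<in>{j..<N + j}. \<phi> (X k)) = (\<Sum>k<N. \<phi> (X (k + j)))"
      using sum.shift_bounds_nat_ivl[of "\<lambda>k. \<phi> (X k)" 0 j N] by (simp add: lessThan_atLeast0)
    also have "(\<Sum>k<j. \<phi> (X k)) \<le> real j * (1 / 2)"
      using sum_bounded_above[of "{..<j}" "\<lambda>k. \<phi> (X k)" "1 / 2"] range(2) by simp
    also have "real j * (1 / 2) \<le> real q / 2" using that by simp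
    finally show ?thesis by simp
  qed
  have "real q * (\<Sum>k<N. \<phi> (X k)) = (\<Sum>j<q. \<Sum>k<N. \<phi> (X k))" by simp
  also have "\<dots> \<le> (\<Sum>j<q. (\<Sum>k<N. \<phi> (X (k + j))) + real q / 2)"
    by (intro sum_mono shift) auto
  also have "\<dots> = (\<Sum>k<N. \<Sum>j<q. \<phi> (X (k + j))) + real q * (real q / 2)"
    by (simp add: sum.distrib sum.swap[of _ "{..<q}"])
  also have "(\<Sum>k<N. \<Sum>j<q. \<phi> (X (k + j)))
      \<le> (\<Sum>k<N. real q * I + 1 / 4 + (\<Sum>j<q. \<bar>P (k + j) - \<mu> k\<bar>) + \<bar>e\<bar> * ((real q)\<^sup>2 / 4))"
    by (intro sum_mono block)
  also have "\<dots> = real N * (real q * I + 1 / 4 + \<bar>e\<bar> * ((real q)\<^sup>2 / 4))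
      + (\<Sum>k<N. \<Sum>j<q. \<bar>P (k + j) - \<mu> k\<bar>)"
    by (simp add: sum.distrib algebra_simps)
  also have "(\<Sum>k<N. \<Sum>j<q. \<bar>P (k + j) - \<mu> k\<bar>)
      \<le> (real q)\<^sup>2 / sqrt 12 * sqrt (real N * ((\<Sum>k<N. (P (Suc k) - P k)\<^sup>2) + real q))"
    by (rule deviation_sum_le) (use step pq in \<open>auto simp: PS \<mu>_def\<close>)
  also have "sqrt (real N * ((\<Sum>k<N. (P (Suc k) - P k)\<^sup>2) + real q))
      \<le> sqrt ((real N)\<^sup>2 * (S + real q / real N))"
  proof (rule real_sqrt_le_mono)
    have "real N * ((\<Sum>k<N. (P (Suc k) - P k)\<^sup>2) + real q) \<le> real N * (real N * S + real q)"
      using S by (intro mult_left_mono) (auto simp: PS)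
    also have "\<dots> = (real N)\<^sup>2 * (S + real q / real N)"
      using N by (simp add: power2_eq_square field_simps)
    finally show "real N * ((\<Sum>k<N. (P (Suc k) - P k)\<^sup>2) + real q) \<le> (real N)\<^sup>2 * (S + real q / real N)" .
  qed
  finally have "real q * (\<Sum>k<N. \<phi> (X k)) \<le> real N * (real q * I + 1 / 4 + \<bar>e\<bar> * ((real q)\<^sup>2 / 4))
      + (real q)\<^sup>2 / sqrt 12 * (real N * sqrt (S + real q / real N)) + real q * (real q / 2)"
    by (simp add: real_sqrt_mult mult_left_mono divide_right_mono)
  also have "\<dots> = real q * (real N * (I + (1 / (4 * real q) + real q / 4 * \<bar>e\<bar>
      + real q / sqrt 12 * sqrt (S + real q / real N)) + real q / (2 * real N)))"
    using q0 N by (simp add: field_simps power2_eq_square)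
  finally show ?thesis using q0 by (simp add: e_def abs_minus_commute)
qed

section \<open>Discrepancy on the circle\<close>

text \<open>
  The test function is \<open>max 0 (r - dist)\<close>, where \<open>dist\<close> is the distance modulo 1 to the arc of length \<open>l\<close> centred
  at \<open>m\<close>. Its integral consists of the plateau \<open>r l\<close> and two triangles of area \<open>r\<^sup>2 / 2\<close>; the bound on \<open>l / 2 + r\<close>
  keeps the two flanks from overlapping.
\<close>

lemma circle_trapezoid:
  fixes m r l :: real
  assumes "0 \<le> r" "0 \<le> l" "l / 2 + r \<le> 1 / 2"
  obtains \<phi> \<Phi> :: "real \<Rightarrow> real" and I :: real
  where "\<And>x y. \<bar>\<phi> x - \<phi> y\<bar> \<le> \<bar>x - y\<bar>" "\<And>x. \<phi> (x + 1) = \<phi> x"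
    "\<And>x. 0 \<le> \<phi> x" "\<And>x. \<phi> x \<le> r" "\<And>x. (\<Phi> has_real_derivative \<phi> x) (at x)"
    "\<And>x. \<Phi> (x + 1) - \<Phi> x = I" "I \<le> r * l + r\<^sup>2"
    "\<And>x n. \<bar>x - m - of_int n\<bar> \<le> l / 2 \<Longrightarrow> \<phi> x = r"
proof -
  define cd where "cd x = \<bar>x - of_int (round x)\<bar>" for x :: real
  have cd_le: "cd x \<le> \<bar>x - of_int n\<bar>" for x n unfolding cd_def by (rule round_diff_minimal)
  have cd_lip: "\<bar>cd x - cd y\<bar> \<le> \<bar>x - y\<bar>" for x y
    using cd_le[of x "round y"] cd_le[of y "round x"] unfolding cd_def by linarith
  have cd_eq: "cd x = \<bar>x\<bar>" if "\<bar>x\<bar> \<le> 1 / 2" for x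
  proof -
    have "\<bar>x\<bar> \<le> \<bar>x - of_int n\<bar>" for n
    proof (cases "n = 0")
      case False
      then have "1 \<le> \<bar>real_of_int n\<bar>" by (metis of_int_1_le_iff of_int_abs zero_less_abs_iff int_one_le_iff_zero_less)
      then show ?thesis using that by linarith
    qed simp
    then show ?thesis using cd_le[of x 0] unfolding cd_def by (metis diff_zero nle_le of_int_0)
  qed
  have cd_per: "cd (x + 1) = cd x" for x
    using cd_le[of "x + 1" "round x + 1"] cd_le[of x "round (x + 1) - 1"] unfolding cd_def by simp
  define \<phi> where "\<phi> x = max 0 (min r (r + l / 2 - cd (x - m)))" for x
  have lip: "\<bar>\<phi> x - \<phi> y\<bar> \<le> \<bar>x - y\<bar>" for x y
    using cd_lip[of "x - m" "y - m"] unfolding \<phi>_def by linarith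
  have per: "\<phi> (x + 1) = \<phi> x" for x
    using cd_per[of "x - m"] unfolding \<phi>_def by (simp add: algebra_simps)
  have "continuous_on UNIV \<phi>"
    by (rule lipschitz_on_continuous_on[of 1]) (auto intro!: lipschitz_onI simp: dist_real_def lip)
  then obtain \<Phi> where "\<And>x. (\<Phi> has_vector_derivative \<phi> x) (at x)"
    using einterval_antiderivative[of "-\<infinity>" "\<infinity>" \<phi>] by (auto simp: continuous_on_eq_continuous_at)
  then have \<Phi>: "(\<Phi> has_real_derivative \<phi> x) (at x)" for x
    by (simp add: has_real_derivative_iff_has_vector_derivative)
  define I where "I = \<Phi> (m + 1 / 2) - \<Phi> (m - 1 / 2)"
  have *: "\<Phi> (x + 1) - \<Phi> x = \<Phi> (m - 1 / 2 + 1) - \<Phi> (m - 1 / 2)" for x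
  proof (rule DERIV_isconst_all[where f = "\<lambda>x. \<Phi> (x + 1) - \<Phi> x"])
    show "\<forall>x. ((\<lambda>x. \<Phi> (x + 1) - \<Phi> x) has_real_derivative 0) (at x)"
    proof
      fix x
      have "((\<lambda>x. \<Phi> (x + 1)) has_real_derivative \<phi> (x + 1)) (at x)"
        using \<Phi>[of "x + 1"] by (simp add: DERIV_shift)
      from DERIV_diff[OF this \<Phi>[of x]] show "((\<lambda>x. \<Phi> (x + 1) - \<Phi> x) has_real_derivative 0) (at x)"
        by (simp add: per)
    qed
  qed
  have I: "\<Phi> (x + 1) - \<Phi> x = I" for x 
  proof -
    have "m - 1 / 2 + 1 = m + 1 / 2" by simp
    with * show ?thesis unfolding I_def by metis
  qed
  define A B C D where "A = m - l / 2 - r" and "B = m - l / 2" and "C = m + l / 2" and "D = m + l / 2 + r"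
  have at: "\<phi> x = max 0 (min r (r + l / 2 - \<bar>x - m\<bar>))" if "m - 1 / 2 \<le> x" "x \<le> m + 1 / 2" for x
  proof -
    have "\<bar>x - m\<bar> \<le> 1 / 2" using that by linarith
    then show ?thesis unfolding \<phi>_def by (simp add: cd_eq)
  qed
  have "\<Phi> A - \<Phi> (m - 1 / 2) \<le> (\<lambda>x. 0 * x) A - (\<lambda>x. 0 * x) (m - 1 / 2)"
    by (rule deriv_le_imp_diff_le[OF _ \<Phi>, where g = "\<lambda>_. 0"])
       (use assms at in \<open>auto simp: A_def\<close>)
  moreover have "\<Phi> B - \<Phi> A \<le> (\<lambda>x. (x - A)\<^sup>2 / 2) B - (\<lambda>x. (x - A)\<^sup>2 / 2) A"
    by (rule deriv_le_imp_diff_le[OF _ \<Phi>, where g = "\<lambda>x. x - A"])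
       (use assms at in \<open>auto simp: A_def B_def intro!: derivative_eq_intros\<close>)
  moreover have "\<Phi> C - \<Phi> B \<le> (\<lambda>x. r * x) C - (\<lambda>x. r * x) B"
    by (rule deriv_le_imp_diff_le[OF _ \<Phi>, where g = "\<lambda>x. r"])
       (use assms at in \<open>auto simp: C_def B_def intro!: derivative_eq_intros\<close>)
  moreover have "\<Phi> D - \<Phi> C \<le> (\<lambda>x. - ((D - x)\<^sup>2 / 2)) D - (\<lambda>x. - ((D - x)\<^sup>2 / 2)) C"
    by (rule deriv_le_imp_diff_le[OF _ \<Phi>, where g = "\<lambda>x. D - x"])
       (use assms at in \<open>auto simp: C_def D_def field_simps intro!: derivative_eq_intros\<close>)
  moreover have "\<Phi> (m + 1 / 2) - \<Phi> D \<le> (\<lambda>x. 0 * x) (m + 1 / 2) - (\<lambda>x. 0 * x) D"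
    by (rule deriv_le_imp_diff_le[OF _ \<Phi>, where g = "\<lambda>_. 0"])
       (use assms at in \<open>auto simp: D_def\<close>)
  ultimately have "I \<le> (B - A)\<^sup>2 / 2 + r * (C - B) + (D - C)\<^sup>2 / 2"
    unfolding I_def by (simp add: right_diff_distrib)
  then have "I \<le> r * l + r\<^sup>2"
    by (simp add: A_def B_def C_def D_def)
  moreover have "\<phi> x = r" if "\<bar>x - m - of_int n\<bar> \<le> l / 2" for x n
    using cd_le[of "x - m" n] that assms(1) unfolding \<phi>_def by simp
  moreover have "0 \<le> \<phi> x" "\<phi> x \<le> r" for x using assms(1) by (auto simp: \<phi>_def)
  ultimately show thesis using that[of \<phi> \<Phi> I] lip per \<Phi> I by blast
qed

text \<open>
  If too few points lie in the arc \<open>(a, a + s]\<close>, too many lie in the complementary arc of length \<open>1 - s\<close>. On the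
  trapezoid of height \<open>r = D / 2\<close> over the complement the excess is worth more than \<open>r D\<close>, of which the
  flanks account for \<open>r\<^sup>2\<close>; the remaining \<open>D\<^sup>2 / 4\<close> exceeds what the test inequality allows.
\<close>

lemma card_below_ge:
  fixes X y :: "nat \<Rightarrow> real"
  assumes test: "\<And>\<phi> \<Phi> I. (\<And>x y. \<bar>\<phi> x - \<phi> y\<bar> \<le> \<bar>x - y\<bar>) \<Longrightarrow> (\<And>x. \<phi> (x + 1) = \<phi> x) \<Longrightarrow>
      (\<And>x. 0 \<le> \<phi> x) \<Longrightarrow> (\<And>x. \<phi> x \<le> 1 / 2) \<Longrightarrow> (\<And>x. (\<Phi> has_real_derivative \<phi> x) (at x)) \<Longrightarrow>
      (\<And>x. \<Phi> (x + 1) - \<Phi> x = I) \<Longrightarrow> (\<Sum>k<N. \<phi> (X k)) \<le> real N * (I + D\<^sup>2 / 4)"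
    and y: "\<And>k. 0 < y k" "\<And>k. y k \<le> 1" "\<And>k. y k = X k - a - of_int (n k)"
    and D: "0 < D" and s: "0 \<le> s" "s \<le> 1"
  shows "real N * (s - D) \<le> real (card {k\<in>{..<N}. y k \<le> s})"
proof (rule ccontr)
  let ?C = "{k\<in>{..<N}. y k \<le> s}" and ?E = "{k\<in>{..<N}. \<not> y k \<le> s}"
  assume "\<not> ?thesis"
  then have less: "real (card ?C) < real N * (s - D)" by simp
  then have N: "0 < real N" using of_nat_0_le_iff[of "card ?C"] by (cases "N = 0") auto
  have "0 < real N * (s - D)" using less by linarith
  then have sD: "D < s" using N by (simp add: zero_less_mult_iff)
  define r l where "r = D / 2" and "l = 1 - s"
  have "l / 2 + r \<le> 1 / 2" using sD s unfolding r_def l_def by argo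
  then obtain \<phi> \<Phi> I where \<phi>: "\<And>x y. \<bar>\<phi> x - \<phi> y\<bar> \<le> \<bar>x - y\<bar>" "\<And>x. \<phi> (x + 1) = \<phi> x"
      "\<And>x. 0 \<le> \<phi> x" "\<And>x. \<phi> x \<le> r" "\<And>x. (\<Phi> has_real_derivative \<phi> x) (at x)"
      "\<And>x. \<Phi> (x + 1) - \<Phi> x = I" and I: "I \<le> r * l + r\<^sup>2"
      and plateau: "\<And>x n. \<bar>x - (a + s + l / 2) - of_int n\<bar> \<le> l / 2 \<Longrightarrow> \<phi> x = r"
    by (rule circle_trapezoid[of r l "a + s + l / 2", rotated 2]) (use D s in \<open>auto simp: r_def l_def\<close>)
  have "r \<le> 1 / 2" using sD s by (simp add: r_def)
  then have half: "\<phi> x \<le> 1 / 2" for x using \<phi>(4)[of x] by linarith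
  have "(\<Sum>k<N. \<phi> (X k)) \<le> real N * (I + D\<^sup>2 / 4)"
    by (rule test[OF \<phi>(1,2,3) half \<phi>(5,6)])
  also have "\<dots> \<le> real N * (r * l + r\<^sup>2 + D\<^sup>2 / 4)"
    using I by (intro mult_left_mono) auto
  also have "\<dots> = r * (real N * (l + D))"
    by (simp add: r_def power2_eq_square field_simps)
  finally have upper: "(\<Sum>k<N. \<phi> (X k)) \<le> r * (real N * (l + D))" .
  have "(\<Sum>k\<in>?E. r) \<le> (\<Sum>k\<in>?E. \<phi> (X k))"
  proof (rule sum_mono)
    fix k assume "k \<in> ?E"
    then have "\<bar>X k - (a + s + l / 2) - of_int (n k)\<bar> \<le> l / 2"
      using y(2)[of k] y(3)[of k] unfolding l_def by (simp add: abs_le_iff) argo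
    then show "r \<le> \<phi> (X k)" using plateau by simp
  qed
  also have "\<dots> \<le> (\<Sum>k<N. \<phi> (X k))" by (rule sum_mono2) (use \<phi>(3) in auto)
  finally have "r * real (card ?E) \<le> (\<Sum>k<N. \<phi> (X k))" by (simp add: mult.commute)
  moreover have "card ?C + card ?E = N"
  proof -
    have "card ?C + card ?E = card (?C \<union> ?E)" by (rule card_Un_disjoint[symmetric]) auto
    also have "?C \<union> ?E = {..<N}" by auto
    finally show ?thesis by simp
  qed
  then have "real (card ?C) + real (card ?E) = real N" by (metis of_nat_add)
  then have "real N * (l + D) < real (card ?E)" using less by (simp add: l_def algebra_simps)
  then have "r * (real N * (l + D)) < r * real (card ?E)" using D by (simp add: r_def)
  ultimately show False using upper by linarith
qed

text \<open>
  Layer-cake formula: \<open>1 - max y s0\<close> is the length of \<open>{s \<in> [s0, 1]. y \<le> s}\<close>, so the sum is controlled by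
  integrating the counting function from \<open>s0\<close> to 1.
\<close>

lemma sum_max_le:
  fixes y :: "nat \<Rightarrow> real"
  assumes y: "\<And>k. y k \<le> 1" and s0: "0 \<le> s0" "s0 \<le> 1" and D: "0 \<le> D" "D \<le> 1"
    and count: "\<And>s. 0 \<le> s \<Longrightarrow> s \<le> 1 \<Longrightarrow> real N * (s - D) \<le> real (card {k\<in>{..<N}. y k \<le> s})"
  shows "(\<Sum>k<N. max (y k) s0) \<le> real N * (1 - (1 - D)\<^sup>2 / 2 + (max (s0 - D) 0)\<^sup>2 / 2)"
proof -
  define s1 where "s1 = max s0 D"
  have s1: "s0 \<le> s1" "D \<le> s1" "s1 \<le> 1" using s0 D by (auto simp: s1_def)
  have "((\<lambda>s. if s \<in> {max (y k) s0..1} then 1 else 0) has_integral (1 - max (y k) s0)) {s0..1}" for k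
    by (subst has_integral_restrict) (use has_integral_const_real[of "1::real" "max (y k) s0" 1] y[of k] s0 in auto)
  then have L: "((\<lambda>s. \<Sum>k<N. if s \<in> {max (y k) s0..1} then 1 else 0)
      has_integral (\<Sum>k<N. 1 - max (y k) s0)) {s0..1}"
    by (intro has_integral_sum) auto
  have "((\<lambda>s. real N * (s - D)) has_integral
      (real N * ((1 - D)\<^sup>2 / 2) - real N * ((s1 - D)\<^sup>2 / 2))) {s1..1}"
    by (rule fundamental_theorem_of_calculus[OF s1(3)])
       (auto intro!: derivative_eq_intros simp: has_real_derivative_iff_has_vector_derivative[symmetric])
  then have R: "((\<lambda>s. if s \<in> {s1..1} then real N * (s - D) else 0) has_integral
      (real N * ((1 - D)\<^sup>2 / 2) - real N * ((s1 - D)\<^sup>2 / 2))) {s0..1}"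
    by (subst has_integral_restrict) (use s1 in auto)
  have "real N * ((1 - D)\<^sup>2 / 2) - real N * ((s1 - D)\<^sup>2 / 2) \<le> (\<Sum>k<N. 1 - max (y k) s0)"
  proof (rule has_integral_le[OF R L])
    fix s assume s: "s \<in> {s0..1}"
    have "(\<Sum>k<N. if s \<in> {max (y k) s0..1} then 1 else 0) = real (card {k\<in>{..<N}. y k \<le> s})"
      using s by (simp add: sum.If_cases Int_def)
    then show "(if s \<in> {s1..1} then real N * (s - D) else 0)
        \<le> (\<Sum>k<N. if s \<in> {max (y k) s0..1} then 1 else 0)"
      using count[of s] s s0 by auto
  qed
  moreover have "s1 - D = max (s0 - D) 0" by (auto simp: s1_def)
  ultimately show ?thesis by (simp add: sum_subtractf algebra_simps)
qed

section \<open>Barriers and energy decay\<close>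

text \<open>
  After the last time above \<open>c\<close> the function would stay in \<open>[a, c]\<close> for a while, where it cannot decrease. The strict inequality
  \<open>a < c\<close> makes room for this: nothing is known about the derivative below \<open>a\<close>.
\<close>

lemma no_return_below:
  fixes f :: "real \<Rightarrow> real"
  assumes cont: "continuous_on {s..t} f" and "s \<le> t"
    and deriv: "\<And>x. s < x \<Longrightarrow> x < t \<Longrightarrow> \<exists>D. (f has_real_derivative D) (at x) \<and> (a \<le> f x \<and> f x \<le> b \<longrightarrow> 0 \<le> D)"
    and c: "a < c" "c \<le> b" and start: "c \<le> f s"
  shows "c \<le> f t"
proof (rule ccontr)
  assume "\<not> c \<le> f t"
  then have ft: "f t < c" by simp
  define S where "S = {s..t} \<inter> f -` {c..}"
  have "closed S" unfolding S_def by (rule continuous_closed_preimage[OF cont]) auto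
  moreover have "S \<noteq> {}" "bdd_above S" using start \<open>s \<le> t\<close> by (auto simp: S_def)
  ultimately have "Sup S \<in> S" by (intro closed_contains_Sup)
  define r where "r = Sup S"
  have r: "s \<le> r" "r \<le> t" "c \<le> f r" using \<open>Sup S \<in> S\<close> by (auto simp: S_def r_def)
  have below: "f x < c" if "r < x" "x \<le> t" for x
  proof (rule ccontr)
    assume "\<not> f x < c"
    then have "x \<in> S" using that r by (auto simp: S_def)
    then have "x \<le> r" unfolding r_def by (rule cSup_upper) fact
    then show False using that by simp
  qed
  have "r < t" using r ft by (cases "r = t") auto
  have "continuous (at r within {s..t}) f" using cont r by (auto simp: continuous_on_eq_continuous_within)
  then obtain d where d: "d > 0" "\<And>x. x \<in> {s..t} \<Longrightarrow> \<bar>x - r\<bar> < d \<Longrightarrow> \<bar>f x - f r\<bar> < c - a"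
    using c unfolding continuous_within_eps_delta dist_real_def by (metis diff_gt_0_iff_gt)
  define x1 where "x1 = min t (r + d / 2)"
  have x1: "r < x1" "x1 \<le> t" "x1 < r + d" using d \<open>r < t\<close> by (auto simp: x1_def)
  have "f r \<le> f x1"
  proof (rule increasing_off_finite[of "{}" r x1 f])
    show "continuous_on {r..x1} f" by (rule continuous_on_subset[OF cont]) (use x1 r in auto)
    fix x assume x: "r < x" "x < x1"
    have "f x \<le> b" using below[of x] x x1 c by simp
    moreover have "a \<le> f x" using d(2)[of x] x x1 r by auto
    ultimately show "\<exists>D\<ge>0. (f has_real_derivative D) (at x)" using deriv[of x] x x1 r by auto
  qed (use x1 in auto)
  then show False using below[of x1] x1 r by simp
qed

text \<open>
  By \<open>no_return_below\<close> a function that has not passed \<open>b\<close> in the end has spent the whole time in \<open>[f s, b]\<close>,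
  where it grows at rate \<open>\<beta>\<close>.
\<close>

lemma pushed_up:
  fixes f :: "real \<Rightarrow> real"
  assumes cont: "continuous_on {s..t} f" and "s \<le> t"
    and deriv: "\<And>x. s < x \<Longrightarrow> x < t \<Longrightarrow> \<exists>D. (f has_real_derivative D) (at x) \<and> (a \<le> f x \<and> f x \<le> b \<longrightarrow> \<beta> \<le> D)"
    and \<beta>: "0 \<le> \<beta>" and a: "a < f s" "a < b"
  shows "min b (f s + \<beta> * (t - s)) \<le> f t"
proof -
  have stay: "c \<le> f y" if "s \<le> x" "x \<le> y" "y \<le> t" "a < c" "c \<le> b" "c \<le> f x" for c x y
  proof (rule no_return_below[of x y f a b c])
    show "continuous_on {x..y} f" by (rule continuous_on_subset[OF cont]) (use that in auto)
    show "\<exists>D. (f has_real_derivative D) (at z) \<and> (a \<le> f z \<and> f z \<le> b \<longrightarrow> 0 \<le> D)"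
      if "x < z" "z < y" for z
      using deriv[of z] that \<open>s \<le> x\<close> \<open>y \<le> t\<close> \<beta> by (meson le_less_trans less_le_trans order_trans)
  qed (use that in auto)
  show ?thesis
  proof (cases "b \<le> f s \<or> b \<le> f t")
    case True
    then show ?thesis using stay[of s t b] \<open>s \<le> t\<close> a by auto
  next
    case False
    have "(\<lambda>x. f x - \<beta> * x) s \<le> (\<lambda>x. f x - \<beta> * x) t"
    proof (rule increasing_off_finite[of "{}" s t "\<lambda>x. f x - \<beta> * x"])
      show "continuous_on {s..t} (\<lambda>x. f x - \<beta> * x)" by (intro continuous_intros cont)
      fix x assume x: "s < x" "x < t"
      have "a \<le> f x" using stay[of s x "f s"] x a False by simp
      moreover have "f x \<le> b" using stay[of x t b] x a False by (cases "f x \<le> b") auto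
      ultimately obtain D where "(f has_real_derivative D) (at x)" "\<beta> \<le> D" using deriv[OF x] by auto
      then show "\<exists>D\<ge>0. ((\<lambda>x. f x - \<beta> * x) has_real_derivative D) (at x)"
        by (intro exI[of _ "D - \<beta>"]) (auto intro!: derivative_eq_intros)
    qed (use \<open>s \<le> t\<close> in auto)
    then show ?thesis by (simp add: algebra_simps)
  qed
qed

text \<open>
  For \<open>e = 0\<close> the comparison function is \<open>1 / A\<close> with \<open>A\<close> affine of slope \<open>m\<^sup>2\<close>. The quantity \<open>F A\<^sup>2 - A\<close>
  linearises the equation: its derivative is at most \<open>e A\<^sup>2 - m\<^sup>2 (F A - 1)\<^sup>2\<close>.
\<close>

lemma riccati_decay:
  fixes F :: "real \<Rightarrow> real"
  assumes T: "0 \<le> T" and cont: "continuous_on {s..s + T} F" and F0: "F s \<le> 1 / A0" and A0: "0 < A0" and e: "0 \<le> e"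
    and deriv: "\<And>x. s < x \<Longrightarrow> x < s + T \<Longrightarrow>
      \<exists>D. (F has_real_derivative D) (at x) \<and> D \<le> e - (m * F x)\<^sup>2"
  shows "F (s + T) \<le> 1 / (A0 + m\<^sup>2 * T) + T * e"
proof -
  define A where "A x = A0 + m\<^sup>2 * (x - s)" for x
  define B where "B = A (s + T)"
  have B0: "0 < B" unfolding B_def A_def using A0 T by (simp add: add_pos_nonneg)
  let ?H = "\<lambda>x. e * B\<^sup>2 * x - (F x * (A x)\<^sup>2 - A x)"
  have "?H s \<le> ?H (s + T)"
  proof (rule increasing_off_finite[of "{}" s "s + T" ?H])
    show "continuous_on {s..s + T} ?H" unfolding A_def by (intro continuous_intros cont)
    fix x assume x: "s < x" "x < s + T"
    obtain D where D: "(F has_real_derivative D) (at x)" "D \<le> e - (m * F x)\<^sup>2" using deriv[OF x] by blast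
    have A: "0 \<le> A x" "A x \<le> B"
      using x A0 unfolding B_def A_def by (auto intro!: mult_left_mono add_nonneg_nonneg)
    have "(?H has_real_derivative e * B\<^sup>2 - (D * (A x)\<^sup>2 + F x * (2 * A x * m\<^sup>2) - m\<^sup>2)) (at x)"
      unfolding A_def
      by (rule derivative_eq_intros D(1) refl | simp add: power2_eq_square)+
    moreover have "0 \<le> e * B\<^sup>2 - (D * (A x)\<^sup>2 + F x * (2 * A x * m\<^sup>2) - m\<^sup>2)"
    proof -
      have "D * (A x)\<^sup>2 \<le> (e - (m * F x)\<^sup>2) * (A x)\<^sup>2" by (rule mult_right_mono[OF D(2)]) simp
      moreover have "e * (A x)\<^sup>2 \<le> e * B\<^sup>2" using A e by (intro mult_left_mono power_mono) auto
      moreover have "(m * F x)\<^sup>2 * (A x)\<^sup>2 - F x * (2 * A x * m\<^sup>2) + m\<^sup>2 = (m * (F x * A x - 1))\<^sup>2"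
        by (simp add: power2_eq_square algebra_simps)
      then have "0 \<le> (m * F x)\<^sup>2 * (A x)\<^sup>2 - F x * (2 * A x * m\<^sup>2) + m\<^sup>2" by simp
      ultimately show ?thesis by (simp add: algebra_simps)
    qed
    ultimately show "\<exists>D\<ge>0. (?H has_real_derivative D) (at x)" by blast
  qed (use T in auto)
  moreover have "F s * A0\<^sup>2 \<le> A0" using F0 A0 by (simp add: field_simps power2_eq_square)
  moreover have "A s = A0" by (simp add: A_def)
  ultimately have "F (s + T) * B\<^sup>2 \<le> B + T * e * B\<^sup>2"
    unfolding B_def by (simp add: algebra_simps)
  also have "\<dots> = (1 / B + T * e) * B\<^sup>2" using B0 by (simp add: power2_eq_square field_simps)
  finally have "F (s + T) \<le> 1 / B + T * e" using B0 by simp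
  then show ?thesis by (simp add: B_def A_def)
qed

lemma sum_telescope_int:
  fixes f :: "int \<Rightarrow> real"
  shows "(\<Sum>k<N. f (int k) - f (int k - 1)) = f (int N - 1) - f (- 1)"
  by (induction N) (auto simp: algebra_simps)

lemma dissipation_by_parts:
  fixes G :: "int \<Rightarrow> real"
  assumes "\<And>k. \<bar>G k\<bar> \<le> M"
  shows "(\<Sum>k<N. G (int k) * ((G (int k + 1) - G (int k)) - (G (int k) - G (int k - 1))))
    \<le> 4 * M\<^sup>2 - (\<Sum>k<N. (G (int k) - G (int k - 1))\<^sup>2)"
proof -
  define b where "b k = G k * (G (k + 1) - G k)" for k
  have b: "\<bar>b k\<bar> \<le> 2 * M\<^sup>2" for k
  proof -
    have "\<bar>b k\<bar> \<le> M * (2 * M)"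
      unfolding b_def abs_mult using assms[of k] assms[of "k + 1"] by (intro mult_mono) auto
    then show ?thesis by (simp add: power2_eq_square)
  qed
  have "(\<Sum>k<N. G (int k) * ((G (int k + 1) - G (int k)) - (G (int k) - G (int k - 1))))
      = (\<Sum>k<N. (b (int k) - b (int k - 1)) - (G (int k) - G (int k - 1))\<^sup>2)"
    by (intro sum.cong) (auto simp: b_def power2_eq_square algebra_simps)
  also have "\<dots> = b (int N - 1) - b (- 1) - (\<Sum>k<N. (G (int k) - G (int k - 1))\<^sup>2)"
    by (simp add: sum_subtractf sum_telescope_int flip: sum_telescope_int[of b])
  finally show ?thesis using b[of "int N - 1"] b[of "- 1"] by linarith
qed

lemma work_by_parts:
  fixes G p :: "int \<Rightarrow> real"
  assumes G: "\<And>k. \<bar>G k\<bar> \<le> M" and p: "\<And>k. \<bar>p k\<bar> \<le> 1"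
  shows "(\<Sum>k<N. (p (int k + 1) - p (int k)) * G (int k))
    \<le> 2 * M + sqrt (real N * (\<Sum>k<N. (G (int k) - G (int k - 1))\<^sup>2))"
proof -
  define b where "b k = p (k + 1) * G k" for k
  have b: "\<bar>b k\<bar> \<le> M" for k
    unfolding b_def abs_mult using mult_mono[OF p[of "k + 1"] G[of k]] by simp
  have "(\<Sum>k<N. (p (int k + 1) - p (int k)) * G (int k))
      = (\<Sum>k<N. (b (int k) - b (int k - 1)) - p (int k) * (G (int k) - G (int k - 1)))"
    by (intro sum.cong) (auto simp: b_def algebra_simps)
  also have "\<dots> = b (int N - 1) - b (- 1) - (\<Sum>k<N. p (int k) * (G (int k) - G (int k - 1)))"
    by (simp add: sum_subtractf flip: sum_telescope_int[of b])
  also have "\<dots> \<le> 2 * M + (\<Sum>k<N. \<bar>G (int k) - G (int k - 1)\<bar>)"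
  proof -
    have "- (\<Sum>k<N. p (int k) * (G (int k) - G (int k - 1)))
        \<le> (\<Sum>k<N. \<bar>G (int k) - G (int k - 1)\<bar>)"
      unfolding sum_negf[symmetric]
    proof (rule sum_mono)
      fix k
      have "\<bar>p (int k) * (G (int k) - G (int k - 1))\<bar> \<le> 1 * \<bar>G (int k) - G (int k - 1)\<bar>"
        unfolding abs_mult by (intro mult_right_mono p) auto
      then show "- (p (int k) * (G (int k) - G (int k - 1))) \<le> \<bar>G (int k) - G (int k - 1)\<bar>"
        using order_trans[OF abs_ge_minus_self] by simp
    qed
    then show ?thesis using b[of "int N - 1"] b[of "- 1"] by linarith
  qed
  also have "(\<Sum>k<N. \<bar>G (int k) - G (int k - 1)\<bar>)
      \<le> sqrt (real N * (\<Sum>k<N. (G (int k) - G (int k - 1))\<^sup>2))"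
    using sum_abs_sq_le_card[of "\<lambda>k. G (int k) - G (int k - 1)" "{..<N}"]
    by (intro real_le_rsqrt) simp
  finally show ?thesis by simp
qed

section \<open>The two phases of the pulse\<close>

text \<open>
  The numbers \<open>dm\<close> and \<open>dp\<close> stand for the minimum \<open>\<delta>\<^sup>-\<close> and the maximum \<open>\<delta>\<^sup>+\<close> of \<open>W''\<close> on \<open>[\<rho> - 1, \<rho> + 1]\<close>.
\<close>

locale pulsed_chain = periodic_chain +
  fixes W :: "real \<Rightarrow> real" and \<tau> dm dp \<rho> :: real
  assumes P_eq: "P = 2 * \<tau>"
    and K_off: "2 * real i * \<tau> < t \<Longrightarrow> t < (2 * real i + 1) * \<tau> \<Longrightarrow> K t = 0"
    and K_on: "(2 * real i + 1) * \<tau> < t \<Longrightarrow> t < (2 * real i + 2) * \<tau> \<Longrightarrow> K t = \<kappa>"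
    and W_deriv: "(W has_real_derivative g x) (at x)"
    and dm_pos: "0 < dm"
    and g_growth: "\<rho> - 1 \<le> x \<Longrightarrow> x \<le> y \<Longrightarrow> y \<le> \<rho> + 1 \<Longrightarrow>
      dm * (y - x) \<le> g y - g x \<and> g y - g x \<le> dp * (y - x)"
begin

lemma tau_pos: "0 < \<tau>"
  using P_pos P_eq by simp

lemma dm_le_dp: "dm \<le> dp"
  using g_growth[of \<rho> "\<rho> + 1"] by simp

lemma dp_pos: "0 < dp"
  using dm_pos dm_le_dp by simp

lemma isCont_const_on:
  assumes "\<And>t. l < t \<Longrightarrow> t < r \<Longrightarrow> K t = c" "l < t" "t < r"
  shows "isCont K t"
proof -
  have "eventually (\<lambda>s. s \<in> {l<..<r}) (nhds t)"
    by (rule eventually_nhds_in_open) (use assms in auto)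
  then have "eventually (\<lambda>s. K s = c) (nhds t)" by eventually_elim (use assms in auto)
  then show ?thesis using isCont_cong[of K "\<lambda>_. c" t] by simp
qed

lemma isCont_K_off: "2 * real i * \<tau> < t \<Longrightarrow> t < (2 * real i + 1) * \<tau> \<Longrightarrow> isCont K t"
  by (rule isCont_const_on[OF K_off])

lemma isCont_K_on: "(2 * real i + 1) * \<tau> < t \<Longrightarrow> t < (2 * real i + 2) * \<tau> \<Longrightarrow> isCont K t"
  by (rule isCont_const_on[OF K_on])

text \<open>
  Subtracting the tangent at \<open>\<rho>\<close> changes the total energy of a window only by a constant and end terms, as
  the spacings average to \<open>\<rho>\<close>, and makes each term comparable with the squared deviation \<open>(x - \<rho>)\<^sup>2\<close>.
\<close>

definition energy :: "real \<Rightarrow> real" where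
  "energy x = W x - W \<rho> - g \<rho> * (x - \<rho>)"

lemma energy_deriv: "(energy has_real_derivative g x - g \<rho>) (at x)"
  unfolding energy_def by (auto intro!: derivative_eq_intros W_deriv)

lemma energy_bounds:
  assumes "\<bar>x - \<rho>\<bar> \<le> 1"
  shows "dm / 2 * (x - \<rho>)\<^sup>2 \<le> energy x" "energy x \<le> dp / 2 * (x - \<rho>)\<^sup>2"
proof -
  have q: "((\<lambda>x. c / 2 * (x - \<rho>)\<^sup>2) has_real_derivative c * (x - \<rho>)) (at x)" for c x
    by (auto intro!: derivative_eq_intros simp: field_simps)
  have e0: "energy \<rho> = 0" by (simp add: energy_def)
  show "dm / 2 * (x - \<rho>)\<^sup>2 \<le> energy x"
  proof (cases "\<rho> \<le> x")
    case True
    have "(\<lambda>x. dm / 2 * (x - \<rho>)\<^sup>2) x - (\<lambda>x. dm / 2 * (x - \<rho>)\<^sup>2) \<rho> \<le> energy x - energy \<rho>"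
      by (rule deriv_le_imp_diff_le[OF True q energy_deriv]) (use g_growth assms in auto)
    then show ?thesis using e0 by simp
  next
    case False
    then have le: "x \<le> \<rho>" by simp
    have "energy \<rho> - energy x \<le> (\<lambda>x. dm / 2 * (x - \<rho>)\<^sup>2) \<rho> - (\<lambda>x. dm / 2 * (x - \<rho>)\<^sup>2) x"
    proof (rule deriv_le_imp_diff_le[OF le energy_deriv q])
      show "g y - g \<rho> \<le> dm * (y - \<rho>)" if "x \<le> y" "y \<le> \<rho>" for y
        using g_growth[of y \<rho>] assms that by (simp add: algebra_simps)
    qed
    then show ?thesis using e0 by simp
  qed
  show "energy x \<le> dp / 2 * (x - \<rho>)\<^sup>2"
  proof (cases "\<rho> \<le> x")
    case True
    have "energy x - energy \<rho> \<le> (\<lambda>x. dp / 2 * (x - \<rho>)\<^sup>2) x - (\<lambda>x. dp / 2 * (x - \<rho>)\<^sup>2) \<rho>"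
      by (rule deriv_le_imp_diff_le[OF True energy_deriv q]) (use g_growth assms in auto)
    then show ?thesis using e0 by simp
  next
    case False
    then have le: "x \<le> \<rho>" by simp
    have "(\<lambda>x. dp / 2 * (x - \<rho>)\<^sup>2) \<rho> - (\<lambda>x. dp / 2 * (x - \<rho>)\<^sup>2) x \<le> energy \<rho> - energy x"
    proof (rule deriv_le_imp_diff_le[OF le q energy_deriv])
      show "dp * (y - \<rho>) \<le> g y - g \<rho>" if "x \<le> y" "y \<le> \<rho>" for y
        using g_growth[of y \<rho>] assms that by (simp add: algebra_simps)
    qed
    then show ?thesis using e0 by simp
  qed
qed

lemma stress_le: "\<bar>x - \<rho>\<bar> \<le> 1 \<Longrightarrow> \<bar>g x - g \<rho>\<bar> \<le> dp"
proof -
  assume x: "\<bar>x - \<rho>\<bar> \<le> 1"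
  have mono: "dp * z \<le> dp" if "z \<le> 1" for z using that dp_pos by simp
  show ?thesis
    using g_growth[of \<rho> x] g_growth[of x \<rho>] g_mono[of \<rho> x] g_mono[of x \<rho>] x
      mono[of "x - \<rho>"] mono[of "\<rho> - x"] by (cases "\<rho> \<le> x") auto
qed

lemma stress_work: "\<bar>x - \<rho>\<bar> \<le> 1 \<Longrightarrow> dm * (x - \<rho>)\<^sup>2 \<le> (x - \<rho>) * (g x - g \<rho>)"
proof (cases "\<rho> \<le> x")
  case True
  assume "\<bar>x - \<rho>\<bar> \<le> 1"
  then have "(x - \<rho>) * (dm * (x - \<rho>)) \<le> (x - \<rho>) * (g x - g \<rho>)"
    using g_growth[of \<rho> x] True by (intro mult_left_mono) auto
  then show ?thesis by (simp add: power2_eq_square mult_ac)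
next
  case False
  assume "\<bar>x - \<rho>\<bar> \<le> 1"
  then have "(\<rho> - x) * (dm * (\<rho> - x)) \<le> (\<rho> - x) * (g \<rho> - g x)"
    using g_growth[of x \<rho>] False by (intro mult_left_mono) auto
  then show ?thesis by (simp add: power2_eq_square algebra_simps)
qed

text \<open>
  The bound for the variance of the spacings in an infinitely long window, and the coefficient of the \<open>1 / N\<close>
  correction for a window of length \<open>N\<close>.
\<close>

definition variance_limit :: real where
  "variance_limit = dp\<^sup>2 / (2 * dm ^ 3 * \<tau> + dp * dm)"

definition variance_error :: real where
  "variance_error = 2 / dm * (\<tau> * (4 * dp * dm + 4 * dp\<^sup>2))"

context
  fixes u c
  assumes u: "linear_from \<rho> 0 c u"
begin

lemma spacing_near: "0 \<le> t \<Longrightarrow> \<bar>u t (k + 1) - u t k - \<rho>\<bar> \<le> 1"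
  using linear_width[OF u, of t "k + 1" k] by simp

lemma u_continuous: "0 \<le> s \<Longrightarrow> continuous_on {s..t} (\<lambda>t. u t k)"
  by (rule solution_continuous[OF linear_fromD(1)[OF u]])

definition stress :: "real \<Rightarrow> int \<Rightarrow> real" where
  "stress t k = g (u t (k + 1) - u t k) - g \<rho>"

lemma stress_bound: "0 \<le> t \<Longrightarrow> \<bar>stress t k\<bar> \<le> dp"
  unfolding stress_def by (intro stress_le spacing_near)

lemma off_deriv:
  assumes "2 * real i * \<tau> < t" "t < (2 * real i + 1) * \<tau>"
  shows "((\<lambda>t. u t k) has_real_derivative stress t k - stress t (k - 1)) (at t)"
proof -
  have "0 \<le> 2 * real i * \<tau>" using tau_pos by simp
  then have "0 < t" using assms by linarith
  then have "((\<lambda>t. u t k) has_real_derivative force t (u t) k) (at t)"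
    by (intro solution_deriv[OF linear_fromD(1)[OF u]] isCont_K_off[OF assms])
  moreover have "force t (u t) k = stress t k - stress t (k - 1)"
    unfolding force_def stress_def by (simp add: K_off[OF assms])
  ultimately show ?thesis by simp
qed

text \<open>
  Only the two stresses at the ends of the window contribute to the total force.
\<close>

lemma off_phase_displacement:
  "- (2 * dp * \<tau>) \<le> (\<Sum>k<N. u ((2 * real i + 1) * \<tau>) (int k) - u (2 * real i * \<tau>) (int k))"
proof -
  define s where "s = 2 * real i * \<tau>"
  have s0: "0 \<le> s" using tau_pos by (simp add: s_def)
  have s': "(2 * real i + 1) * \<tau> = s + \<tau>" by (simp add: s_def algebra_simps)
  let ?f = "\<lambda>t. (\<Sum>k<N. u t (int k)) + 2 * dp * t"
  have "?f s \<le> ?f (s + \<tau>)"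
  proof (rule increasing_off_finite[of "{}" s "s + \<tau>" ?f])
    show "continuous_on {s..s + \<tau>} ?f" by (intro continuous_intros u_continuous s0)
    fix t assume t: "s < t" "t < s + \<tau>"
    have "((\<lambda>t. \<Sum>k<N. u t (int k)) has_real_derivative
        (\<Sum>k<N. stress t (int k) - stress t (int k - 1))) (at t)"
      using t by (intro DERIV_sum off_deriv[of i]) (auto simp: s' s_def[symmetric])
    from DERIV_add[OF this DERIV_cmult_Id[of "2 * dp"]]
    have "(?f has_real_derivative (\<Sum>k<N. stress t (int k) - stress t (int k - 1)) + 2 * dp) (at t)"
      by simp
    moreover have "0 \<le> (\<Sum>k<N. stress t (int k) - stress t (int k - 1)) + 2 * dp"
      unfolding sum_telescope_int
      using stress_bound[of t "int N - 1"] stress_bound[of t "- 1"] t s0 by linarith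
    ultimately show "\<exists>D\<ge>0. (?f has_real_derivative D) (at t)" by blast
  qed (use tau_pos in auto)
  then show ?thesis unfolding s' s_def[symmetric] by (simp add: sum_subtractf algebra_simps)
qed

text \<open>
  Let \<open>Q\<close> be the sum of squared deviations of the spacings, \<open>R\<close> the sum of squared forces and \<open>F\<close> the mean energy. The
  energy is dissipated at rate \<open>R / N\<close> up to the ends (\<open>dissipation_by_parts\<close>). Summation by parts against
  the displacements \<open>p\<close>, which are at most 1 by \<open>linear_width\<close>, gives
  \<open>dm Q \<le> sqrt (N R)\<close> up to the ends (\<open>work_by_parts\<close>), and \<open>N F \<le> dp Q / 2\<close>. So \<open>F' \<le> - m\<^sup>2 F\<^sup>2\<close>
  with \<open>m = 2 dm / dp\<close>, up to an error \<open>e\<close> of order \<open>1 / N\<close>. The initial value \<open>F \<le> dp / 2\<close> holds since spacings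
  deviate by at most 1 from \<open>\<rho>\<close>.
\<close>

lemma off_phase_variance:
  assumes N: "N \<ge> 1"
  shows "(\<Sum>k<N. (u ((2 * real i + 1) * \<tau>) (int k + 1) - u ((2 * real i + 1) * \<tau>) (int k) - \<rho>)\<^sup>2)
    \<le> real N * (variance_limit + variance_error / real N)"
proof -
  define s where "s = 2 * real i * \<tau>"
  have s0: "0 \<le> s" using tau_pos by (simp add: s_def)
  have s': "(2 * real i + 1) * \<tau> = s + \<tau>" by (simp add: s_def algebra_simps)
  have N0: "0 < real N" using N by simp
  define X where "X t k = u t (k + 1) - u t k" for t k
  define Q where "Q t = (\<Sum>k<N. (X t (int k) - \<rho>)\<^sup>2)" for t
  define F where "F t = (\<Sum>k<N. energy (X t (int k))) / real N" for t
  define R where "R t = (\<Sum>k<N. (stress t (int k) - stress t (int k - 1))\<^sup>2)" for t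
  define m where "m = 2 * dm / dp"
  define e where "e = (4 * dp * dm + 4 * dp\<^sup>2) / real N"
  have X1: "\<bar>X t k - \<rho>\<bar> \<le> 1" if "0 \<le> t" for t k unfolding X_def by (rule spacing_near[OF that])
  have F_le: "real N * F t \<le> dp / 2 * Q t" and F_ge: "dm / 2 * Q t \<le> real N * F t" if "0 \<le> t" for t
    unfolding F_def Q_def sum_distrib_left using N0 energy_bounds[OF X1[OF that]]
    by (auto intro!: sum_mono)
  have Q0: "0 \<le> Q t" for t unfolding Q_def by (intro sum_nonneg) auto
  have Q_le: "Q t \<le> real N" if "0 \<le> t" for t
    unfolding Q_def using sum_bounded_above[of "{..<N}" "\<lambda>k. (X t (int k) - \<rho>)\<^sup>2" 1] X1[OF that]
    by (simp add: abs_square_le_1)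
  have F0: "0 \<le> F t" if "0 \<le> t" for t
  proof -
    have "0 \<le> real N * F t" using F_ge[OF that] Q0[of t] dm_pos by (smt (verit) divide_nonneg_pos mult_nonneg_nonneg)
    then show ?thesis using N0 by (simp add: zero_le_mult_iff)
  qed
  have F_half: "F t \<le> dp / 2" if "0 \<le> t" for t
  proof -
    have "dp / 2 * Q t \<le> dp / 2 * real N" using Q_le[OF that] dp_pos by (intro mult_left_mono) auto
    then have "real N * F t \<le> real N * (dp / 2)" using F_le[OF that] by (simp add: mult.commute)
    then show ?thesis using N0 by simp
  qed
  have dissipation: "(m * F t)\<^sup>2 - 4 * dp * dm / real N \<le> R t / real N" if t: "0 \<le> t" for t
  proof -
    define p where "p k = u t k - u t 0 - of_int k * \<rho>" for k
    have "dm * Q t \<le> (\<Sum>k<N. (p (int k + 1) - p (int k)) * stress t (int k))"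
      unfolding Q_def sum_distrib_left
    proof (rule sum_mono)
      fix k
      have "p (int k + 1) - p (int k) = X t (int k) - \<rho>" by (simp add: p_def X_def algebra_simps)
      then show "dm * (X t (int k) - \<rho>)\<^sup>2 \<le> (p (int k + 1) - p (int k)) * stress t (int k)"
        using stress_work[OF X1[OF t, of "int k"]] by (simp add: stress_def X_def)
    qed
    also have "\<dots> \<le> 2 * dp + sqrt (real N * R t)"
      unfolding R_def
    proof (rule work_by_parts[OF stress_bound[OF t]])
      show "\<bar>p k\<bar> \<le> 1" for k
        using linear_width[OF u t, of k 0] by (simp add: p_def)
    qed
    finally have 1: "dm * Q t \<le> 2 * dp + sqrt (real N * R t)" .
    have "m * (real N * F t) \<le> m * (dp / 2 * Q t)"
      using F_le[OF t] dm_pos dp_pos by (intro mult_left_mono) (auto simp: m_def)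
    also have "\<dots> = dm * Q t" using dp_pos by (simp add: m_def)
    finally have 2: "m * (real N * F t) \<le> 2 * dp + sqrt (real N * R t)" using 1 by linarith
    define y where "y = m * F t"
    have y: "0 \<le> y" "y \<le> dm"
    proof -
      show "0 \<le> y" unfolding y_def m_def using F0[OF t] dm_pos dp_pos by simp
      have "m * F t \<le> m * (dp / 2)" using F_half[OF t] dm_pos dp_pos
        by (intro mult_left_mono) (auto simp: m_def)
      then show "y \<le> dm" unfolding y_def m_def using dp_pos by simp
    qed
    have R0: "0 \<le> R t" unfolding R_def by (intro sum_nonneg) auto
    have le: "real N * y - 2 * dp \<le> sqrt (real N * R t)" using 2 by (simp add: y_def mult_ac)
    have "(real N)\<^sup>2 * y\<^sup>2 - 4 * dp * real N * y \<le> real N * R t"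
    proof (cases "2 * dp \<le> real N * y")
      case True
      then have "(real N * y - 2 * dp)\<^sup>2 \<le> (sqrt (real N * R t))\<^sup>2" using le by (intro power_mono) auto
      then have "(real N * y - 2 * dp)\<^sup>2 \<le> real N * R t" using R0 by simp
      moreover have "(real N)\<^sup>2 * y\<^sup>2 - 4 * dp * real N * y \<le> (real N * y - 2 * dp)\<^sup>2"
        by (simp add: power2_eq_square algebra_simps)
      ultimately show ?thesis by linarith
    next
      case False
      then have "(real N * y) * (real N * y - 4 * dp) \<le> 0"
        using y dp_pos by (intro mult_nonneg_nonpos) auto
      then have "(real N)\<^sup>2 * y\<^sup>2 - 4 * dp * real N * y \<le> 0"
        by (simp add: power2_eq_square algebra_simps)
      also have "0 \<le> real N * R t" using R0 by simp
      finally show ?thesis .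
    qed
    moreover have "4 * dp * real N * y \<le> 4 * dp * real N * dm"
      using y dp_pos by (intro mult_left_mono) auto
    ultimately have "(real N)\<^sup>2 * y\<^sup>2 - 4 * dp * real N * dm \<le> real N * R t" by linarith
    then have "((real N)\<^sup>2 * y\<^sup>2 - 4 * dp * real N * dm) / (real N)\<^sup>2 \<le> real N * R t / (real N)\<^sup>2"
      by (rule divide_right_mono) simp
    then show ?thesis
      using N0 by (simp add: y_def[symmetric] diff_divide_distrib power2_eq_square mult_ac)
  qed
  have "F (s + \<tau>) \<le> 1 / (2 / dp + m\<^sup>2 * \<tau>) + \<tau> * e"
  proof (rule riccati_decay)
    show "continuous_on {s..s + \<tau>} F"
    proof -
      have "continuous_on UNIV energy"
        using energy_deriv by (meson DERIV_isCont continuous_at_imp_continuous_on)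
      then have "continuous_on {s..s + \<tau>} (\<lambda>t. energy (X t k))" for k
        unfolding X_def by (rule continuous_on_compose2) (auto intro!: continuous_intros u_continuous s0)
      then show ?thesis unfolding F_def by (intro continuous_intros) (use N0 in auto)
    qed
    show "F s \<le> 1 / (2 / dp)" using F_half[OF s0] by simp
    show "0 \<le> e" unfolding e_def using dp_pos dm_pos by simp
    fix t assume t: "s < t" "t < s + \<tau>"
    then have t0: "0 \<le> t" using s0 by simp
    let ?D = "(\<Sum>k<N. stress t (int k) * ((stress t (int k + 1) - stress t (int k))
      - (stress t (int k) - stress t (int k - 1)))) / real N"
    have "((\<lambda>t. energy (X t k)) has_real_derivative stress t k * ((stress t (k + 1) - stress t k)
      - (stress t k - stress t (k - 1)))) (at t)" for k
    proof -
      have off: "((\<lambda>t. u t k) has_real_derivative stress t k - stress t (k - 1)) (at t)" for k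
        using t by (intro off_deriv[of i]) (auto simp: s' s_def[symmetric])
      have "((\<lambda>t. X t k) has_real_derivative (stress t (k + 1) - stress t k)
          - (stress t k - stress t (k - 1))) (at t)"
        unfolding X_def using DERIV_diff[OF off[of "k + 1"] off[of k]] by simp
      from DERIV_chain2[OF energy_deriv this] show ?thesis
        by (simp add: stress_def X_def)
    qed
    then have "(F has_real_derivative ?D) (at t)"
      unfolding F_def by (intro DERIV_cdivide DERIV_sum)
    moreover have "?D \<le> e - (m * F t)\<^sup>2"
    proof -
      have "?D \<le> (4 * dp\<^sup>2 - R t) / real N"
        unfolding R_def by (intro divide_right_mono dissipation_by_parts stress_bound[OF t0]) simp
      also have "\<dots> = 4 * dp\<^sup>2 / real N - R t / real N" by (rule diff_divide_distrib)
      also have "\<dots> \<le> 4 * dp\<^sup>2 / real N - ((m * F t)\<^sup>2 - 4 * dp * dm / real N)"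
        using dissipation[OF t0] by linarith
      also have "\<dots> = e - (m * F t)\<^sup>2" by (simp add: e_def add_divide_distrib)
      finally show ?thesis .
    qed
    ultimately show "\<exists>D. (F has_real_derivative D) (at t) \<and> D \<le> e - (m * F t)\<^sup>2" by blast
  qed (use tau_pos dp_pos in auto)
  then have "real N * F (s + \<tau>) \<le> real N * (1 / (2 / dp + m\<^sup>2 * \<tau>) + \<tau> * e)"
    by (intro mult_left_mono) auto
  then have "dm / 2 * Q (s + \<tau>) \<le> real N * (1 / (2 / dp + m\<^sup>2 * \<tau>) + \<tau> * e)"
    using F_ge[of "s + \<tau>"] s0 tau_pos by linarith
  then have "2 / dm * (dm / 2 * Q (s + \<tau>)) \<le> 2 / dm * (real N * (1 / (2 / dp + m\<^sup>2 * \<tau>) + \<tau> * e))"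
    using dm_pos by (intro mult_left_mono) auto
  then have "Q (s + \<tau>) \<le> real N * (2 / dm * (1 / (2 / dp + m\<^sup>2 * \<tau>)) + 2 / dm * (\<tau> * e))"
    using dm_pos by (simp add: algebra_simps)
  also have "2 / dm * (1 / (2 / dp + m\<^sup>2 * \<tau>)) = variance_limit"
  proof -
    define Z where "Z = 2 * dm ^ 3 * \<tau> + dp * dm"
    have eq: "dm * (2 / dp + m\<^sup>2 * \<tau>) = 2 * Z / dp\<^sup>2"
      using dp_pos by (simp add: m_def Z_def field_simps power2_eq_square power3_eq_cube)
    have "2 / dm * (1 / (2 / dp + m\<^sup>2 * \<tau>)) = 2 / (dm * (2 / dp + m\<^sup>2 * \<tau>))" by simp
    also have "\<dots> = variance_limit" unfolding eq variance_limit_def Z_def[symmetric] by simp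
    finally show ?thesis .
  qed
  also have "2 / dm * (\<tau> * e) = variance_error / real N"
    by (simp add: variance_error_def e_def)
  finally show ?thesis unfolding s' Q_def X_def .
qed

text \<open>
  Consecutive spacings lie between the floor and the ceiling of \<open>\<rho>\<close>, so they differ by at most 1 and the
  elastic force is at least \<open>- dp\<close>; inside \<open>[a, b]\<close> modulo 1 the pulse overcomes it with margin \<open>\<beta>\<close>. A
  particle starting between \<open>b\<close> and the next \<open>a\<close> may drift back, but not beyond \<open>b\<close>. The case \<open>y = 1\<close>, a particle
  exactly at \<open>a\<close>, counts as belonging to the previous cell, where only this weaker bound is claimed.
\<close>

lemma on_phase_displacement:
  fixes y n
  assumes \<beta>: "0 < \<beta>" and ab: "a < b"
    and push: "\<And>x. a \<le> x \<Longrightarrow> x \<le> b \<Longrightarrow> dp + \<beta> \<le> \<kappa> * h x"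
    and y: "0 < y" "y = u ((2 * real i + 1) * \<tau>) k - a - of_int n"
  shows "(b - a) - max y (b - a - \<beta> * \<tau>)
    \<le> u ((2 * real i + 2) * \<tau>) k - u ((2 * real i + 1) * \<tau>) k"
proof -
  define s where "s = (2 * real i + 1) * \<tau>"
  have s0: "0 \<le> s" using tau_pos by (simp add: s_def)
  have s': "(2 * real i + 2) * \<tau> = s + \<tau>" by (simp add: s_def algebra_simps)
  have "min (b + of_int n) (u s k + \<beta> * (s + \<tau> - s)) \<le> u (s + \<tau>) k"
  proof (rule pushed_up[where a = "a + of_int n"])
    show "continuous_on {s..s + \<tau>} (\<lambda>t. u t k)" by (rule u_continuous[OF s0])
    fix t assume t: "s < t" "t < s + \<tau>"
    then have on: "(2 * real i + 1) * \<tau> < t" "t < (2 * real i + 2) * \<tau>"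
      unfolding s' by (auto simp: s_def)
    have t0: "0 < t" using t s0 by simp
    have "((\<lambda>t. u t k) has_real_derivative force t (u t) k) (at t)"
      by (intro solution_deriv[OF linear_fromD(1)[OF u]] t0 isCont_K_on[OF on])
    moreover have "\<beta> \<le> force t (u t) k" if "a + of_int n \<le> u t k" "u t k \<le> b + of_int n"
    proof -
      let ?x = "u t k - u t (k - 1)" and ?y = "u t (k + 1) - u t k"
      have lo: "of_int \<lfloor>\<rho>\<rfloor> \<le> u t (j + 1) - u t j" and hi: "u t (j + 1) - u t j \<le> of_int \<lceil>\<rho>\<rceil>" for j
        using linear_spread[OF u, where t = t and j = 1 and k = j] t0 by auto
      have bounds: "of_int \<lfloor>\<rho>\<rfloor> \<le> ?x" "?x \<le> of_int \<lceil>\<rho>\<rceil>" "of_int \<lfloor>\<rho>\<rfloor> \<le> ?y" "?y \<le> of_int \<lceil>\<rho>\<rceil>"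
        using lo[of k] hi[of k] lo[of "k - 1"] hi[of "k - 1"] by auto
      have "real_of_int \<lceil>\<rho>\<rceil> \<le> of_int \<lfloor>\<rho>\<rfloor> + 1"
        by (simp add: ceiling_altdef)
      then have xy: "?x - ?y \<le> 1" using bounds by linarith
      have r: "\<rho> - 1 \<le> ?x" "?x \<le> \<rho> + 1" "\<rho> - 1 \<le> ?y" "?y \<le> \<rho> + 1"
        using bounds floor_correct[of \<rho>] ceiling_correct[of \<rho>] by linarith+
      have "g ?x - g ?y \<le> dp"
      proof (cases "?y \<le> ?x")
        case True
        have "g ?x - g ?y \<le> dp * (?x - ?y)" using g_growth[of ?y ?x] True r by auto
        also have "\<dots> \<le> dp * 1" using xy dp_pos by (intro mult_left_mono) auto
        finally show ?thesis by simp
      next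
        case False
        then show ?thesis using g_mono[of ?x ?y] dp_pos by simp
      qed
      moreover have "dp + \<beta> \<le> \<kappa> * h (u t k)"
        using push[of "u t k - of_int n"] that h_periodic_int[of "u t k - of_int n" n] by simp
      ultimately show ?thesis unfolding force_def K_on[OF on] by linarith
    qed
    ultimately show "\<exists>D. ((\<lambda>t. u t k) has_real_derivative D) (at t) \<and>
        (a + of_int n \<le> u t k \<and> u t k \<le> b + of_int n \<longrightarrow> \<beta> \<le> D)" by blast
  qed (use \<beta> ab y tau_pos in \<open>auto simp: s_def\<close>)
  then show ?thesis unfolding s' s_def[symmetric] using y unfolding s_def[symmetric]
    by (auto simp: min_def max_def algebra_simps split: if_splits)
qed

end

end

section \<open>The lower bound for the rotation number\<close>

context pulsed_chain
begin

text \<open>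
  The expression under the infimum in \<open>d_FK\<close>, with the standard deviation of the spacings written as \<open>sqrt S\<close>.
\<close>

definition matching_cost :: "real \<Rightarrow> int \<Rightarrow> nat \<Rightarrow> real" where
  "matching_cost S p q = 1 / (4 * real q) + real q / 4 * \<bar>of_int p / real q - \<rho>\<bar>
     + real q / sqrt 12 * sqrt S"

lemma period_gain:
  fixes D :: real
  assumes u: "linear_from \<rho> 0 c u" and \<beta>: "0 < \<beta>" and ab: "a < b" "b - a \<le> 1"
    and push: "\<And>x. a \<le> x \<Longrightarrow> x \<le> b \<Longrightarrow> dp + \<beta> \<le> \<kappa> * h x"
    and D: "0 < D" "D \<le> 1"
    and count: "\<And>y n s. \<lbrakk>\<And>k. 0 < y k; \<And>k. y k \<le> 1;
        \<And>k. y k = u ((2 * real i + 1) * \<tau>) (int k) - a - of_int (n k); 0 \<le> s; s \<le> 1\<rbrakk> \<Longrightarrow>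
        real N * (s - D) \<le> real (card {k\<in>{..<N}. y k \<le> s})"
  shows "real N * (b - a - 1 + (1 - D)\<^sup>2 / 2 - (max (b - a - \<beta> * \<tau> - D) 0)\<^sup>2 / 2) - 2 * dp * \<tau>
    \<le> (\<Sum>k<N. u ((2 * real i + 2) * \<tau>) (int k) - u (2 * real i * \<tau>) (int k))"
proof -
  let ?X = "\<lambda>k. u ((2 * real i + 1) * \<tau>) (int k)" and ?Y = "\<lambda>k. u ((2 * real i + 2) * \<tau>) (int k)"
  \<comment> \<open>Cells are half-open, \<open>(a + n, a + n + 1]\<close>, hence the ceiling.\<close>
  define n where "n k = \<lceil>?X k - a\<rceil> - 1" for k
  define y where "y k = ?X k - a - of_int (n k)" for k
  have y: "0 < y k" "y k \<le> 1" for k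
    using ceiling_correct[of "?X k - a"] unfolding y_def n_def by (simp_all, linarith+)
  define s0 where "s0 = max 0 (b - a - \<beta> * \<tau>)"
  have "0 < \<beta> * \<tau>" using \<beta> tau_pos by simp
  then have s0: "0 \<le> s0" "s0 \<le> 1" using ab unfolding s0_def by linarith+
  have "(\<Sum>k<N. max (y k) s0) \<le> real N * (1 - (1 - D)\<^sup>2 / 2 + (max (s0 - D) 0)\<^sup>2 / 2)"
    by (rule sum_max_le[OF y(2) s0]) (use D count[of y n, OF y] in \<open>auto simp: y_def\<close>)
  moreover have "max (s0 - D) 0 = max (b - a - \<beta> * \<tau> - D) 0"
    using D by (auto simp: s0_def max_def)
  ultimately have 1: "(\<Sum>k<N. max (y k) s0)
      \<le> real N * (1 - (1 - D)\<^sup>2 / 2 + (max (b - a - \<beta> * \<tau> - D) 0)\<^sup>2 / 2)" by simp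
  have "(\<Sum>k<N. (b - a) - max (y k) s0) \<le> (\<Sum>k<N. ?Y k - ?X k)"
  proof (rule sum_mono)
    fix k
    have "max (y k) s0 = max (y k) (b - a - \<beta> * \<tau>)" using y(1)[of k] by (auto simp: s0_def max_def)
    then show "(b - a) - max (y k) s0 \<le> ?Y k - ?X k"
      using on_phase_displacement[OF u \<beta> ab(1) push y(1)[of k] y_def[of k]] by simp
  qed
  then have 2: "real N * (b - a) - (\<Sum>k<N. max (y k) s0) \<le> (\<Sum>k<N. ?Y k - ?X k)"
    by (simp add: sum_subtractf)
  have 3: "- (2 * dp * \<tau>) \<le> (\<Sum>k<N. ?X k - u (2 * real i * \<tau>) (int k))"
    by (rule off_phase_displacement[OF u])
  have "(\<Sum>k<N. ?Y k - u (2 * real i * \<tau>) (int k))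
      = (\<Sum>k<N. ?Y k - ?X k) + (\<Sum>k<N. ?X k - u (2 * real i * \<tau>) (int k))"
    by (simp flip: sum.distrib)
  then show ?thesis using 1 2 3 by (simp add: algebra_simps)
qed

text \<open>
  The corrections of order \<open>1 / N\<close> vanish as the window grows, uniformly in the period number \<open>i\<close> and in the arc, so
  one window length serves for all of them.
\<close>

lemma eventually_equidistributed:
  assumes u: "linear_from \<rho> 0 c u" and D: "0 < D" and pq: "coprime p (int q)" "q \<ge> 1"
    and dev: "matching_cost variance_limit p q < D\<^sup>2 / 4"
  shows "\<exists>N0. \<forall>N\<ge>N0. \<forall>i y a n s. (\<forall>k. 0 < y k) \<longrightarrow> (\<forall>k. y k \<le> 1) \<longrightarrow>
    (\<forall>k. y k = u ((2 * real i + 1) * \<tau>) (int k) - a - of_int (n k)) \<longrightarrow> 0 \<le> s \<longrightarrow> s \<le> 1 \<longrightarrow>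
    real N * (s - D) \<le> real (card {k\<in>{..<N}. y k \<le> s})"
proof -
  define dN where "dN N = matching_cost (variance_limit + variance_error / real N + real q / real N) p q
      + real q / (2 * real N)" for N
  have "dN \<longlonglongrightarrow> matching_cost (variance_limit + 0 + 0) p q + 0"
    unfolding dN_def matching_cost_def
    by (intro tendsto_intros lim_const_over_n)
       (auto intro!: tendsto_divide_0[OF tendsto_const] filterlim_at_top_imp_at_infinity
          filterlim_tendsto_pos_mult_at_top[OF tendsto_const] filterlim_real_sequentially)
  then have "eventually (\<lambda>N. dN N < D\<^sup>2 / 4) sequentially"
    using dev by (intro order_tendstoD(2)) auto
  then obtain N0 where N0: "\<And>N. N \<ge> N0 \<Longrightarrow> dN N < D\<^sup>2 / 4"
    by (auto simp: eventually_sequentially)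
  have "real N * (s - D) \<le> real (card {k\<in>{..<N}. y k \<le> s})"
    if N: "N \<ge> max N0 1" and y: "\<And>k. 0 < y k" "\<And>k. y k \<le> 1"
      "\<And>k. y k = u ((2 * real i + 1) * \<tau>) (int k) - a - of_int (n k)" and s: "0 \<le> s" "s \<le> 1"
    for N i y a n s
  proof (rule card_below_ge[OF _ y D s])
    fix \<phi> \<Phi> :: "real \<Rightarrow> real" and I
    assume \<phi>: "\<And>x y. \<bar>\<phi> x - \<phi> y\<bar> \<le> \<bar>x - y\<bar>" "\<And>x. \<phi> (x + 1) = \<phi> x"
      "\<And>x. 0 \<le> \<phi> x" "\<And>x. \<phi> x \<le> 1 / 2" "\<And>x. (\<Phi> has_real_derivative \<phi> x) (at x)"
      "\<And>x. \<Phi> (x + 1) - \<Phi> x = I"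
    let ?X = "\<lambda>k. u ((2 * real i + 1) * \<tau>) (int k)"
    have t: "0 \<le> (2 * real i + 1) * \<tau>" using tau_pos by simp
    have "(\<Sum>k<N. \<phi> (?X k)) \<le> real N * (I + (1 / (4 * real q) + real q / 4 * \<bar>of_int p / real q - \<rho>\<bar>
      + real q / sqrt 12 * sqrt (variance_limit + variance_error / real N + real q / real N))
      + real q / (2 * real N))"
    proof (rule window_average_le[OF \<phi> pq])
      show "\<bar>?X (Suc k) - ?X k - \<rho>\<bar> \<le> 1" for k
        using spacing_near[OF u t, of "int k"] by (simp add: add.commute)
      show "(\<Sum>k<N. (?X (Suc k) - ?X k - \<rho>)\<^sup>2) \<le> real N * (variance_limit + variance_error / real N)"
        using off_phase_variance[OF u, of N i] N by (simp add: add.commute)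
    qed (use N in simp)
    also have "\<dots> = real N * (I + dN N)" by (simp add: dN_def matching_cost_def)
    also have "\<dots> \<le> real N * (I + D\<^sup>2 / 4)" using N0[of N] N by (intro mult_left_mono) auto
    finally show "(\<Sum>k<N. \<phi> (?X k)) \<le> real N * (I + D\<^sup>2 / 4)" .
  qed
  then show ?thesis by (intro exI[of _ "max N0 1"]) blast
qed

text \<open>
  Summing \<open>period_gain\<close> over \<open>m\<close> periods and letting first \<open>m\<close> and then \<open>N\<close> tend to infinity removes the bounded
  errors. For \<open>D = 1\<close> equidistribution says nothing and holds trivially; this is the role of the cap \<open>1 / 4\<close> in \<open>d_FK\<close>.
\<close>

lemma rotation_lower_bound:
  assumes u: "linear_from \<rho> 0 c u"
    and \<omega>: "\<And>m k. \<bar>u (real m * P) k - u 0 k - real m * \<omega>\<bar> \<le> 2"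
    and \<beta>: "0 < \<beta>" and ab: "a < b" "b - a \<le> 1"
    and push: "\<And>x. a \<le> x \<Longrightarrow> x \<le> b \<Longrightarrow> dp + \<beta> \<le> \<kappa> * h x"
    and D: "0 < D" "D \<le> 1"
    and dev: "D = 1 \<or> (\<exists>p q. coprime p (int q) \<and> q \<ge> 1 \<and> matching_cost variance_limit p q < D\<^sup>2 / 4)"
  shows "b - a - 1 + (1 - D)\<^sup>2 / 2 - (max (b - a - \<beta> * \<tau> - D) 0)\<^sup>2 / 2 \<le> \<omega>" (is "?B \<le> \<omega>")
proof -
  obtain N0 where N0: "\<And>N i y n s. N \<ge> N0 \<Longrightarrow> (\<And>k. 0 < y k) \<Longrightarrow> (\<And>k. y k \<le> 1) \<Longrightarrow>
      (\<And>k. y k = u ((2 * real i + 1) * \<tau>) (int k) - a - of_int (n k)) \<Longrightarrow> 0 \<le> s \<Longrightarrow> s \<le> 1 \<Longrightarrow>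
      real N * (s - D) \<le> real (card {k\<in>{..<N}. y k \<le> s})"
  proof (cases "D = 1")
    case True
    show thesis
    proof (rule that[of 0])
      fix N :: nat and y :: "nat \<Rightarrow> real" and s :: real
      assume "s \<le> 1"
      then have "real N * (s - D) \<le> 0" using True by (simp add: mult_nonneg_nonpos)
      also have "0 \<le> real (card {k\<in>{..<N}. y k \<le> s})" by simp
      finally show "real N * (s - D) \<le> real (card {k\<in>{..<N}. y k \<le> s})" .
    qed
  next
    case False
    then obtain p q where "coprime p (int q)" "q \<ge> 1" "matching_cost variance_limit p q < D\<^sup>2 / 4"
      using dev by blast
    from eventually_equidistributed[OF u D(1) this] show thesis using that by blast
  qed
  have gain: "real m * (real N * ?B - 2 * dp * \<tau>) \<le> (\<Sum>k<N. u (real m * P) (int k) - u 0 (int k))"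
    if "N \<ge> N0" for N m
  proof (induction m)
    case (Suc m)
    have e: "(2 * real m + 2) * \<tau> = real (Suc m) * P" "2 * real m * \<tau> = real m * P"
      by (auto simp: P_eq algebra_simps)
    have "real N * ?B - 2 * dp * \<tau>
        \<le> (\<Sum>k<N. u ((2 * real m + 2) * \<tau>) (int k) - u (2 * real m * \<tau>) (int k))"
      by (rule period_gain[OF u \<beta> ab push D N0[OF that]])
    then have "real N * ?B - 2 * dp * \<tau> \<le> (\<Sum>k<N. u (real (Suc m) * P) (int k) - u (real m * P) (int k))"
      unfolding e .
    moreover have "(\<Sum>k<N. u (real (Suc m) * P) (int k) - u 0 (int k))
        = (\<Sum>k<N. u (real (Suc m) * P) (int k) - u (real m * P) (int k))
          + (\<Sum>k<N. u (real m * P) (int k) - u 0 (int k))"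
      by (simp flip: sum.distrib)
    ultimately show ?case using Suc.IH by (simp add: distrib_right)
  qed simp
  have le: "real N * (?B - \<omega>) \<le> 2 * dp * \<tau>" if "N \<ge> N0" for N
  proof (rule ccontr)
    assume "\<not> ?thesis"
    then have pos: "0 < real N * (?B - \<omega>) - 2 * dp * \<tau>" by simp
    obtain m where m: "2 * real N < real m * (real N * (?B - \<omega>) - 2 * dp * \<tau>)"
      using reals_Archimedean3[OF pos] by blast
    have "(\<Sum>k<N. u (real m * P) (int k) - u 0 (int k)) \<le> (\<Sum>k<N. real m * \<omega> + 2)"
    proof (rule sum_mono)
      show "u (real m * P) (int k) - u 0 (int k) \<le> real m * \<omega> + 2" for k
        using \<omega>[of m "int k"] by linarith
    qed
    then have "real m * (real N * ?B - 2 * dp * \<tau>) \<le> real N * (real m * \<omega> + 2)"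
      using gain[OF that, of m] by simp
    then show False using m by (simp add: algebra_simps)
  qed
  show ?thesis
  proof (rule ccontr)
    assume "\<not> ?thesis"
    then have pos: "0 < ?B - \<omega>" by simp
    obtain N where N: "2 * dp * \<tau> < real N * (?B - \<omega>)"
      using reals_Archimedean3[OF pos] by blast
    have "real N * (?B - \<omega>) \<le> real (max N N0) * (?B - \<omega>)" using pos by (intro mult_right_mono) auto
    then show False using le[of "max N N0"] N by linarith
  qed
qed

end

section \<open>The transport speed\<close>

lemma C2_derivs:
  assumes "C2 f"
  shows "(f has_real_derivative deriv f x) (at x)"
    and "(deriv f has_real_derivative deriv (deriv f) x) (at x)"
    and "continuous_on S (deriv (deriv f))"
  using assms unfolding C2_def
  by (auto simp: DERIV_deriv_iff_real_differentiable intro: continuous_on_subset)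

lemma lipschitz_of_deriv_bound:
  fixes f :: "real \<Rightarrow> real"
  assumes f: "\<And>x. (f has_real_derivative f' x) (at x)"
    and bound: "\<And>x. l \<le> x \<Longrightarrow> x \<le> r \<Longrightarrow> \<bar>f' x\<bar> \<le> A"
    and xy: "l \<le> x" "x \<le> r" "l \<le> y" "y \<le> r"
  shows "\<bar>f x - f y\<bar> \<le> A * \<bar>x - y\<bar>"
proof -
  have *: "\<bar>f y - f x\<bar> \<le> A * (y - x)" if "x \<le> y" "l \<le> x" "y \<le> r" for x y
  proof (rule bounded_change_off_finite[of "{}"])
    show "continuous_on {x..y} f"
      using f by (meson DERIV_isCont continuous_at_imp_continuous_on)
    show "\<exists>D. \<bar>D\<bar> \<le> A \<and> (f has_real_derivative D) (at z)" if "x < z" "z < y" for z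
      using f[of z] bound[of z] that \<open>l \<le> x\<close> \<open>y \<le> r\<close> by auto
  qed (use that in auto)
  show ?thesis
  proof (cases "x \<le> y")
    case True
    then show ?thesis using *[of x y] xy by (simp add: abs_minus_commute)
  next
    case False
    then show ?thesis using *[of y x] xy by simp
  qed
qed

lemma continuous_bounded_interval:
  fixes f :: "real \<Rightarrow> real"
  assumes "continuous_on {l..r} f"
  obtains B where "0 \<le> B" "\<And>x. l \<le> x \<Longrightarrow> x \<le> r \<Longrightarrow> \<bar>f x\<bar> \<le> B"
proof -
  have "bounded (f ` {l..r})" by (intro compact_imp_bounded compact_continuous_image assms) simp
  then obtain B where B: "\<And>y. y \<in> f ` {l..r} \<Longrightarrow> norm y \<le> B" unfolding bounded_iff by blast
  show thesis
  proof (rule that[of "\<bar>B\<bar>"])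
    show "\<bar>f x\<bar> \<le> \<bar>B\<bar>" if "l \<le> x" "x \<le> r" for x
      using B[of "f x"] that by simp
  qed simp
qed

lemma periodic_bounded:
  fixes f :: "real \<Rightarrow> real"
  assumes "continuous_on {0..1} f" and per: "\<And>x. f (x + 1) = f x"
  obtains B where "\<And>x. \<bar>f x\<bar> \<le> B"
proof -
  obtain B where B: "\<And>x. 0 \<le> x \<Longrightarrow> x \<le> 1 \<Longrightarrow> \<bar>f x\<bar> \<le> B"
    using continuous_bounded_interval[OF assms(1)] by blast
  have "\<bar>f x\<bar> \<le> B" for x
    using B[of "frac x"] periodic_int[of f, OF per, of "frac x" "\<lfloor>x\<rfloor>"] frac_ge_0[of x] frac_lt_1[of x]
    by (simp add: frac_def)
  then show thesis by (rule that)
qed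

lemma deriv_periodic:
  fixes f :: "real \<Rightarrow> real"
  assumes "\<And>x. f (x + 1) = f x" and "\<And>x. (f has_real_derivative deriv f x) (at x)"
  shows "deriv f (x + 1) = deriv f x"
proof -
  have "((\<lambda>x. f (x + 1)) has_real_derivative deriv f (x + 1)) (at x)"
    using assms(2)[of "x + 1"] by (simp add: DERIV_shift)
  then have "(f has_real_derivative deriv f (x + 1)) (at x)" using assms(1) by simp
  then show ?thesis by (rule DERIV_imp_deriv[symmetric])
qed

theorem theorem2p2:
  fixes W V K :: "real \<Rightarrow> real"
    and \<rho> \<tau> \<kappa> \<alpha> \<beta> a b :: real
  assumes W_C2: "C2 W"
    and W_convex: "\<exists>c>0. \<forall>x. deriv (deriv W) x \<ge> c"
    and V_C2: "C2 V"
    and V_periodic: "\<forall>x. V (x + 1) = V x"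
    and tau: "\<tau> > 0"
    and kappa: "\<kappa> \<ge> 0"
    and K_off: "\<forall>n::int. \<forall>t\<in>{2 * of_int n * \<tau>..<(2 * of_int n + 1) * \<tau>}. K t = 0"
    and K_on: "\<forall>n::int. \<forall>t\<in>{(2 * of_int n + 1) * \<tau>..<(2 * of_int n + 2) * \<tau>}. K t = \<kappa>"
    and beta: "\<beta> > 0"
    and alpha: "0 < \<alpha>" "\<alpha> < 1 / 2"
    and ab: "1 / 2 + \<alpha> \<le> b - a" "b - a < 1"
    and force: "\<forall>x\<in>{a..b}. \<kappa> * deriv V x \<ge> delta_plus W \<rho> + \<beta>"
  shows "transport_speed W V K \<tau> \<rho> \<ge>
    1 / \<tau> * (\<alpha> / 2 - sqrt (d_FK W \<rho> \<tau>) + d_FK W \<rho> \<tau>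
      - 1 / 4 * (max (1 / 2 + \<alpha> - \<beta> * \<tau> - 2 * sqrt (d_FK W \<rho> \<tau>)) 0)\<^sup>2)"
proof -
  note W' = C2_derivs[OF W_C2] and V' = C2_derivs[OF V_C2]
  obtain cW where cW: "cW > 0" "\<And>x. cW \<le> deriv (deriv W) x" using W_convex by blast
  have V_per: "V (x + 1) = V x" for x using V_periodic by simp
  have dV_per: "deriv V (x + 1) = deriv V x" for x by (rule deriv_periodic[OF V_per V'(1)])
  have ddV_per: "deriv (deriv V) (x + 1) = deriv (deriv V) x" for x
    by (rule deriv_periodic[OF dV_per V'(2)])
  have dV_cont: "continuous_on S (deriv V)" for S
    using V'(2) by (meson DERIV_isCont continuous_at_imp_continuous_on)
  obtain H where H: "\<And>x. \<bar>deriv V x\<bar> \<le> H" using periodic_bounded[OF dV_cont dV_per] by blast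
  obtain L where L: "\<And>x. \<bar>deriv (deriv V) x\<bar> \<le> L" using periodic_bounded[OF V'(3) ddV_per] by blast

  have fl: "of_int \<lfloor>t / \<tau>\<rfloor> * \<tau> \<le> t" "t < (of_int \<lfloor>t / \<tau>\<rfloor> + 1) * \<tau>" for t
    using iffD1[OF pos_le_divide_eq[OF tau] of_int_floor_le]
      iffD1[OF pos_divide_less_eq[OF tau] conjunct2[OF floor_correct]] by auto
  have K_eq: "K t = (if even \<lfloor>t / \<tau>\<rfloor> then 0 else \<kappa>)" for t
  proof -
    show ?thesis
    proof (cases "even \<lfloor>t / \<tau>\<rfloor>")
      case True
      then obtain n where n: "\<lfloor>t / \<tau>\<rfloor> = 2 * n" by blast
      have "t \<in> {2 * of_int n * \<tau>..<(2 * of_int n + 1) * \<tau>}" using fl[of t] by (simp add: n)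
      then show ?thesis using K_off True by auto
    next
      case False
      then obtain n where n: "\<lfloor>t / \<tau>\<rfloor> = 2 * n + 1" using oddE by blast
      have "t \<in> {(2 * of_int n + 1) * \<tau>..<(2 * of_int n + 2) * \<tau>}" using fl[of t] by (simp add: n add.assoc)
      then show ?thesis using K_on False by auto
    qed
  qed
  have K_floor: "isCont K t" if "t / \<tau> \<noteq> of_int \<lfloor>t / \<tau>\<rfloor>" for t
  proof -
    define m where "m = \<lfloor>t / \<tau>\<rfloor>"
    have "t \<in> {of_int m * \<tau><..<(of_int m + 1) * \<tau>}"
      using fl[of t] that tau by (auto simp: m_def field_simps less_le)
    then have "eventually (\<lambda>s. s \<in> {of_int m * \<tau><..<(of_int m + 1) * \<tau>}) (nhds t)"
      by (intro eventually_nhds_in_open) auto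
    then have "eventually (\<lambda>s. K s = (if even m then 0 else \<kappa>)) (nhds t)"
    proof eventually_elim
      case (elim s)
      then have "\<lfloor>s / \<tau>\<rfloor> = m" using tau by (intro floor_unique) (auto simp: field_simps)
      then show ?case by (simp add: K_eq)
    qed
    then show ?thesis using isCont_cong[of K "\<lambda>_. if even m then 0 else \<kappa>" t] by simp
  qed
  have K_jumps: "finite {t\<in>{s..s'}. \<not> isCont K t}" for s s'
  proof (rule finite_subset)
    show "{t\<in>{s..s'}. \<not> isCont K t} \<subseteq> (\<lambda>n. of_int n * \<tau>) ` {\<lfloor>s / \<tau>\<rfloor>..\<lfloor>s' / \<tau>\<rfloor>}"
    proof
      fix t assume t: "t \<in> {t\<in>{s..s'}. \<not> isCont K t}"
      then have "t / \<tau> = of_int \<lfloor>t / \<tau>\<rfloor>" using K_floor by blast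
      then have "t = of_int \<lfloor>t / \<tau>\<rfloor> * \<tau>" using tau by (simp add: field_simps)
      moreover have "\<lfloor>t / \<tau>\<rfloor> \<in> {\<lfloor>s / \<tau>\<rfloor>..\<lfloor>s' / \<tau>\<rfloor>}"
        using t tau by (auto intro!: floor_mono divide_right_mono)
      ultimately show "t \<in> (\<lambda>n. of_int n * \<tau>) ` {\<lfloor>s / \<tau>\<rfloor>..\<lfloor>s' / \<tau>\<rfloor>}" by (rule image_eqI)
    qed
  qed simp
  have K_meas: "K \<in> borel_measurable borel"
  proof -
    have "(\<lambda>t. if even \<lfloor>t / \<tau>\<rfloor> then 0 else \<kappa>) \<in> borel_measurable borel" by measurable
    moreover have "K = (\<lambda>t. if even \<lfloor>t / \<tau>\<rfloor> then 0 else \<kappa>)" using K_eq by auto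
    ultimately show ?thesis by simp
  qed

  define dm where "dm = delta_minus W \<rho>"
  define dp where "dp = delta_plus W \<rho>"
  obtain B2 where B2: "\<And>x. \<rho> - 1 \<le> x \<Longrightarrow> x \<le> \<rho> + 1 \<Longrightarrow> \<bar>deriv (deriv W) x\<bar> \<le> B2"
    using continuous_bounded_interval[OF W'(3)] by blast
  have dm_le: "dm \<le> deriv (deriv W) x" and le_dp: "deriv (deriv W) x \<le> dp"
    if "\<rho> - 1 \<le> x" "x \<le> \<rho> + 1" for x
  proof -
    have "bdd_below (deriv (deriv W) ` {\<rho> - 1..\<rho> + 1})" using cW(2) by (intro bdd_belowI2) auto
    then show "dm \<le> deriv (deriv W) x"
      unfolding dm_def delta_minus_def by (rule cINF_lower) (use that in auto)
    have "bdd_above (deriv (deriv W) ` {\<rho> - 1..\<rho> + 1})"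
      using B2 by (intro bdd_aboveI2[of _ _ B2]) (auto simp: abs_le_iff)
    then show "deriv (deriv W) x \<le> dp"
      unfolding dp_def delta_plus_def by (intro cSUP_upper) (use that in auto)
  qed
  have "cW \<le> dm" unfolding dm_def delta_minus_def by (rule cINF_greatest) (use cW in auto)
  then have dm_pos: "0 < dm" using cW by simp

  interpret pulsed_chain "deriv W" "deriv V" K L H \<kappa> "2 * \<tau>" W \<tau> dm dp \<rho>
  proof
    show "deriv W x \<le> deriv W y" if "x \<le> y" for x y
      by (rule DERIV_nonneg_imp_nondecreasing[OF that]) (use W'(2) cW in \<open>meson less_le_trans less_imp_le\<close>)
    show "\<exists>A\<ge>0. \<forall>x y. \<bar>x\<bar> \<le> B \<longrightarrow> \<bar>y\<bar> \<le> B \<longrightarrow> \<bar>deriv W x - deriv W y\<bar> \<le> A * \<bar>x - y\<bar>" for B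
    proof -
      obtain A where A: "0 \<le> A" "\<And>x. - B \<le> x \<Longrightarrow> x \<le> B \<Longrightarrow> \<bar>deriv (deriv W) x\<bar> \<le> A"
        using continuous_bounded_interval[OF W'(3)] by blast
      have "\<bar>deriv W x - deriv W y\<bar> \<le> A * \<bar>x - y\<bar>" if "\<bar>x\<bar> \<le> B" "\<bar>y\<bar> \<le> B" for x y
        by (rule lipschitz_of_deriv_bound[OF W'(2) A(2)]) (use that in auto)
      then show ?thesis using A(1) by blast
    qed
    show "\<bar>deriv V x - deriv V y\<bar> \<le> L * \<bar>x - y\<bar>" for x y
      by (rule lipschitz_of_deriv_bound[where l = "min x y" and r = "max x y", OF V'(2) L]) auto
    show "\<bar>K t\<bar> \<le> \<kappa>" for t using K_eq kappa by auto
    show "K (t + 2 * \<tau>) = K t" for t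
    proof -
      have "(t + 2 * \<tau>) / \<tau> = t / \<tau> + of_int 2" using tau by (simp add: field_simps)
      then have "\<lfloor>(t + 2 * \<tau>) / \<tau>\<rfloor> = \<lfloor>t / \<tau>\<rfloor> + 2" by (simp only: floor_add_int)
      then show ?thesis by (simp add: K_eq)
    qed
    show "K t = 0" if "2 * real i * \<tau> < t" "t < (2 * real i + 1) * \<tau>" for i t
      using K_off[THEN spec[of _ "int i"]] that by auto
    show "K t = \<kappa>" if "(2 * real i + 1) * \<tau> < t" "t < (2 * real i + 2) * \<tau>" for i t
      using K_on[THEN spec[of _ "int i"]] that by auto
    show "dm * (y - x) \<le> deriv W y - deriv W x \<and> deriv W y - deriv W x \<le> dp * (y - x)"
      if xy: "\<rho> - 1 \<le> x" "x \<le> y" "y \<le> \<rho> + 1" for x y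
    proof
      have "(\<lambda>z. dm * z) y - (\<lambda>z. dm * z) x \<le> deriv W y - deriv W x"
        by (rule deriv_le_imp_diff_le[OF xy(2) DERIV_cmult_Id W'(2)]) (use dm_le xy in auto)
      then show "dm * (y - x) \<le> deriv W y - deriv W x" by (simp add: right_diff_distrib)
      have "deriv W y - deriv W x \<le> (\<lambda>z. dp * z) y - (\<lambda>z. dp * z) x"
        by (rule deriv_le_imp_diff_le[OF xy(2) W'(2) DERIV_cmult_Id]) (use le_dp xy in auto)
      then show "deriv W y - deriv W x \<le> dp * (y - x)" by (simp add: right_diff_distrib)
    qed
  qed (use H dV_per K_jumps K_meas tau W'(1) dm_pos in auto)

  have FK_iff: "FK_solution W V K t0 u \<longleftrightarrow> solution t0 u" for t0 u
    unfolding FK_solution_def solution_def force_def by simp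
  obtain \<omega> where \<omega>: "\<And>t0 u n m k. solution t0 u \<Longrightarrow> bounded_width \<rho> n (u t0) \<Longrightarrow>
      \<bar>u (t0 + real m * (2 * \<tau>)) k - u t0 k - real m * \<omega>\<bar> \<le> real n + 2"
    using bounded_width_rotation[of \<rho>] by blast
  obtain u where u: "linear_from \<rho> 0 0 u" using linear_exists[OF K_meas] by blast
  have u_width: "bounded_width \<rho> n (u 0)" for n
    unfolding bounded_width_def linear_fromD(2)[OF u] by (simp add: algebra_simps)
  have u\<omega>: "\<bar>u (real m * (2 * \<tau>)) k - u 0 k - real m * \<omega>\<bar> \<le> 2" for m k
    using \<omega>[OF linear_fromD(1)[OF u] u_width[of 0], of m k] by simp

  \<comment> \<open>The speed is the advance per period \<open>\<omega>\<close> divided by the period \<open>2 \<tau>\<close>.\<close>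
  have speed: "transport_speed W V K \<tau> \<rho> = \<omega> / (2 * \<tau>)"
    unfolding transport_speed_def
  proof (rule the_equality)
    show "is_transport_speed W V K \<tau> \<rho> (\<omega> / (2 * \<tau>))"
      unfolding is_transport_speed_def
    proof (intro allI impI)
      fix t0 u n and k m :: int
      assume A: "1 \<le> n \<and> FK_solution W V K t0 u \<and> bounded_width \<rho> n (u t0)" and m: "1 \<le> m"
      define x where "x = u (t0 + 2 * of_int m * \<tau>) k - u t0 k"
      have "\<bar>x - of_int m * \<omega>\<bar> \<le> real n + 2"
        using \<omega>[of t0 u n "nat m" k] A m by (simp add: FK_iff x_def mult_ac)
      moreover have pos: "0 < 2 * of_int m * \<tau>" using m tau by simp
      moreover have "x / (2 * of_int m * \<tau>) - \<omega> / (2 * \<tau>) = (x - of_int m * \<omega>) / (2 * of_int m * \<tau>)"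
        using m tau by (simp add: field_simps)
      ultimately show "\<bar>(u (t0 + 2 * of_int m * \<tau>) k - u t0 k) / (2 * of_int m * \<tau>) - \<omega> / (2 * \<tau>)\<bar>
          \<le> (real n + 2) / (2 * of_int m * \<tau>)"
        unfolding x_def[symmetric] by (simp only: abs_divide abs_of_pos) (rule divide_right_mono, auto)
    qed
    fix v assume v: "is_transport_speed W V K \<tau> \<rho> v"
    show "v = \<omega> / (2 * \<tau>)"
    proof (rule ccontr)
      assume ne: "v \<noteq> \<omega> / (2 * \<tau>)"
      have "0 < \<bar>2 * \<tau> * v - \<omega>\<bar>" using ne tau by (auto simp: field_simps)
      then obtain m where m: "5 < real m * \<bar>2 * \<tau> * v - \<omega>\<bar>" using reals_Archimedean3 by blast
      have m0: "0 < m" using m by (cases m) auto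
      define x where "x = u (2 * real m * \<tau>) 0 - u 0 0"
      have "\<bar>x / (2 * real m * \<tau>) - v\<bar> \<le> 3 / (2 * real m * \<tau>)"
        using v[unfolded is_transport_speed_def, rule_format, of 1 0 u "int m" 0]
          linear_fromD(1)[OF u] u_width m0 by (simp add: FK_iff x_def)
      moreover have pos: "0 < 2 * real m * \<tau>" using m0 tau by simp
      moreover have "x / (2 * real m * \<tau>) - v = (x - real m * (2 * \<tau> * v)) / (2 * real m * \<tau>)"
        using m0 tau by (simp add: field_simps)
      ultimately have "\<bar>x - real m * (2 * \<tau> * v)\<bar> \<le> 3"
        by (simp only: abs_divide abs_of_pos divide_le_cancel)
      moreover have "\<bar>x - real m * \<omega>\<bar> \<le> 2" using u\<omega>[of m 0] by (simp add: x_def mult_ac)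
      ultimately have "\<bar>real m * (2 * \<tau> * v) - real m * \<omega>\<bar> \<le> 5" by linarith
      then show False using m by (simp add: abs_mult flip: right_diff_distrib)
    qed
  qed

  \<comment> \<open>The forcing interval is shortened to length exactly \<open>1 / 2 + \<alpha>\<close>.\<close>
  define l where "l = 1 / 2 + \<alpha>"
  have push: "dp + \<beta> \<le> \<kappa> * deriv V x" if "a \<le> x" "x \<le> a + l" for x
    using force that ab by (auto simp: dp_def l_def)
  define B where "B D = l - 1 + (1 - D)\<^sup>2 / 2 - (max (l - \<beta> * \<tau> - D) 0)\<^sup>2 / 2" for D
  have bound: "B D \<le> \<omega>" if "0 < D" "D \<le> 1"
    "D = 1 \<or> (\<exists>p q. coprime p (int q) \<and> q \<ge> 1 \<and> matching_cost variance_limit p q < D\<^sup>2 / 4)" for D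
  proof -
    have "a < a + l" "a + l - a \<le> 1" using alpha by (auto simp: l_def)
    from rotation_lower_bound[OF u u\<omega> beta this push that] show ?thesis by (simp add: B_def)
  qed

  define f where "f p q = 1 / (4 * of_int q) + of_int q / 4 * \<bar>of_int p / of_int q - \<rho>\<bar>
      + of_int q / sqrt 12 * (dp / sqrt (2 * dm ^ 3 * \<tau> + dp * dm))" for p q :: int
  define S where "S = {(p :: int, q :: int). coprime p q \<and> q \<ge> 1}"
  define d where "d = d_FK W \<rho> \<tau>"
  have d_eq: "d = min (INF (p, q)\<in>S. f p q) (1 / 4)"
    unfolding d_def d_FK_def S_def f_def dm_def dp_def ..
  have f_eq: "matching_cost variance_limit p (nat q) = f p q" if "q \<ge> 1" for p q
    using that dp_pos
    by (simp add: matching_cost_def variance_limit_def f_def real_sqrt_divide)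
  have f0: "0 \<le> f p q" if "q \<ge> 1" for p q
    using that dp_pos dm_pos tau by (simp add: f_def)
  have "(0, 1) \<in> S" by (simp add: S_def)
  then have S_ne: "S \<noteq> {}" by blast
  have inf0: "0 \<le> (INF (p, q)\<in>S. f p q)"
    by (rule cINF_greatest[OF S_ne]) (auto simp: S_def f0)
  define D0 where "D0 = 2 * sqrt d"
  have d0: "0 \<le> d" "d \<le> 1 / 4" using inf0 by (auto simp: d_eq)
  have "sqrt d \<le> sqrt (1 / 4)" using d0 by (intro real_sqrt_le_mono)
  then have D0: "0 \<le> D0" "D0 \<le> 1" using d0 by (auto simp: D0_def real_sqrt_divide)
  \<comment> \<open>If \<open>D0 < 1\<close>, the bound holds for each \<open>D\<close> between \<open>D0\<close> and 1, since such a \<open>D\<close> leaves room for some \<open>p / q\<close> close to the infimum; \<open>B\<close> is continuous.\<close>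
  have "B D0 \<le> \<omega>"
  proof (cases "D0 = 1")
    case True
    then show ?thesis using bound[of 1] by simp
  next
    case False
    then have "D0 < 1" using D0 by simp
    have "B D \<le> \<omega>" if D: "D0 < D" "D < 1" for D
    proof -
      have "d < D\<^sup>2 / 4"
      proof -
        have "D0\<^sup>2 < D\<^sup>2" using D D0 by (intro power_strict_mono) auto
        then show ?thesis using d0 by (simp add: D0_def power_mult_distrib)
      qed
      moreover have "D\<^sup>2 / 4 \<le> 1 / 4" using D D0 by (simp add: power_le_one)
      ultimately have "(INF (p, q)\<in>S. f p q) < D\<^sup>2 / 4" unfolding d_eq by linarith
      moreover have "bdd_below ((\<lambda>(p, q). f p q) ` S)"
        by (rule bdd_belowI2[of _ 0]) (auto simp: S_def f0)
      ultimately have "\<exists>z\<in>S. (\<lambda>(p, q). f p q) z < D\<^sup>2 / 4"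
        using cINF_less_iff[OF S_ne, of "\<lambda>(p, q). f p q"] by blast
      then obtain p q where "(p, q) \<in> S" "f p q < D\<^sup>2 / 4" by auto
      then have "coprime p (int (nat q))" "nat q \<ge> 1" "matching_cost variance_limit p (nat q) < D\<^sup>2 / 4"
        by (auto simp: S_def f_eq)
      then have "\<exists>p q. coprime p (int q) \<and> q \<ge> 1 \<and> matching_cost variance_limit p q < D\<^sup>2 / 4"
        by blast
      moreover have "0 < D" "D \<le> 1" using D D0 by auto
      ultimately show ?thesis by (intro bound disjI2)
    qed
    then have "eventually (\<lambda>D. B D \<le> \<omega>) (at_right D0)"
      unfolding eventually_at_right_field using \<open>D0 < 1\<close> by blast
    moreover have "(B \<longlongrightarrow> B D0) (at_right D0)"
      unfolding B_def by (intro tendsto_intros) auto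
    ultimately show ?thesis by (intro tendsto_upperbound[of B]) auto
  qed
  then have "B D0 / (2 * \<tau>) \<le> transport_speed W V K \<tau> \<rho>"
    unfolding speed using tau by (intro divide_right_mono) auto
  moreover have "B D0 / (2 * \<tau>) = 1 / \<tau> * (\<alpha> / 2 - sqrt d + d
      - 1 / 4 * (max (1 / 2 + \<alpha> - \<beta> * \<tau> - 2 * sqrt d) 0)\<^sup>2)"
  proof -
    have "(1 - D0)\<^sup>2 = 1 - 4 * sqrt d + 4 * d"
      using d0 by (simp add: D0_def power2_diff power_mult_distrib)
    then have "B D0 = 2 * (\<alpha> / 2 - sqrt d + d
        - 1 / 4 * (max (1 / 2 + \<alpha> - \<beta> * \<tau> - 2 * sqrt d) 0)\<^sup>2)"
      unfolding B_def l_def by (simp add: D0_def add_divide_distrib diff_divide_distrib)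
    moreover have "2 * E / (2 * \<tau>) = 1 / \<tau> * E" for E by simp
    ultimately show ?thesis by (simp only:)
  qed
  ultimately show ?thesis unfolding d_def by simp
qed

end
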